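(* Let a countable amenable group $G$ act freely (by homeomorphisms) on a zero-dimensional compact metric space $X$. Then the action has a tiling system as a topological factor if and only if it admits comparison. Moreover, the forward implication (if the action has a tiling system as a topological factor, then it admits comparison) holds for every action of $G$ on a zero-dimensional compact metric space, without assuming that the action is free.
   Context: "Countable" means infinite countable and discrete. All systems are actions of $G$ by homeomorphisms on (nonempty) compact metric spaces. The action is *free* if $g(x)=x$ for at least one $x\in X$ implies $g=e$. A system $Z$ is a *topological factor* of $X$ if there is a continuous equivariant surjection $X\to Z$. A finite $F\subset G$ is $(K,\varepsilon)$-invariant if $|KF\triangle F|<\varepsilon|F|$; $G$ is amenable if it has a Følner sequence, i.e. a sequence of finite sets which, for all finite $K\subset G$ and $\varepsilon>0$, are eventually $(K,\varepsilon)$-invariant. **Comparison.** For clopen $\mathsf A,\mathsf B\subset X$, write $\mathsf A\preccurlyeq\mathsf B$ if there are a finite partition $\mathsf A=\bigcup_{i=1}^k\mathsf A_i$ into clopen sets and $g_1,\dots,g_k\in G$ such that $g_1(\mathsf A_1),\dots,g_k(\mathsf A_k)$ are disjoint subsets of $\mathsf B$. The action *admits comparison* if for any clopen $\mathsf A,\mathsf B\subset X$, the condition $\mu(\mathsf A)<\mu(\mathsf B)$ for every $G$-invariant Borel probability measure $\mu$ on $X$ implies $\mathsf A\preccurlyeq\mathsf B$. **Tiling systems.** For finite $\Lambda$, $G$ acts on $\Lambda^G$ by $(g(x))_f=x_{fg}$; a *subshift* is a nonempty closed invariant subset of $\Lambda^G$. A *joining* of countably many systems is a closed invariant subset of their product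 projecting onto every coordinate. Let $\mathcal S$ be a finite collection of finite subsets of $G$ ("shapes"), each containing the unity $e$; the same set may be repeated in $\mathcal S$ under different labels and then the copies are treated as different shapes. Let $\mathrm V=\{``S":S\in\mathcal S\}\cup\{0\}$. An element $\mathcal T\in \mathrm V^G$ is identified with the quasitiling whose tiles are the sets $Sc$ (with shape $S$ and center $c$) for all $c\in G$, $S\in\mathcal S$ with $\mathcal T_c=``S"$. It is a *tiling* if its tiles form a partition of $G$. A *dynamical tiling* is a subshift $\mathbb T\subset\mathrm V^G$ all of whose elements are tilings; its collection of shapes is $\mathcal S$. A *Følner system of tilings* is a joining $\mathbf T=\bigvee_{k\in\mathbb N}\mathbb T_k$ of dynamical tilings with collections of shapes $\mathcal S_k$ such that for every finite $K\subset G$ and $\varepsilon>0$, for all large $k$ all shapes in $\mathcal S_k$ are $(K,\varepsilon)$-invariant. It is *congruent* if for every $(\mathcal T_k)_{k}\in\mathbf T$ and $k$, every tile of $\mathcal T_{k+1}$ is a union of tiles of $\mathcal T_k$; a congruent one is *deterministic* if for each $k$ and $S'\in\mathcal S_{k+1}$ there are sets $C_S(S')\subset S'$ ($S\in\mathcal S_k$) such that $S'=\bigcup_{S\in\mathcal S_k}\bigcup_{c\in C_S(S')}Sc$ is a disjoint union and, for every $(\mathcal T_k)_k\in\mathbf T$, whenever $S'c'$ is a tile of $\mathcal T_{k+1}$ (of shape $S'$, centered at $c'$), the sets $Scc'$ with $S\in\mathcal S_k$, $c\in C_S(S')$ are tiles of $\mathcal T_k$ (of shape $S$, centered at $cc'$).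 A *tiling system* is a congruent, deterministic Følner system of tilings, regarded as a topological dynamical system. *)

theory Defs
  imports "HOL-Analysis.Analysis" "HOL-Probability.Probability" "HOL-Algebra.Group_Action"
begin

section \<open>Systems, factors, joinings\<close>

text \<open>Library group actions are extensional: \<open>\<phi> g\<close> is a bijection of \<open>X\<close> with
  value \<open>undefined\<close> off \<open>X\<close>, and all statements below only concern points of \<open>X\<close>.\<close>

locale topological_system = group_action G X \<phi>
  for G (structure) and X :: "'x::topological_space set" and \<phi> +
  assumes compact_space: "compact X"
    and nonempty_space: "X \<noteq> {}"
    and homeomorphisms: "g \<in> carrier G \<Longrightarrow> \<exists>\<psi>. homeomorphism X X (\<phi> g) \<psi>"

definition free_system :: "('g, 'm) monoid_scheme \<Rightarrow> 'x set \<Rightarrow> ('g \<Rightarrow> 'x \<Rightarrow> 'x) \<Rightarrow> bool" where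
  "free_system G X \<phi> \<longleftrightarrow> (\<forall>g\<in>carrier G. (\<exists>x\<in>X. \<phi> g x = x) \<longrightarrow> g = \<one>\<^bsub>G\<^esub>)"

definition clopen_in :: "'x::topological_space set \<Rightarrow> 'x set \<Rightarrow> bool" where
  "clopen_in X A \<longleftrightarrow> openin (top_of_set X) A \<and> closedin (top_of_set X) A"

text \<open>Zero-dimensional means that the clopen sets form a base of the topology.\<close>

definition zero_dimensional :: "'x::topological_space set \<Rightarrow> bool" where
  "zero_dimensional X \<longleftrightarrow>
     (\<forall>U x. openin (top_of_set X) U \<and> x \<in> U \<longrightarrow> (\<exists>B. clopen_in X B \<and> x \<in> B \<and> B \<subseteq> U))"

definition factor_map ::
  "('g, 'm) monoid_scheme \<Rightarrow> 'x::topological_space set \<Rightarrow> ('g \<Rightarrow> 'x \<Rightarrow> 'x) \<Rightarrow>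
   'z::topological_space set \<Rightarrow> ('g \<Rightarrow> 'z \<Rightarrow> 'z) \<Rightarrow> ('x \<Rightarrow> 'z) \<Rightarrow> bool" where
  "factor_map G X \<phi> Z \<psi> \<pi> \<longleftrightarrow>
     continuous_on X \<pi> \<and> \<pi> ` X = Z \<and> (\<forall>g\<in>carrier G. \<forall>x\<in>X. \<pi> (\<phi> g x) = \<psi> g (\<pi> x))"

definition topological_factor ::
  "('g, 'm) monoid_scheme \<Rightarrow> 'x::topological_space set \<Rightarrow> ('g \<Rightarrow> 'x \<Rightarrow> 'x) \<Rightarrow>
   'z::topological_space set \<Rightarrow> ('g \<Rightarrow> 'z \<Rightarrow> 'z) \<Rightarrow> bool" where
  "topological_factor G X \<phi> Z \<psi> \<longleftrightarrow> (\<exists>\<pi>. factor_map G X \<phi> Z \<psi> \<pi>)"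

definition product_action :: "('g \<Rightarrow> 'y \<Rightarrow> 'y) \<Rightarrow> 'g \<Rightarrow> (nat \<Rightarrow> 'y) \<Rightarrow> (nat \<Rightarrow> 'y)" where
  "product_action \<psi> g z = (\<lambda>k. \<psi> g (z k))"

definition joining ::
  "('g, 'm) monoid_scheme \<Rightarrow> ('g \<Rightarrow> 'y \<Rightarrow> 'y) \<Rightarrow> (nat \<Rightarrow> 'y::topological_space set) \<Rightarrow>
   (nat \<Rightarrow> 'y) set \<Rightarrow> bool" where
  "joining G \<psi> Y Z \<longleftrightarrow>
     closedin (top_of_set (\<Pi>\<^sub>E k\<in>UNIV. Y k)) Z \<and>
     (\<forall>g\<in>carrier G. \<forall>z\<in>Z. product_action \<psi> g z \<in> Z) \<and>
     (\<forall>k. (\<lambda>z. z k) ` Z = Y k)"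


section \<open>Comparison\<close>

definition invariant_prob ::
  "('g, 'm) monoid_scheme \<Rightarrow> 'x::topological_space set \<Rightarrow> ('g \<Rightarrow> 'x \<Rightarrow> 'x) \<Rightarrow> 'x measure \<Rightarrow> bool" where
  "invariant_prob G X \<phi> \<mu> \<longleftrightarrow>
     prob_space \<mu> \<and> sets \<mu> = sets (restrict_space borel X) \<and>
     (\<forall>g\<in>carrier G. distr \<mu> \<mu> (\<phi> g) = \<mu>)"

text \<open>Pieces of the partition are allowed to be empty; this changes nothing, and makes
  the empty set subequivalent to every clopen set.\<close>

definition subequivalent ::
  "('g, 'm) monoid_scheme \<Rightarrow> 'x::topological_space set \<Rightarrow> ('g \<Rightarrow> 'x \<Rightarrow> 'x) \<Rightarrow>
   'x set \<Rightarrow> 'x set \<Rightarrow> bool" where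
  "subequivalent G X \<phi> A B \<longleftrightarrow>
     (\<exists>(n::nat) P g.
        (\<forall>i<n. clopen_in X (P i) \<and> g i \<in> carrier G \<and> \<phi> (g i) ` P i \<subseteq> B) \<and>
        A = (\<Union>i<n. P i) \<and> disjoint_family_on P {..<n} \<and>
        disjoint_family_on (\<lambda>i. \<phi> (g i) ` P i) {..<n})"

definition admits_comparison ::
  "('g, 'm) monoid_scheme \<Rightarrow> 'x::topological_space set \<Rightarrow> ('g \<Rightarrow> 'x \<Rightarrow> 'x) \<Rightarrow> bool" where
  "admits_comparison G X \<phi> \<longleftrightarrow>
     (\<forall>A B. clopen_in X A \<and> clopen_in X B \<and>
        (\<forall>\<mu>. invariant_prob G X \<phi> \<mu> \<longrightarrow> measure \<mu> A < measure \<mu> B) \<longrightarrow>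
        subequivalent G X \<phi> A B)"


section \<open>Amenability\<close>

definition Folner_invariant ::
  "('g, 'm) monoid_scheme \<Rightarrow> 'g set \<Rightarrow> real \<Rightarrow> 'g set \<Rightarrow> bool" where
  "Folner_invariant G K \<epsilon> F \<longleftrightarrow>
     finite F \<and> F \<subseteq> carrier G \<and> real (card (sym_diff (K <#>\<^bsub>G\<^esub> F) F)) < \<epsilon> * real (card F)"

text \<open>Here and in \<open>Folner_system\<close> the finite set \<open>K\<close> must be nonempty: for \<open>K = {}\<close> and
  \<open>\<epsilon> \<le> 1\<close> no set is \<open>(K, \<epsilon>)\<close>-invariant.\<close>

definition Folner_sequence :: "('g, 'm) monoid_scheme \<Rightarrow> (nat \<Rightarrow> 'g set) \<Rightarrow> bool" where
  "Folner_sequence G F \<longleftrightarrow>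
     (\<forall>n. finite (F n) \<and> F n \<subseteq> carrier G) \<and>
     (\<forall>K \<epsilon>. finite K \<and> K \<noteq> {} \<and> K \<subseteq> carrier G \<and> \<epsilon> > 0 \<longrightarrow>
        (\<forall>\<^sub>F n in sequentially. Folner_invariant G K \<epsilon> (F n)))"

definition amenable :: "('g, 'm) monoid_scheme \<Rightarrow> bool" where
  "amenable G \<longleftrightarrow> (\<exists>F. Folner_sequence G F)"


section \<open>Tiling systems\<close>

definition shift :: "('g, 'm) monoid_scheme \<Rightarrow> 'g \<Rightarrow> ('g \<Rightarrow> 'l) \<Rightarrow> ('g \<Rightarrow> 'l)" where
  "shift G g x = (\<lambda>f\<in>carrier G. x (f \<otimes>\<^bsub>G\<^esub> g))"

text \<open>Configurations over \<open>\<Lambda>\<close> are extensional functions on \<open>carrier G\<close>; since they are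
  constant elsewhere, the topology of pointwise convergence on them is the product of the
  discrete topologies.\<close>

definition subshift ::
  "('g, 'm) monoid_scheme \<Rightarrow> 'l::discrete_topology set \<Rightarrow> ('g \<Rightarrow> 'l) set \<Rightarrow> bool" where
  "subshift G \<Lambda> T \<longleftrightarrow>
     T \<noteq> {} \<and> closedin (top_of_set (carrier G \<rightarrow>\<^sub>E \<Lambda>)) T \<and>
     (\<forall>g\<in>carrier G. \<forall>x\<in>T. shift G g x \<in> T)"

text \<open>A finite collection of shapes, possibly with repetitions, is given by a finite set
  \<open>L\<close> of nonzero natural numbers (the labels) and the shape \<open>sh l\<close> carried by each label
  \<open>l \<in> L\<close>. The symbol of a shape is its label, so that the alphabet is \<open>insert 0 L\<close>.\<close>

definition shape_collection ::
  "('g, 'm) monoid_scheme \<Rightarrow> nat set \<Rightarrow> (nat \<Rightarrow> 'g set) \<Rightarrow> bool" where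
  "shape_collection G L sh \<longleftrightarrow>
     finite L \<and> 0 \<notin> L \<and>
     (\<forall>l\<in>L. finite (sh l) \<and> sh l \<subseteq> carrier G \<and> \<one>\<^bsub>G\<^esub> \<in> sh l)"

definition centers :: "('g, 'm) monoid_scheme \<Rightarrow> ('g \<Rightarrow> nat) \<Rightarrow> 'g set" where
  "centers G t = {c \<in> carrier G. t c \<noteq> 0}"

definition tile ::
  "('g, 'm) monoid_scheme \<Rightarrow> (nat \<Rightarrow> 'g set) \<Rightarrow> ('g \<Rightarrow> nat) \<Rightarrow> 'g \<Rightarrow> 'g set" where
  "tile G sh t c = sh (t c) #>\<^bsub>G\<^esub> c"

definition tiles ::
  "('g, 'm) monoid_scheme \<Rightarrow> (nat \<Rightarrow> 'g set) \<Rightarrow> ('g \<Rightarrow> nat) \<Rightarrow> 'g set set" where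
  "tiles G sh t = tile G sh t ` centers G t"

text \<open>A tile carries its center and its shape. Two tiles with different centers are
  different members of the partition, hence disjoint; this is the injectivity requirement.\<close>

definition is_tiling ::
  "('g, 'm) monoid_scheme \<Rightarrow> (nat \<Rightarrow> 'g set) \<Rightarrow> ('g \<Rightarrow> nat) \<Rightarrow> bool" where
  "is_tiling G sh t \<longleftrightarrow>
     partition_on (carrier G) (tiles G sh t) \<and> inj_on (tile G sh t) (centers G t)"

definition dynamical_tiling ::
  "('g, 'm) monoid_scheme \<Rightarrow> nat set \<Rightarrow> (nat \<Rightarrow> 'g set) \<Rightarrow> ('g \<Rightarrow> nat) set \<Rightarrow> bool" where
  "dynamical_tiling G L sh T \<longleftrightarrow>
     shape_collection G L sh \<and> subshift G (insert 0 L) T \<and> (\<forall>t\<in>T. is_tiling G sh t)"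

definition Folner_system ::
  "('g, 'm) monoid_scheme \<Rightarrow> (nat \<Rightarrow> nat set) \<Rightarrow> (nat \<Rightarrow> nat \<Rightarrow> 'g set) \<Rightarrow>
   (nat \<Rightarrow> ('g \<Rightarrow> nat) set) \<Rightarrow> (nat \<Rightarrow> 'g \<Rightarrow> nat) set \<Rightarrow> bool" where
  "Folner_system G L sh T Z \<longleftrightarrow>
     (\<forall>k. dynamical_tiling G (L k) (sh k) (T k)) \<and>
     joining G (shift G) T Z \<and>
     (\<forall>K \<epsilon>. finite K \<and> K \<noteq> {} \<and> K \<subseteq> carrier G \<and> \<epsilon> > 0 \<longrightarrow>
        (\<forall>\<^sub>F k in sequentially. \<forall>l\<in>L k. Folner_invariant G K \<epsilon> (sh k l)))"

definition congruent_tilings ::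
  "('g, 'm) monoid_scheme \<Rightarrow> (nat \<Rightarrow> nat \<Rightarrow> 'g set) \<Rightarrow> (nat \<Rightarrow> 'g \<Rightarrow> nat) set \<Rightarrow> bool" where
  "congruent_tilings G sh Z \<longleftrightarrow>
     (\<forall>z\<in>Z. \<forall>k. \<forall>U\<in>tiles G (sh (Suc k)) (z (Suc k)).
        \<exists>\<U>\<subseteq>tiles G (sh k) (z k). U = \<Union>\<U>)"

text \<open>In the following definition \<open>C l\<close> is the set of relative centers, inside the shape
  labelled \<open>l'\<close>, of the subtiles whose shape is labelled \<open>l\<close>.\<close>

definition deterministic_tilings ::
  "('g, 'm) monoid_scheme \<Rightarrow> (nat \<Rightarrow> nat set) \<Rightarrow> (nat \<Rightarrow> nat \<Rightarrow> 'g set) \<Rightarrow>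
   (nat \<Rightarrow> 'g \<Rightarrow> nat) set \<Rightarrow> bool" where
  "deterministic_tilings G L sh Z \<longleftrightarrow>
     (\<forall>k. \<forall>l'\<in>L (Suc k). \<exists>C :: nat \<Rightarrow> 'g set.
        (\<forall>l\<in>L k. C l \<subseteq> sh (Suc k) l') \<and>
        sh (Suc k) l' = (\<Union>l\<in>L k. \<Union>c\<in>C l. sh k l #>\<^bsub>G\<^esub> c) \<and>
        disjoint_family_on (\<lambda>(l, c). sh k l #>\<^bsub>G\<^esub> c) (SIGMA l:L k. C l) \<and>
        (\<forall>z\<in>Z. \<forall>c'\<in>carrier G. z (Suc k) c' = l' \<longrightarrow>
           (\<forall>l\<in>L k. \<forall>c\<in>C l. z k (c \<otimes>\<^bsub>G\<^esub> c') = l)))"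

definition tiling_system ::
  "('g, 'm) monoid_scheme \<Rightarrow> (nat \<Rightarrow> nat set) \<Rightarrow> (nat \<Rightarrow> nat \<Rightarrow> 'g set) \<Rightarrow>
   (nat \<Rightarrow> ('g \<Rightarrow> nat) set) \<Rightarrow> (nat \<Rightarrow> 'g \<Rightarrow> nat) set \<Rightarrow> bool" where
  "tiling_system G L sh T Z \<longleftrightarrow>
     Folner_system G L sh T Z \<and> congruent_tilings G sh Z \<and> deterministic_tilings G L sh Z"

definition has_tiling_system_factor ::
  "('g, 'm) monoid_scheme \<Rightarrow> 'x::topological_space set \<Rightarrow> ('g \<Rightarrow> 'x \<Rightarrow> 'x) \<Rightarrow> bool" where
  "has_tiling_system_factor G X \<phi> \<longleftrightarrow>
     (\<exists>L sh T Z. tiling_system G L sh T Z \<and>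
        topological_factor G X \<phi> Z (product_action (shift G)))"

end

theory Submission
  imports Defs
begin

text \<open>
  A locally constant function \<open>\<gamma>\<close> from \<open>X\<close> to the group that carries every point to a base point
  splits each orbit equivariantly into cells, and every clopen tiling arises in this way.

  Suppose that \<open>\<mu> A < \<mu> B\<close> for all invariant measures. Limits of empirical measures along Folner
  shapes show that on some level of a tiling system every tile meets \<open>A\<close> in at most as many points
  as \<open>B\<close>; matching them inside each tile gives \<open>A \<preceq> B\<close>.

  Conversely, for a free action the Ornstein-Weiss greedy construction, carried out on \<open>X\<close> with clopen
  sets, yields almost invariant cells covering all but a small proportion of \<open>X\<close> simultaneously for
  all invariant measures. Comparison embeds the remainder into a small part of these cells, to which
  it is attached. Regrouping the tiles of one level along such an exact partition of higher
  invariance gives the next level of a congruent system.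
\<close>

section \<open>Topological preliminaries\<close>

text \<open>A tile is a subset of G, and when the action is not free it cannot be recovered from the
  orbit points that it visits. Tiles are therefore stored as displacements in G, which keeps the
  forward implication valid for all actions; freeness enters only through
  \<open>separated_nbhd\<close>. Every selection (a matching, a part of a cell, a new center) is
  made as a function of finite subsets of G alone, hence is locally constant as soon as the cells
  are.

  The greedy covering must run from large scales to small ones, because a later shape F should
  rarely straddle the border of what is already covered. So the castle of the previous scale is
  requested with a small outer L-boundary, for a finite L prescribed beforehand, and this bound is
  carried through the induction.

  Comparison asks for a strict inequality for each invariant measure. The receiving set must then
  take a definite proportion of each cell, and rounding to integers is harmless only if cells are
  large, which an infinite group can enforce.

  Exact partitions found independently at two levels are not nested; regrouping along the coarser
  one changes its cells only near their boundaries.\<close>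

lemma Hausdorff_discrete: "Hausdorff_space (euclidean :: 'a::discrete_topology topology)"
  unfolding Hausdorff_space_def
proof (intro allI impI)
  fix x y :: 'a assume "x \<in> topspace euclidean \<and> y \<in> topspace euclidean \<and> x \<noteq> y"
  then show "\<exists>U V. openin euclidean U \<and> openin euclidean V \<and> x \<in> U \<and> y \<in> V \<and> disjnt U V"
    by (intro exI[of _ "{x}"] exI[of _ "{y}"]) (auto simp: Topological_Spaces.open_discrete)
qed

lemma Hausdorff_fun:
  assumes "Hausdorff_space (euclidean :: 'b::topological_space topology)"
  shows "Hausdorff_space (euclidean :: ('a \<Rightarrow> 'b) topology)"
  unfolding euclidean_product_topology[symmetric] Hausdorff_space_product_topology using assms by simp

text \<open>The source of closedness for subshifts and joinings: both will be continuous images of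
  the compact X.\<close>

lemma compact_closedin:
  assumes "Hausdorff_space (euclidean :: 'b::topological_space topology)" "compact Z" "Z \<subseteq> S"
  shows "closedin (top_of_set S) (Z :: 'b set)"
proof -
  have "closedin euclidean Z"
    using assms(1,2) by (intro compactin_imp_closedin) (simp_all add: compactin_euclidean_iff)
  then show ?thesis using assms(3) by (simp add: closed_subset)
qed

lemma tendsto_fun_component:
  fixes f :: "'a \<Rightarrow> 'b \<Rightarrow> 'c::topological_space"
  assumes "(f \<longlongrightarrow> m) F"
  shows "((\<lambda>x. f x i) \<longlongrightarrow> m i) F"
proof (rule topological_tendstoI)
  fix S assume S: "open S" "m i \<in> S"
  have "open ((\<lambda>h. h i) -` S :: ('b \<Rightarrow> 'c) set)"
    by (rule open_vimage[OF S(1)]) simp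
  from topological_tendstoD[OF assms this] S(2)
  show "\<forall>\<^sub>F x in F. f x i \<in> S" by simp
qed

text \<open>By Tychonoff's theorem, a sequence of functions into \<open>[0, 1]\<close> converges pointwise
  along some filter finer than \<open>sequentially\<close>, whatever the size of the domain.\<close>

lemma pointwise_cluster_filter:
  fixes f :: "nat \<Rightarrow> 'b \<Rightarrow> real"
  assumes "\<And>n b. 0 \<le> f n b \<and> f n b \<le> 1"
  obtains m H where "H \<noteq> bot" "H \<le> sequentially" "\<And>b. ((\<lambda>n. f n b) \<longlongrightarrow> m b) H"
proof -
  define K :: "('b \<Rightarrow> real) set" where "K = (\<Pi>\<^sub>E b\<in>UNIV. {0..1})"
  have "compactin (product_topology (\<lambda>_. euclidean) UNIV) K"
    unfolding K_def compactin_PiE by auto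
  then have "compact K"
    unfolding euclidean_product_topology compactin_euclidean_iff .
  moreover have "filtermap f sequentially \<noteq> bot"
    by (simp add: filtermap_bot_iff)
  moreover have "eventually (\<lambda>h. h \<in> K) (filtermap f sequentially)"
    using assms by (auto simp: eventually_filtermap K_def PiE_def)
  ultimately obtain m where m: "inf (nhds m) (filtermap f sequentially) \<noteq> bot"
    unfolding compact_filter by blast
  \<comment> \<open>A cluster point m becomes a filter on indices: the neighbourhoods of m are
    pulled back and joined with \<open>sequentially\<close>. The cluster property is what keeps this
    filter proper.\<close>
  define H where "H = inf (filtercomap f (nhds m)) sequentially"
  have 1: "H \<noteq> bot"
  proof
    assume "H = bot"
    then have "eventually (\<lambda>_. False) H" by simp
    then obtain P Q where P: "eventually P (nhds m)" and Q: "eventually Q sequentially"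
      and PQ: "\<And>n. P (f n) \<Longrightarrow> Q n \<Longrightarrow> False"
      unfolding H_def eventually_inf eventually_filtercomap by blast
    have "eventually (\<lambda>h. \<not> P h) (filtermap f sequentially)"
      unfolding eventually_filtermap using Q by eventually_elim (use PQ in blast)
    then have "eventually (\<lambda>_. False) (inf (nhds m) (filtermap f sequentially))"
      unfolding eventually_inf using P by blast
    then show False using m by (simp add: trivial_limit_def)
  qed
  have 2: "H \<le> sequentially" by (simp add: H_def)
  have 3: "(f \<longlongrightarrow> m) H"
    unfolding H_def by (rule filterlim_mono[OF filterlim_filtercomap order_refl]) simp
  show thesis
    by (rule that[OF 1 2 tendsto_fun_component[OF 3]])
qed

section \<open>Almost invariant finite sets\<close>

definition almost_inv :: "('g, 'm) monoid_scheme \<Rightarrow> 'g set \<Rightarrow> real \<Rightarrow> 'g set \<Rightarrow> bool" where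
  "almost_inv G K \<kappa> T \<longleftrightarrow>
     finite T \<and> T \<subseteq> carrier G \<and> real (card ((K <#>\<^bsub>G\<^esub> T) - T)) \<le> \<kappa> * real (card T)"

context group
begin

lemma finite_set_mult: "finite K \<Longrightarrow> finite T \<Longrightarrow> finite (K <#> T)"
  by (auto simp: set_mult_def)

lemma card_set_mult_le: "finite K \<Longrightarrow> finite T \<Longrightarrow> card (K <#> T) \<le> card K * card T"
proof -
  assume fin: "finite K" "finite T"
  have "K <#> T = (\<lambda>(k, t). k \<otimes> t) ` (K \<times> T)"
    by (auto simp: set_mult_def)
  then show ?thesis
    by (metis card_cartesian_product card_image_le fin finite_cartesian_product)
qed

lemma card_le_card_set_mult:
  assumes "finite K" "finite T" "K \<subseteq> carrier G" "T \<subseteq> carrier G" "T \<noteq> {}"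
  shows "card K \<le> card (K <#> T)"
proof -
  obtain t where t: "t \<in> T" using assms by blast
  have "inj_on (\<lambda>k. k \<otimes> t) K"
    using assms t by (intro inj_onI) (metis right_cancel subsetD)
  moreover have "(\<lambda>k. k \<otimes> t) ` K \<subseteq> K <#> T"
    using t by (auto simp: set_mult_def)
  ultimately show ?thesis
    using finite_set_mult[OF assms(1,2)] by (metis card_inj_on_le)
qed

lemma almost_inv_empty [simp]: "almost_inv G K \<kappa> {}"
  by (auto simp: almost_inv_def set_mult_def)

lemma almost_inv_mono:
  assumes "almost_inv G K \<kappa> T" "K' \<subseteq> K" "\<kappa> \<le> \<kappa>'" "finite K"
  shows "almost_inv G K' \<kappa>' T"
proof -
  have "card ((K' <#> T) - T) \<le> card ((K <#> T) - T)"
    using assms by (intro card_mono) (auto simp: set_mult_def almost_inv_def)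
  moreover have "\<kappa> * real (card T) \<le> \<kappa>' * real (card T)"
    using assms by (intro mult_right_mono) auto
  ultimately show ?thesis using assms(1) by (auto simp: almost_inv_def)
qed

lemma almost_inv_union:
  assumes "almost_inv G K \<kappa> S" "almost_inv G K \<kappa> T" "S \<inter> T = {}" "finite K"
  shows "almost_inv G K \<kappa> (S \<union> T)"
proof -
  have fin: "finite S" "finite T" using assms by (auto simp: almost_inv_def)
  have "card ((K <#> (S \<union> T)) - (S \<union> T)) \<le> card (((K <#> S) - S) \<union> ((K <#> T) - T))"
    using fin assms(4) by (intro card_mono) (auto simp: set_mult_def)
  also have "\<dots> \<le> card ((K <#> S) - S) + card ((K <#> T) - T)" by (rule card_Un_le)
  finally have "real (card ((K <#> (S \<union> T)) - (S \<union> T))) \<le>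
     real (card ((K <#> S) - S)) + real (card ((K <#> T) - T))" by linarith
  also have "\<dots> \<le> \<kappa> * real (card (S \<union> T))"
    using assms by (simp add: almost_inv_def card_Un_disjoint distrib_left)
  finally show ?thesis using assms by (auto simp: almost_inv_def)
qed

text \<open>A point of \<open>K <#> S\<close> outside S comes from \<open>S - T\<close>, or lies in
  \<open>K <#> T\<close>; in the latter case it is either outside T or in
  \<open>T - S\<close>.\<close>

lemma card_boundary_perturb:
  assumes "finite K" "finite S" "finite T"
  shows "card ((K <#> S) - S) \<le> card ((K <#> T) - T) + card K * card (S - T) + card (T - S)"
proof -
  have "card ((K <#> S) - S) \<le> card (((K <#> T) - T) \<union> (K <#> (S - T)) \<union> (T - S))"
    using assms by (intro card_mono) (auto simp: set_mult_def)
  also have "\<dots> \<le> card ((K <#> T) - T) + card (K <#> (S - T)) + card (T - S)"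
    by (metis (no_types, lifting) add_le_mono1 card_Un_le order_trans)
  finally show ?thesis
    using card_set_mult_le[of K "S - T"] assms by (meson add_mono_thms_linordered_semiring(3)
        add_le_cancel_left add_le_cancel_right finite_Diff order_trans)
qed

text \<open>The boundary of T consists of boundary points of F and of removed points, at most
  2\<epsilon>|F| in all, and |F| \<le> 2|T| because \<epsilon> \<le> 1/2; hence the constant
  4.\<close>

lemma almost_inv_of_subset:
  assumes "almost_inv G K \<epsilon> F" "T \<subseteq> F" "real (card T) \<ge> (1 - \<epsilon>) * real (card F)"
    and "0 < \<epsilon>" "\<epsilon> \<le> 1/2" "finite K"
  shows "almost_inv G K (4 * \<epsilon>) T"
proof -
  have fin: "finite F" "finite T"
    using assms finite_subset by (auto simp: almost_inv_def)
  have "card (F - T) = card F - card T" "card T \<le> card F"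
    using assms fin by (auto simp: card_Diff_subset card_mono)
  moreover have "card ((K <#> T) - T) \<le> card ((K <#> F) - F) + card K * card (T - F) + card (F - T)"
    by (rule card_boundary_perturb[OF assms(6) fin(2,1)])
  moreover have "T - F = {}" using assms by auto
  ultimately have "real (card ((K <#> T) - T)) \<le> real (card ((K <#> F) - F)) + (real (card F) - real (card T))"
    by simp
  also have "\<dots> \<le> \<epsilon> * real (card F) + \<epsilon> * real (card F)"
    using assms(1,3) by (auto simp: almost_inv_def algebra_simps)
  also have "\<dots> \<le> 4 * \<epsilon> * real (card T)"
  proof -
    have "1/2 * real (card F) \<le> (1 - \<epsilon>) * real (card F)"
      using assms by (intro mult_right_mono) auto
    then have "real (card F) \<le> 2 * real (card T)" using assms(3) by linarith
    then have "2 * \<epsilon> * real (card F) \<le> 2 * \<epsilon> * (2 * real (card T))"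
      using assms by (intro mult_left_mono) auto
    then show ?thesis by simp
  qed
  finally show ?thesis using assms fin by (auto simp: almost_inv_def)
qed

text \<open>The inner boundary costs no more than the outer one: for k in K',
  \<open>T - (K' <#> T)\<close> is contained in T - kT, which has as many elements as kT - T since
  |kT| = |T|. The two halves give 2\<kappa>.\<close>

lemma Folner_invariant_of_almost_inv:
  assumes "almost_inv G K \<kappa> T" "T \<noteq> {}" "finite K" "K' \<subseteq> K" "K' \<noteq> {}" "K \<subseteq> carrier G" "2 * \<kappa> < \<epsilon>"
  shows "Folner_invariant G K' \<epsilon> T"
proof -
  have T: "finite T" "T \<subseteq> carrier G" and le: "real (card ((K <#> T) - T)) \<le> \<kappa> * real (card T)"
    using assms by (auto simp: almost_inv_def)
  have fK': "finite K'" using assms finite_subset by blast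
  have 1: "card ((K' <#> T) - T) \<le> card ((K <#> T) - T)"
    using assms T by (intro card_mono) (auto simp: set_mult_def)
  have set_mult_mem: "k \<otimes> t \<in> K' <#> T" if "k \<in> K'" "t \<in> T" for k t
    using that by (auto simp: set_mult_def)
  obtain k where k: "k \<in> K'" using assms by blast
  let ?kT = "(\<otimes>) k ` T"
  have kc: "k \<in> carrier G" using k assms by blast
  have "inj_on ((\<otimes>) k) T" using T kc by (intro inj_onI) (metis Units_eq Units_l_cancel subsetD)
  then have c: "card ?kT = card T" by (rule card_image)
  have "card (T - (K' <#> T)) \<le> card (T - ?kT)"
    using T set_mult_mem[OF k] by (intro card_mono) auto
  also have "card (T - ?kT) = card T - card (T \<inter> ?kT)"
    using T by (metis card_Diff_subset_Int finite_Int)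
  also have "\<dots> = card ?kT - card (?kT \<inter> T)"
    using c by (simp add: Int_commute)
  also have "\<dots> = card (?kT - T)"
    using T by (metis card_Diff_subset_Int finite_Int)
  also have "\<dots> \<le> card ((K <#> T) - T)"
    using assms T k by (intro card_mono) (auto simp: set_mult_def)
  finally have 2: "card (T - (K' <#> T)) \<le> card ((K <#> T) - T)" .
  have "card (sym_diff (K' <#> T) T) \<le> card ((K' <#> T) - T) + card (T - (K' <#> T))"
    by (rule card_Un_le)
  then have "real (card (sym_diff (K' <#> T) T)) \<le> 2 * (\<kappa> * real (card T))"
    using 1 2 le by linarith
  also have "\<dots> = 2 * \<kappa> * real (card T)" by simp
  also have "\<dots> < \<epsilon> * real (card T)"
    using assms T by (intro mult_strict_right_mono) (auto simp: card_gt_0_iff)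
  finally show ?thesis using T by (auto simp: Folner_invariant_def)
qed

lemma amenable_almost_inv:
  assumes "amenable G" "finite K" "K \<subseteq> carrier G" "\<kappa> > 0"
  obtains F where "almost_inv G K \<kappa> F" "F \<noteq> {}"
proof -
  obtain FF where FF: "Folner_sequence G FF" using assms by (auto simp: amenable_def)
  \<comment> \<open>Adjoining \<one> meets the requirement of \<open>Folner_sequence\<close> that
    the set be nonempty.\<close>
  define K1 where "K1 = insert \<one> K"
  have "\<forall>\<^sub>F n in sequentially. Folner_invariant G K1 \<kappa> (FF n)"
    using FF assms by (auto simp: Folner_sequence_def K1_def)
  then obtain n where n: "Folner_invariant G K1 \<kappa> (FF n)"
    using eventually_happens by fastforce
  have fin: "finite (FF n)" "FF n \<subseteq> carrier G" using n by (auto simp: Folner_invariant_def)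
  have "FF n \<noteq> {}" using n by (auto simp: Folner_invariant_def)
  moreover have "card ((K <#> FF n) - FF n) \<le> card (sym_diff (K1 <#> FF n) (FF n))"
    using fin assms finite_set_mult[of K1 "FF n"]
    by (intro card_mono) (auto simp: set_mult_def K1_def)
  then have "almost_inv G K \<kappa> (FF n)"
    using n fin unfolding Folner_invariant_def almost_inv_def by linarith
  ultimately show thesis using that by blast
qed

text \<open>Left products with K commute with right translations, so moving the origin of a shape to
  another center does not affect its invariance.\<close>

lemma almost_inv_translate:
  assumes "almost_inv G K \<kappa> ((\<lambda>s. s \<otimes> t) ` S)" "t \<in> carrier G" "S \<subseteq> carrier G" "K \<subseteq> carrier G" "finite S"
  shows "almost_inv G K \<kappa> S"
proof -
  let ?r = "\<lambda>s. s \<otimes> t"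
  have inj: "inj_on ?r (carrier G)" using assms by (intro inj_onI) simp
  have KS: "K <#> S \<subseteq> carrier G" using assms by (rule_tac set_mult_closed)
  have "K <#> (?r ` S) = ?r ` (K <#> S)"
    using assms by (auto simp: set_mult_def m_assoc subset_iff image_iff) blast
  then have "(K <#> (?r ` S)) - ?r ` S = ?r ` ((K <#> S) - S)"
    using inj_on_image_set_diff[OF inj, of "K <#> S" S] subset_trans[OF Diff_subset KS] assms(3) by simp
  moreover have "card (?r ` ((K <#> S) - S)) = card ((K <#> S) - S)"
    using inj_on_subset[OF inj] KS by (intro card_image) blast
  moreover have "card (?r ` S) = card S"
    using inj_on_subset[OF inj] assms by (intro card_image) blast
  ultimately show ?thesis using assms by (simp add: almost_inv_def)
qed

end

section \<open>Locally constant functions on zero-dimensional systems\<close>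

locale zero_dim_system = topological_system G X \<phi>
  for G :: "('g, 'm) monoid_scheme" (structure) and X :: "'x::metric_space set" and \<phi> +
  assumes zero_dim: "zero_dimensional X"

sublocale zero_dim_system \<subseteq> group G
  using group_hom by (rule group_hom.axioms(1))

context zero_dim_system
begin

abbreviation nhd :: "'x \<Rightarrow> 'x filter" where
  "nhd x \<equiv> inf (nhds x) (principal X)"

text \<open>Continuity into a discrete space, for an arbitrary value type: the values will be truth
  values, group elements, finite subsets of the group and patterns of labels.\<close>

definition loc_const :: "('x \<Rightarrow> 'v) \<Rightarrow> bool" where
  "loc_const f \<longleftrightarrow> (\<forall>x\<in>X. \<forall>\<^sub>F y in nhd x. f y = f x)"

lemma act_closed [simp]: "g \<in> carrier G \<Longrightarrow> x \<in> X \<Longrightarrow> \<phi> g x \<in> X"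
  using element_image by blast

lemma act_one [simp]: "x \<in> X \<Longrightarrow> \<phi> \<one> x = x"
  using id_eq_one by (metis restrict_apply')

lemma act_mult: "x \<in> X \<Longrightarrow> g \<in> carrier G \<Longrightarrow> h \<in> carrier G \<Longrightarrow> \<phi> g (\<phi> h x) = \<phi> (g \<otimes> h) x"
  using composition_rule by simp

lemma act_inv [simp]: "x \<in> X \<Longrightarrow> g \<in> carrier G \<Longrightarrow> \<phi> (inv g) (\<phi> g x) = x"
  using orbit_sym_aux by blast

lemma act_inv' [simp]: "x \<in> X \<Longrightarrow> g \<in> carrier G \<Longrightarrow> \<phi> g (\<phi> (inv g) x) = x"
  by (simp add: act_mult)

lemma act_inj: "x \<in> X \<Longrightarrow> y \<in> X \<Longrightarrow> g \<in> carrier G \<Longrightarrow> \<phi> g x = \<phi> g y \<Longrightarrow> x = y"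
  by (metis act_inv)

lemma continuous_act: "g \<in> carrier G \<Longrightarrow> continuous_on X (\<phi> g)"
  using homeomorphisms[of g] by (auto simp: homeomorphism_def)

lemma eventually_nhd:
  "(\<forall>\<^sub>F y in nhd x. P y) \<longleftrightarrow> (\<exists>U. open U \<and> x \<in> U \<and> (\<forall>y\<in>X \<inter> U. P y))"
  unfolding eventually_inf_principal eventually_nhds by auto

lemma filterlim_act:
  assumes "g \<in> carrier G" "x \<in> X"
  shows "filterlim (\<phi> g) (nhd (\<phi> g x)) (nhd x)"
  unfolding filterlim_inf filterlim_principal
proof
  show "filterlim (\<phi> g) (nhds (\<phi> g x)) (nhd x)"
    unfolding tendsto_def eventually_nhd
  proof (intro allI impI)
    fix S assume "open S" "\<phi> g x \<in> S"
    then obtain A where "open A" "x \<in> A" "\<forall>y\<in>X. y \<in> A \<longrightarrow> \<phi> g y \<in> S"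
      using continuous_act[OF assms(1)] assms(2) unfolding continuous_on_topological by metis
    then show "\<exists>U. open U \<and> x \<in> U \<and> (\<forall>y\<in>X \<inter> U. \<phi> g y \<in> S)"
      by blast
  qed
  show "\<forall>\<^sub>F y in nhd x. \<phi> g y \<in> X"
    unfolding eventually_inf_principal using assms by auto
qed

lemma loc_const_const [simp]: "loc_const (\<lambda>_. c)"
  by (simp add: loc_const_def)

lemma loc_const_comp: "loc_const f \<Longrightarrow> loc_const (\<lambda>x. h (f x))"
  unfolding loc_const_def by (auto elim!: eventually_mono)

lemma loc_const_comp2: "loc_const f \<Longrightarrow> loc_const g \<Longrightarrow> loc_const (\<lambda>x. h (f x) (g x))"
  unfolding loc_const_def by (fastforce elim: eventually_elim2)

text \<open>Near x the index is frozen at \<open>f x\<close>, so only one member of the family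
  matters there.\<close>

lemma loc_const_bind:
  assumes "loc_const f" "\<And>x. x \<in> X \<Longrightarrow> loc_const (F (f x))"
  shows "loc_const (\<lambda>x. F (f x) x)"
  unfolding loc_const_def
proof
  fix x assume x: "x \<in> X"
  show "\<forall>\<^sub>F y in nhd x. F (f y) y = F (f x) x"
    using assms(1)[unfolded loc_const_def, rule_format, OF x]
      assms(2)[OF x, unfolded loc_const_def, rule_format, OF x]
    by eventually_elim simp
qed

lemma loc_const_cong: "(\<And>x. x \<in> X \<Longrightarrow> f x = g x) \<Longrightarrow> loc_const f \<longleftrightarrow> loc_const g"
  unfolding loc_const_def eventually_inf_principal by (auto elim!: eventually_mono)

lemma loc_const_act:
  assumes "g \<in> carrier G" "loc_const f"
  shows "loc_const (\<lambda>x. f (\<phi> g x))"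
  unfolding loc_const_def
proof
  fix x assume x: "x \<in> X"
  then have "\<forall>\<^sub>F y in nhd (\<phi> g x). f y = f (\<phi> g x)"
    using assms by (auto simp: loc_const_def)
  then show "\<forall>\<^sub>F y in nhd x. f (\<phi> g y) = f (\<phi> g x)"
    using filterlim_act[OF assms(1) x] by (auto simp: filterlim_iff)
qed

lemma loc_const_act_bind:
  assumes "loc_const g" "loc_const f" "\<And>x. x \<in> X \<Longrightarrow> g x \<in> carrier G"
  shows "loc_const (\<lambda>x. f (\<phi> (g x) x))"
  by (rule loc_const_bind[where F = "\<lambda>h x. f (\<phi> h x)"]) (use assms loc_const_act in auto)

text \<open>Finitely many neighbourhoods can be intersected. For this reason set-valued functions
  are first confined to a fixed finite set, usually that of all displacements.\<close>

lemma loc_const_Collect: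
  assumes "finite D" "\<And>s. s \<in> D \<Longrightarrow> loc_const (P s)"
  shows "loc_const (\<lambda>x. {s \<in> D. P s x})"
  unfolding loc_const_def
proof
  fix x assume x: "x \<in> X"
  have "\<forall>\<^sub>F y in nhd x. \<forall>s\<in>D. P s y = P s x"
    using assms x by (intro eventually_ball_finite) (auto simp: loc_const_def)
  then show "\<forall>\<^sub>F y in nhd x. {s \<in> D. P s y} = {s \<in> D. P s x}"
    by eventually_elim auto
qed

lemma loc_const_open:
  assumes "loc_const f"
  shows "openin (top_of_set X) {x \<in> X. P (f x)}"
proof (subst openin_subopen, safe)
  fix x assume x: "x \<in> X" "P (f x)"
  then obtain U where U: "open U" "x \<in> U" "\<forall>y\<in>X \<inter> U. f y = f x"
    using assms unfolding loc_const_def eventually_nhd by blast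
  have "X \<inter> U \<subseteq> {x \<in> X. P (f x)}"
  proof
    fix y assume y: "y \<in> X \<inter> U"
    then have "f y = f x" using U(3) by blast
    then show "y \<in> {x \<in> X. P (f x)}" using x y by simp
  qed
  moreover have "openin (top_of_set X) (X \<inter> U)" using U(1) by (rule openin_open_Int)
  ultimately show "\<exists>T. openin (top_of_set X) T \<and> x \<in> T \<and> T \<subseteq> {x \<in> X. P (f x)}"
    using x U(2) by blast
qed

section \<open>Clopen sets as locally constant predicates\<close>

lemma clopen_iff: "clopen_in X A \<longleftrightarrow> A \<subseteq> X \<and> loc_const (\<lambda>x. x \<in> A)"
proof safe
  assume A: "clopen_in X A"
  show "x \<in> X" if "x \<in> A" for x
    using A that openin_imp_subset by (auto simp: clopen_in_def)
  obtain U where U: "open U" "A = X \<inter> U"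
    using A by (auto simp: clopen_in_def openin_open)
  have "openin (top_of_set X) (X - A)"
    using A by (auto simp: clopen_in_def closedin_def)
  then obtain V where V: "open V" "X - A = X \<inter> V"
    by (auto simp: openin_open)
  show "loc_const (\<lambda>x. x \<in> A)"
    unfolding loc_const_def eventually_nhd
  proof
    fix x assume "x \<in> X"
    then consider "x \<in> U" | "x \<in> V" using U V by blast
    then show "\<exists>W. open W \<and> x \<in> W \<and> (\<forall>y\<in>X \<inter> W. (y \<in> A) = (x \<in> A))"
      by cases (use U V \<open>x \<in> X\<close> in blast)+
  qed
next
  assume A: "A \<subseteq> X" "loc_const (\<lambda>x. x \<in> A)"
  have "openin (top_of_set X) {x \<in> X. x \<in> A}" "openin (top_of_set X) {x \<in> X. \<not> x \<in> A}"
    using loc_const_open[OF A(2), of "\<lambda>b. b"] loc_const_open[OF A(2), of Not] by auto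
  moreover have "{x \<in> X. x \<in> A} = A" "{x \<in> X. x \<notin> A} = X - A" using A by auto
  ultimately show "clopen_in X A"
    using A by (auto simp: clopen_in_def closedin_def)
qed

lemma clopen_subset: "clopen_in X A \<Longrightarrow> A \<subseteq> X"
  and loc_const_mem: "clopen_in X A \<Longrightarrow> loc_const (\<lambda>x. x \<in> A)"
  by (simp_all add: clopen_iff)

lemma clopen_Collect: "loc_const P \<Longrightarrow> clopen_in X {x \<in> X. P x}"
  unfolding clopen_iff by (auto intro: iffD1[OF loc_const_cong, rotated])

lemma clopen_Collect_act: "g \<in> carrier G \<Longrightarrow> clopen_in X A \<Longrightarrow> clopen_in X {x \<in> X. \<phi> g x \<in> A}"
  by (intro clopen_Collect loc_const_act) (auto simp: clopen_iff)

lemma image_act_eq: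
  assumes "g \<in> carrier G" "A \<subseteq> X"
  shows "\<phi> g ` A = {x \<in> X. \<phi> (inv g) x \<in> A}"
  using assms by (auto simp: image_iff subset_iff) (metis act_inv')

lemma clopen_act: "g \<in> carrier G \<Longrightarrow> clopen_in X A \<Longrightarrow> clopen_in X (\<phi> g ` A)"
  using clopen_Collect_act[of "inv g" A] image_act_eq[of g A] clopen_subset by simp

lemma clopen_Un: "clopen_in X A \<Longrightarrow> clopen_in X B \<Longrightarrow> clopen_in X (A \<union> B)"
  and clopen_Int: "clopen_in X A \<Longrightarrow> clopen_in X B \<Longrightarrow> clopen_in X (A \<inter> B)"
  and clopen_Diff: "clopen_in X A \<Longrightarrow> clopen_in X B \<Longrightarrow> clopen_in X (A - B)"
  and clopen_empty [simp]: "clopen_in X {}"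
  and clopen_space [simp]: "clopen_in X X"
  by (auto simp: clopen_in_def openin_diff closedin_diff)

lemma clopen_UN:
  assumes "finite I" "\<And>i. i \<in> I \<Longrightarrow> clopen_in X (A i)"
  shows "clopen_in X (\<Union>i\<in>I. A i)"
  using assms by (auto simp: clopen_in_def intro!: closedin_Union)

text \<open>Compactness turns local constancy into finitely many values; the finiteness of
  displacements, shapes and label sets all comes from here.\<close>

lemma loc_const_finite:
  assumes "loc_const f"
  shows "finite (f ` X)"
proof -
  have "\<forall>x\<in>X. \<exists>U. open U \<and> x \<in> U \<and> (\<forall>y\<in>X \<inter> U. f y = f x)"
    using assms unfolding loc_const_def eventually_nhd .
  then obtain U where U: "\<forall>x\<in>X. open (U x) \<and> x \<in> U x \<and> (\<forall>y\<in>X \<inter> U x. f y = f x)"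
    unfolding bchoice_iff ..
  obtain D where D: "D \<subseteq> X" "finite D" "X \<subseteq> (\<Union>x\<in>D. U x)"
    by (rule compactE_image[OF compact_space, of X U]) (use U in blast)+
  have "f ` X \<subseteq> f ` D"
  proof
    fix v assume "v \<in> f ` X"
    then obtain y where y: "y \<in> X" "v = f y" by blast
    then obtain x where x: "x \<in> D" "y \<in> U x" using D by blast
    then have "f y = f x" using U D y by blast
    then show "v \<in> f ` D" using x y by blast
  qed
  then show ?thesis using D finite_surj by blast
qed

lemma clopen_cover:
  assumes C: "compact C" "C \<subseteq> X" and P: "\<And>x. x \<in> C \<Longrightarrow> \<exists>B. clopen_in X B \<and> x \<in> B \<and> P B"
  obtains \<B> where "finite \<B>" "\<And>B. B \<in> \<B> \<Longrightarrow> clopen_in X B \<and> P B" "C \<subseteq> \<Union>\<B>"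
proof -
  have "\<forall>x\<in>C. \<exists>B. clopen_in X B \<and> x \<in> B \<and> P B"
    using P by blast
  then obtain B where B: "\<forall>x\<in>C. clopen_in X (B x) \<and> x \<in> B x \<and> P (B x)"
    unfolding bchoice_iff ..
  then have "\<forall>x\<in>C. \<exists>U. open U \<and> B x = X \<inter> U"
    by (simp add: clopen_in_def openin_open)
  then obtain U where U: "\<forall>x\<in>C. open (U x) \<and> B x = X \<inter> U x"
    unfolding bchoice_iff ..
  obtain D where D: "D \<subseteq> C" "finite D" "C \<subseteq> (\<Union>x\<in>D. U x)"
    by (rule compactE_image[OF C(1), of C U]) (use U B in blast)+
  show thesis
    by (rule that[of "B ` D"]) (use D U B C(2) in blast)+
qed

section \<open>Invariant measures and cells\<close>

context
  fixes \<mu> :: "'x measure"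
  assumes \<mu>: "invariant_prob G X \<phi> \<mu>"
begin

lemma space_invariant: "space \<mu> = X"
proof -
  have "space \<mu> = space (restrict_space borel X)"
    using \<mu> by (intro sets_eq_imp_space_eq) (auto simp: invariant_prob_def)
  then show ?thesis by (simp add: space_restrict_space)
qed

lemma clopen_sets: "clopen_in X A \<Longrightarrow> A \<in> sets \<mu>"
  using \<mu> by (auto simp: invariant_prob_def clopen_in_def openin_open sets_restrict_space)

lemma measure_act_vimage:
  assumes "g \<in> carrier G" "clopen_in X A"
  shows "measure \<mu> {x \<in> X. \<phi> g x \<in> A} = measure \<mu> A"
proof -
  have "\<phi> g \<in> restrict_space borel X \<rightarrow>\<^sub>M borel"
    by (rule borel_measurable_continuous_on_restrict[OF continuous_act[OF assms(1)]])
  then have "\<phi> g \<in> restrict_space borel X \<rightarrow>\<^sub>M restrict_space borel X"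
    using assms(1) by (intro measurable_restrict_space2) (auto simp: space_restrict_space)
  moreover have "sets \<mu> = sets (restrict_space borel X)"
    using \<mu> by (auto simp: invariant_prob_def)
  ultimately have m: "\<phi> g \<in> \<mu> \<rightarrow>\<^sub>M \<mu>"
    by (simp cong: measurable_cong_sets)
  have "measure \<mu> A = measure (distr \<mu> \<mu> (\<phi> g)) A"
    using \<mu> assms by (simp add: invariant_prob_def)
  also have "\<dots> = measure \<mu> (\<phi> g -` A \<inter> space \<mu>)"
    by (rule measure_distr[OF m clopen_sets[OF assms(2)]])
  also have "\<phi> g -` A \<inter> space \<mu> = {x \<in> X. \<phi> g x \<in> A}"
    by (auto simp: space_invariant)
  finally show ?thesis by simp
qed

lemma measure_act_image:
  assumes "g \<in> carrier G" "clopen_in X A"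
  shows "measure \<mu> (\<phi> g ` A) = measure \<mu> A"
  using measure_act_vimage[of "inv g" A] image_act_eq[of g A] assms clopen_subset by simp

lemma finite_measure_invariant: "finite_measure \<mu>"
  using \<mu> prob_space.finite_measure by (auto simp: invariant_prob_def)

lemma measure_space_invariant: "measure \<mu> X = 1"
  using \<mu> prob_space.prob_space space_invariant by (auto simp: invariant_prob_def)

lemma measure_mono_clopen: "clopen_in X B \<Longrightarrow> A \<subseteq> B \<Longrightarrow> clopen_in X A \<Longrightarrow> measure \<mu> A \<le> measure \<mu> B"
  using finite_measure.finite_measure_mono[OF finite_measure_invariant] clopen_sets by blast

lemma measure_Diff_clopen:
  assumes "clopen_in X A" "clopen_in X B" "A \<subseteq> B"
  shows "measure \<mu> (B - A) = measure \<mu> B - measure \<mu> A"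
  using finite_measure.finite_measure_Diff[OF finite_measure_invariant] assms clopen_sets by blast

lemma measure_Un_le:
  assumes "clopen_in X A" "clopen_in X B"
  shows "measure \<mu> (A \<union> B) \<le> measure \<mu> A + measure \<mu> B"
  by (rule measure_Un_le) (use assms clopen_sets in auto)

lemma measure_disjoint_UN:
  assumes "finite I" "\<And>i. i \<in> I \<Longrightarrow> clopen_in X (A i)" "disjoint_family_on A I"
  shows "measure \<mu> (\<Union>i\<in>I. A i) = (\<Sum>i\<in>I. measure \<mu> (A i))"
  by (rule finite_measure.finite_measure_finite_Union[OF finite_measure_invariant])
     (use assms clopen_sets in auto)

lemma measure_UN_le:
  assumes "finite I" "\<And>i. i \<in> I \<Longrightarrow> clopen_in X (A i)"
  shows "measure \<mu> (\<Union>i\<in>I. A i) \<le> (\<Sum>i\<in>I. measure \<mu> (A i))"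
  by (rule measure_UNION_le) (use assms clopen_sets in auto)

section \<open>Double counting by integration\<close>

lemma integral_card:
  assumes "finite I" "\<And>i. i \<in> I \<Longrightarrow> clopen_in X (P i)"
  shows "integrable \<mu> (\<lambda>x. real (card {i \<in> I. x \<in> P i}))"
    and "(\<integral>x. real (card {i \<in> I. x \<in> P i}) \<partial>\<mu>) = (\<Sum>i\<in>I. measure \<mu> (P i))"
proof -
  interpret finite_measure \<mu> by (rule finite_measure_invariant)
  have card: "real (card {i \<in> I. x \<in> P i}) = (\<Sum>i\<in>I. indicat_real (P i) x)" for x
    using assms(1) by (simp add: indicator_def sum.If_cases Int_def)
  have P: "P i \<in> sets \<mu>" if "i \<in> I" for i
    using that assms(2) clopen_sets by blast
  have i: "integrable \<mu> (indicat_real (P i))" if "i \<in> I" for i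
    using P[OF that] by (simp add: less_top[symmetric])
  then show "integrable \<mu> (\<lambda>x. real (card {i \<in> I. x \<in> P i}))"
    unfolding card by (intro Bochner_Integration.integrable_sum) auto
  have "(\<integral>x. (\<Sum>i\<in>I. indicat_real (P i) x) \<partial>\<mu>) = (\<Sum>i\<in>I. \<integral>x. indicat_real (P i) x \<partial>\<mu>)"
    using i by (intro Bochner_Integration.integral_sum) auto
  also have "\<dots> = (\<Sum>i\<in>I. measure \<mu> (P i))"
    using P by (intro sum.cong refl) (simp add: sets.Int_space_eq2)
  finally show "(\<integral>x. real (card {i \<in> I. x \<in> P i}) \<partial>\<mu>) = (\<Sum>i\<in>I. measure \<mu> (P i))"
    unfolding card .
qed

text \<open>The sum of the measures of a finite family is the integral of its multiplicity function,
  so a pointwise comparison of multiplicities is enough.\<close>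

lemma sum_measure_mono:
  assumes fin: "finite I" "finite J"
    and cl: "\<And>i. i \<in> I \<Longrightarrow> clopen_in X (P i)" "\<And>j. j \<in> J \<Longrightarrow> clopen_in X (Q j)"
    and le: "\<And>x. x \<in> X \<Longrightarrow> c * real (card {i \<in> I. x \<in> P i}) \<le> d * real (card {j \<in> J. x \<in> Q j})"
  shows "c * (\<Sum>i\<in>I. measure \<mu> (P i)) \<le> d * (\<Sum>j\<in>J. measure \<mu> (Q j))"
proof -
  have "(\<integral>x. c * real (card {i \<in> I. x \<in> P i}) \<partial>\<mu>) \<le> (\<integral>x. d * real (card {j \<in> J. x \<in> Q j}) \<partial>\<mu>)"
    using integral_card(1)[OF fin(1) cl(1)] integral_card(1)[OF fin(2) cl(2)] le
    by (intro integral_mono) (auto simp: space_invariant)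
  then show ?thesis
    using integral_card(2)[OF fin(1) cl(1)] integral_card(2)[OF fin(2) cl(2)] by simp
qed

lemma measure_le_sum:
  assumes "finite J" "clopen_in X A" "\<And>j. j \<in> J \<Longrightarrow> clopen_in X (Q j)"
    and "\<And>x. x \<in> A \<Longrightarrow> c \<le> real (card {j \<in> J. x \<in> Q j})"
  shows "c * measure \<mu> A \<le> (\<Sum>j\<in>J. measure \<mu> (Q j))"
proof -
  have "c * (\<Sum>i\<in>{0::nat}. measure \<mu> A) \<le> 1 * (\<Sum>j\<in>J. measure \<mu> (Q j))"
  proof (rule sum_measure_mono)
    fix x assume "x \<in> X"
    show "c * real (card {i \<in> {0::nat}. x \<in> A}) \<le> 1 * real (card {j \<in> J. x \<in> Q j})"
      by (cases "x \<in> A") (use assms(4) in auto)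
  qed (use assms in auto)
  then show ?thesis by simp
qed

end

text \<open>The pieces are the level sets of \<theta> on A, finite in number by compactness;
  injectivity of the whole map makes their images disjoint. A single displacement function is easier
  to compose with other locally constant data than a partition.\<close>

lemma subequivalentI:
  assumes "clopen_in X A" "loc_const \<theta>" "\<And>x. x \<in> A \<Longrightarrow> \<theta> x \<in> carrier G"
    and "inj_on (\<lambda>x. \<phi> (\<theta> x) x) A" "\<And>x. x \<in> A \<Longrightarrow> \<phi> (\<theta> x) x \<in> B"
  shows "subequivalent G X \<phi> A B"
proof -
  have AX: "A \<subseteq> X" using assms(1) by (rule clopen_subset)
  have "finite (\<theta> ` A)"
    using loc_const_finite[OF assms(2)] AX by (meson finite_subset image_mono)
  then obtain g n where g: "bij_betw g {0..<n::nat} (\<theta> ` A)"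
    using ex_bij_betw_nat_finite by blast
  define P where "P i = {x \<in> X. x \<in> A \<and> \<theta> x = g i}" for i
  have cl: "clopen_in X (P i)" for i
    unfolding P_def using loc_const_mem[OF assms(1)] assms(2)
    by (intro clopen_Collect loc_const_comp2[where h = "\<lambda>a b. a \<and> b = g i"]) auto
  have gi: "g i \<in> carrier G" if "i < n" for i
  proof -
    have "g i \<in> \<theta> ` A" using that bij_betw_imp_surj_on[OF g] by auto
    then show ?thesis using assms(3) by auto
  qed
  have ginj: "i = j" if "i < n" "j < n" "g i = g j" for i j
    using bij_betw_imp_inj_on[OF g] that by (auto simp: inj_on_def)
  have union: "A = (\<Union>i<n. P i)"
  proof
    show "A \<subseteq> (\<Union>i<n. P i)"
    proof
      fix x assume "x \<in> A"
      then have "\<theta> x \<in> g ` {0..<n}" using bij_betw_imp_surj_on[OF g] by auto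
      then show "x \<in> (\<Union>i<n. P i)" using \<open>x \<in> A\<close> AX by (auto simp: P_def)
    qed
  qed (auto simp: P_def)
  have im: "\<phi> (g i) ` P i \<subseteq> B" for i
    using assms(5) by (force simp: P_def)
  have "disjoint_family_on P {..<n}"
    using ginj by (auto simp: disjoint_family_on_def P_def)
  moreover have "disjoint_family_on (\<lambda>i. \<phi> (g i) ` P i) {..<n}"
    unfolding disjoint_family_on_def
  proof (intro ballI impI, rule ccontr)
    fix i j assume ij: "i \<in> {..<n}" "j \<in> {..<n}" "i \<noteq> j" "\<phi> (g i) ` P i \<inter> \<phi> (g j) ` P j \<noteq> {}"
    then obtain x y where xy: "x \<in> P i" "y \<in> P j" "\<phi> (g i) x = \<phi> (g j) y" by blast
    then have "\<phi> (\<theta> x) x = \<phi> (\<theta> y) y" "x \<in> A" "y \<in> A" by (auto simp: P_def)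
    then have "x = y" using assms(4) by (auto simp: inj_on_def)
    then show False using xy ij ginj by (auto simp: P_def)
  qed
  ultimately show ?thesis
    unfolding subequivalent_def using cl gi im union
    by (intro exI[of _ n] exI[of _ P] exI[of _ g]) simp
qed

lemma subequivalentE:
  assumes "subequivalent G X \<phi> A B"
  obtains \<theta> where "loc_const \<theta>" "\<And>x. \<theta> x \<in> carrier G"
    "inj_on (\<lambda>x. \<phi> (\<theta> x) x) A" "\<And>x. x \<in> A \<Longrightarrow> \<phi> (\<theta> x) x \<in> B"
proof -
  obtain n P g where *: "\<And>i. i < n \<Longrightarrow> clopen_in X (P i) \<and> g i \<in> carrier G \<and> \<phi> (g i) ` P i \<subseteq> B"
    and A: "A = (\<Union>i<(n::nat). P i)"
    and dP: "disjoint_family_on P {..<n}"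
    and dg: "disjoint_family_on (\<lambda>i. \<phi> (g i) ` P i) {..<n}"
    using assms unfolding subequivalent_def by blast
  \<comment> \<open>The index is read off from the set of all i with \<open>x \<in> P i\<close>,
    which is locally constant. The default \<one> off A keeps \<theta> group-valued
    everywhere.\<close>
  define \<theta> where "\<theta> x = (let I = {i \<in> {..<n}. x \<in> P i} in if I = {} then \<one> else g (SOME i. i \<in> I))" for x
  have \<theta>: "\<theta> x = g i" if "i < n" "x \<in> P i" for x i
  proof -
    have "{i \<in> {..<n}. x \<in> P i} = {i}"
      using that dP by (auto simp: disjoint_family_on_def)
    then show ?thesis by (simp add: \<theta>_def Let_def)
  qed
  have "\<theta> x \<in> carrier G" for x
  proof (cases "{i \<in> {..<n}. x \<in> P i} = {}")
    case False
    then show ?thesis using \<theta> * by auto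
  qed (simp add: \<theta>_def Let_def)
  moreover have "loc_const \<theta>"
    unfolding \<theta>_def Let_def
    by (rule loc_const_comp[where h = "\<lambda>I. if I = {} then \<one> else g (SOME i. i \<in> I)"],
        rule loc_const_Collect) (use * loc_const_mem in auto)
  moreover have "inj_on (\<lambda>x. \<phi> (\<theta> x) x) A"
  proof (rule inj_onI)
    fix x y assume xy: "x \<in> A" "y \<in> A" "\<phi> (\<theta> x) x = \<phi> (\<theta> y) y"
    then obtain i j where ij: "i < n" "x \<in> P i" "j < n" "y \<in> P j" using A by blast
    then have eq: "\<phi> (g i) x = \<phi> (g j) y" using xy \<theta> by simp
    then have "\<phi> (g i) ` P i \<inter> \<phi> (g j) ` P j \<noteq> {}" using ij by blast
    then have "i = j" using dg ij by (force simp: disjoint_family_on_def)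
    moreover have "x \<in> X" "y \<in> X" using ij * clopen_subset by blast+
    ultimately show "x = y" using eq act_inj * ij by blast
  qed
  moreover have "\<phi> (\<theta> x) x \<in> B" if x: "x \<in> A" for x
  proof -
    obtain i where "i < n" "x \<in> P i" using A x by blast
    then show ?thesis using \<theta> * by fastforce
  qed
  ultimately show thesis using that by blast
qed

text \<open>The function \<open>\<gamma>\<close> carries each point of \<open>W\<close> to the base point of its cell. Whatever \<open>\<gamma>\<close> is,
  \<open>x = s v\<close> with \<open>s\<close> in the cell of \<open>v\<close> determines \<open>s\<close> and \<open>v\<close>, even for actions that are not free,
  so the cells partition \<open>W\<close>. A base point need not belong to \<open>W\<close>.\<close>

definition cell :: "'x set \<Rightarrow> ('x \<Rightarrow> 'g) \<Rightarrow> 'x \<Rightarrow> 'g set" where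
  "cell W \<gamma> v = {s \<in> carrier G. \<phi> s v \<in> W \<and> \<gamma> (\<phi> s v) = inv s}"

lemma cell_base:
  assumes "s \<in> cell W \<gamma> v" "v \<in> X"
  shows "\<phi> (\<gamma> (\<phi> s v)) (\<phi> s v) = v"
  using assms by (auto simp: cell_def)

lemma mem_cell_base:
  assumes "x \<in> W" "x \<in> X" "\<gamma> x \<in> carrier G"
  shows "inv (\<gamma> x) \<in> cell W \<gamma> (\<phi> (\<gamma> x) x)"
  using assms by (auto simp: cell_def)

context
  fixes \<gamma>
  assumes \<gamma>: "loc_const \<gamma>" "\<And>x. x \<in> X \<Longrightarrow> \<gamma> x \<in> carrier G"
begin

definition displacements :: "'g set" where
  "displacements = (\<lambda>x. inv (\<gamma> x)) ` X"

lemma finite_displacements: "finite displacements"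
  and displacements_subset: "displacements \<subseteq> carrier G"
  using loc_const_finite[OF loc_const_comp[OF \<gamma>(1)], of "\<lambda>g. inv g"] \<gamma>(2)
  unfolding displacements_def by auto

lemma cell_subset: "v \<in> X \<Longrightarrow> cell W \<gamma> v \<subseteq> displacements"
  unfolding cell_def displacements_def
  by (smt (verit) act_closed image_iff inv_inv mem_Collect_eq subsetI)

lemma finite_cell: "v \<in> X \<Longrightarrow> finite (cell W \<gamma> v)"
  using cell_subset finite_displacements finite_subset by blast

lemma loc_const_cell:
  assumes "clopen_in X W"
  shows "loc_const (cell W \<gamma>)"
proof -
  have "loc_const (\<lambda>v. {s \<in> displacements. \<phi> s v \<in> W \<and> \<gamma> (\<phi> s v) = inv s})"
  proof (rule loc_const_Collect[OF finite_displacements])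
    fix s assume "s \<in> displacements"
    then have s: "s \<in> carrier G" using displacements_subset by blast
    show "loc_const (\<lambda>v. \<phi> s v \<in> W \<and> \<gamma> (\<phi> s v) = inv s)"
      by (rule loc_const_comp2[where h = "\<lambda>a b. a \<and> b = inv s"])
         (use loc_const_act[OF s] loc_const_mem[OF assms] \<gamma>(1) in auto)
  qed
  moreover have "{s \<in> displacements. \<phi> s v \<in> W \<and> \<gamma> (\<phi> s v) = inv s} = cell W \<gamma> v" if "v \<in> X" for v
    using cell_subset[OF that] displacements_subset by (auto simp: cell_def)
  ultimately show ?thesis using loc_const_cong by (metis (no_types, lifting))
qed

text \<open>Mass transport: \<open>\<mu> A\<close> is the average number of points of \<open>A\<close> in the cell based at
  a random point.\<close>

lemma measure_cell:
  assumes "invariant_prob G X \<phi> \<mu>" "clopen_in X A"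
  shows "measure \<mu> A = (\<Sum>s\<in>displacements. measure \<mu> {v \<in> X. s \<in> cell A \<gamma> v})"
proof -
  have AX: "A \<subseteq> X" using assms clopen_subset by blast
  have cl: "clopen_in X {x \<in> X. x \<in> A \<and> \<gamma> x = inv s}" for s
    by (intro clopen_Collect loc_const_comp2[where h = "\<lambda>a b. a \<and> b = inv s"])
       (use loc_const_mem assms \<gamma>(1) in auto)
  have "measure \<mu> A = measure \<mu> (\<Union>s\<in>displacements. {x \<in> X. x \<in> A \<and> \<gamma> x = inv s})"
    using AX \<gamma>(2) by (intro arg_cong[where f = "measure \<mu>"]) (auto simp: displacements_def)
  also have "\<dots> = (\<Sum>s\<in>displacements. measure \<mu> {x \<in> X. x \<in> A \<and> \<gamma> x = inv s})"
  proof (intro measure_disjoint_UN[OF assms(1)] cl finite_displacements)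
    show "disjoint_family_on (\<lambda>s. {x \<in> X. x \<in> A \<and> \<gamma> x = inv s}) displacements"
      using displacements_subset by (auto simp: disjoint_family_on_def) (metis inv_inv subsetD)
  qed
  also have "\<dots> = (\<Sum>s\<in>displacements. measure \<mu> {v \<in> X. s \<in> cell A \<gamma> v})"
  proof (rule sum.cong[OF refl])
    fix s assume "s \<in> displacements"
    then have s: "s \<in> carrier G" using displacements_subset by blast
    have "{v \<in> X. s \<in> cell A \<gamma> v} = {v \<in> X. \<phi> s v \<in> {x \<in> X. x \<in> A \<and> \<gamma> x = inv s}}"
      using s by (auto simp: cell_def)
    then show "measure \<mu> {x \<in> X. x \<in> A \<and> \<gamma> x = inv s} = measure \<mu> {v \<in> X. s \<in> cell A \<gamma> v}"
      using measure_act_vimage[OF assms(1) s cl[of s]] by simp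
  qed
  finally show ?thesis .
qed

lemma measure_le_of_cells:
  assumes "invariant_prob G X \<phi> \<mu>" "clopen_in X A" "clopen_in X B"
    and le: "\<And>v. v \<in> X \<Longrightarrow> c * real (card (cell A \<gamma> v)) \<le> d * real (card (cell B \<gamma> v))"
  shows "c * measure \<mu> A \<le> d * measure \<mu> B"
  unfolding measure_cell[OF assms(1,2)] measure_cell[OF assms(1,3)]
proof (rule sum_measure_mono[OF assms(1) finite_displacements finite_displacements])
  have *: "clopen_in X {v \<in> X. s \<in> cell C \<gamma> v}" if "clopen_in X C" for s C
    by (intro clopen_Collect loc_const_comp[where h = "\<lambda>a. s \<in> a"] loc_const_cell that)
  show "clopen_in X {v \<in> X. s \<in> cell A \<gamma> v}" "clopen_in X {v \<in> X. s \<in> cell B \<gamma> v}" for s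
    using assms * by blast+
  fix x assume x: "x \<in> X"
  have "{s \<in> displacements. x \<in> {v \<in> X. s \<in> cell C \<gamma> v}} = cell C \<gamma> x" for C
    using x cell_subset[OF x] by auto
  then show "c * real (card {s \<in> displacements. x \<in> {v \<in> X. s \<in> cell A \<gamma> v}})
      \<le> d * real (card {s \<in> displacements. x \<in> {v \<in> X. s \<in> cell B \<gamma> v}})"
    using le[OF x] by simp
qed

end

section \<open>Invariant measures along Folner sequences\<close>

lemma clopen_compact: "clopen_in X A \<Longrightarrow> compact A"
  using closedin_compact[OF compact_space] by (auto simp: clopen_in_def)

text \<open>The finite intersection property. It gives every finitely additive content on the clopen
  algebra continuity at the empty set, which is the hypothesis of Caratheodory's theorem.\<close>

lemma decseq_clopen_empty:
  assumes cl: "\<And>i. clopen_in X (A i)" and dec: "decseq A" and empty: "(\<Inter>i. A i) = {}"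
  shows "\<exists>n. \<forall>i\<ge>n. A i = {}"
proof -
  have op: "open (- A i)" for i
    using compact_imp_closed[OF clopen_compact[OF cl]] by (rule open_Compl)
  have "X \<subseteq> (\<Union>i\<in>UNIV. - A i)" using empty by blast
  then obtain D where D: "finite D" "X \<subseteq> (\<Union>i\<in>D. - A i)"
    by (rule compactE_image[OF compact_space op]) auto
  have "A i = {}" if "i \<ge> Max (insert 0 D)" for i
  proof (rule ccontr)
    assume "A i \<noteq> {}"
    then obtain x where x: "x \<in> A i" by blast
    then have "x \<in> X" using cl clopen_subset by blast
    then obtain j where j: "j \<in> D" "x \<notin> A j" using D by blast
    then have "j \<le> i" using that D(1) by simp
    then have "A i \<subseteq> A j" using dec by (simp add: decseq_def)
    then show False using x j by blast
  qed
  then show ?thesis by blast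
qed

text \<open>The points of X at distance at least 1/(n+1) from the complement of S form compact sets
  that exhaust \<open>X \<inter> S\<close>; finitely many clopen subsets of S cover each of
  them.\<close>

lemma open_countable_Union_clopen:
  assumes "open S"
  obtains U :: "nat \<Rightarrow> 'x set" where "\<And>n. clopen_in X (U n)" "X \<inter> S = (\<Union>n. U n)"
proof (cases "S = UNIV")
  \<comment> \<open>This case is separate because the distance to an empty complement is 0 by
    convention.\<close>
  case True
  then show thesis using that[of "\<lambda>_. X"] by simp
next
  case False
  define K where "K n = X \<inter> {x. inverse (real (Suc n)) \<le> infdist x (- S)}" for n
  have closed: "closed (- S)" "- S \<noteq> {}" using assms False by auto
  have KS: "K n \<subseteq> S" for n
  proof
    fix x assume "x \<in> K n"
    then have "infdist x (- S) > 0"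
      by (auto simp: K_def intro: less_le_trans[rotated])
    then show "x \<in> S" by (metis ComplI infdist_zero less_irrefl)
  qed
  have "\<exists>B. clopen_in X B \<and> K n \<subseteq> B \<and> B \<subseteq> S" for n
  proof -
    have "closed {x. inverse (real (Suc n)) \<le> infdist x (- S)}"
      by (intro closed_Collect_le continuous_intros)
    then have 1: "compact (K n)"
      unfolding K_def using compact_space by (rule compact_Int_closed[rotated])
    have 2: "K n \<subseteq> X" by (auto simp: K_def)
    have 3: "\<exists>B. clopen_in X B \<and> x \<in> B \<and> B \<subseteq> S" if "x \<in> K n" for x
    proof -
      have "openin (top_of_set X) (X \<inter> S)" "x \<in> X \<inter> S"
        using that KS assms by (auto simp: K_def openin_open_Int)
      then obtain B where "clopen_in X B" "x \<in> B" "B \<subseteq> X \<inter> S"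
        using zero_dim unfolding zero_dimensional_def by blast
      then show ?thesis by blast
    qed
    obtain \<B> where \<B>: "finite \<B>" "\<And>B. B \<in> \<B> \<Longrightarrow> clopen_in X B \<and> B \<subseteq> S" "K n \<subseteq> \<Union>\<B>"
      by (rule clopen_cover[OF 1 2 3]) auto
    have "clopen_in X (\<Union>B\<in>\<B>. B)"
      using \<B> by (intro clopen_UN) auto
    then show ?thesis using \<B> by (intro exI[of _ "\<Union>\<B>"]) auto
  qed
  then obtain B where B: "\<And>n. clopen_in X (B n) \<and> K n \<subseteq> B n \<and> B n \<subseteq> S"
    using choice[of "\<lambda>n B. clopen_in X B \<and> K n \<subseteq> B \<and> B \<subseteq> S"] by blast
  have "X \<inter> S \<subseteq> (\<Union>n. B n)"
  proof
    fix x assume x: "x \<in> X \<inter> S"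
    then have "infdist x (- S) > 0"
      using infdist_pos_not_in_closed[OF closed] by blast
    then obtain n where "inverse (real (Suc n)) < infdist x (- S)"
      using reals_Archimedean by blast
    then have "x \<in> K n" using x by (auto simp: K_def)
    then show "x \<in> (\<Union>n. B n)" using B by blast
  qed
  moreover have "(\<Union>n. B n) \<subseteq> X \<inter> S" using B clopen_subset by blast
  ultimately show thesis using that[of B] B by blast
qed

lemma algebra_clopen: "algebra X (Collect (clopen_in X))"
  unfolding algebra_iff_Un
  using clopen_subset clopen_Un clopen_Diff[OF clopen_space] by auto

lemma sigma_sets_clopen: "sigma_sets X (Collect (clopen_in X)) = sets (restrict_space borel X)"
proof
  have "Collect (clopen_in X) \<subseteq> sets (restrict_space borel X)"
    by (auto simp: clopen_in_def openin_open sets_restrict_space)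
  then show "sigma_sets X (Collect (clopen_in X)) \<subseteq> sets (restrict_space borel X)"
    by (rule sets.sigma_sets_subset'[of _ _ X]) (auto simp: sets_restrict_space)
  let ?M = "sigma X (Collect (clopen_in X))"
  have C: "Collect (clopen_in X) \<subseteq> Pow X" using clopen_subset by auto
  have sets: "sets ?M = sigma_sets X (Collect (clopen_in X))" "space ?M = X"
    using C by (simp_all add: space_measure_of)
  have "(\<lambda>x. x) \<in> borel_measurable ?M"
  proof (rule borel_measurableI)
    fix S :: "'x set" assume "open S"
    then obtain U :: "nat \<Rightarrow> 'x set" where U: "\<And>n. clopen_in X (U n)" "X \<inter> S = (\<Union>n. U n)"
      using open_countable_Union_clopen by blast
    have "(\<Union>n. U n) \<in> sets ?M"
      using U(1) unfolding sets by (intro sigma_sets.Union) auto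
    then show "(\<lambda>x. x) -` S \<inter> space ?M \<in> sets ?M"
      using U(2) sets(2) by (simp add: Int_commute)
  qed
  then have "X \<inter> B \<in> sets ?M" if "B \<in> sets borel" for B
    using measurable_sets[of "\<lambda>x. x" ?M borel B] that sets(2) by (simp add: Int_commute)
  then show "sets (restrict_space borel X) \<subseteq> sigma_sets X (Collect (clopen_in X))"
    by (auto simp: sets_restrict_space sets)
qed

text \<open>Clopen sets form an intersection-stable generator of the Borel sets, so invariance of
  the extension has to be checked on them only.\<close>

lemma extend_clopen_content:
  assumes m: "\<And>A. 0 \<le> m A" "m X = 1"
    and add: "\<And>A B. clopen_in X A \<Longrightarrow> clopen_in X B \<Longrightarrow> A \<inter> B = {} \<Longrightarrow> m (A \<union> B) = m A + m B"
    and invariant: "\<And>g A. g \<in> carrier G \<Longrightarrow> clopen_in X A \<Longrightarrow> m {x \<in> X. \<phi> g x \<in> A} = m A"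
  obtains \<mu> where "invariant_prob G X \<phi> \<mu>" "\<And>A. clopen_in X A \<Longrightarrow> measure \<mu> A = m A"
proof -
  let ?C = "Collect (clopen_in X)"
  interpret C: algebra X ?C by (rule algebra_clopen)
  have m0: "m {} = 0" using add[of "{}" "{}"] by simp
  have "\<exists>\<mu>. (\<forall>s\<in>?C. \<mu> s = ennreal (m s)) \<and> measure_space X (sigma_sets X ?C) \<mu>"
  proof (rule C.caratheodory_empty_continuous)
    show "positive ?C (\<lambda>A. ennreal (m A))" using m0 by (simp add: positive_def)
    show "additive ?C (\<lambda>A. ennreal (m A))"
      unfolding additive_def using m add by (auto simp: ennreal_plus)
    fix A :: "nat \<Rightarrow> 'x set"
    assume "range A \<subseteq> ?C" "decseq A" "(\<Inter>i. A i) = {}"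
    then obtain n where "\<forall>i\<ge>n. A i = {}" using decseq_clopen_empty[of A] by blast
    then have "\<forall>\<^sub>F i in sequentially. ennreal (m (A i)) = 0"
      unfolding eventually_sequentially using m0 by (intro exI[of _ n]) simp
    then show "(\<lambda>i. ennreal (m (A i))) \<longlonglongrightarrow> 0" by (rule tendsto_eventually)
  qed simp
  then obtain \<mu>0 where \<mu>0: "\<And>s. clopen_in X s \<Longrightarrow> \<mu>0 s = ennreal (m s)"
    "measure_space X (sigma_sets X ?C) \<mu>0" by auto
  define \<mu> where "\<mu> = measure_of X (sigma_sets X ?C) \<mu>0"
  have C: "?C \<subseteq> Pow X" using clopen_subset by auto
  have sC: "sigma_sets X ?C \<subseteq> Pow X" using sigma_sets_into_sp[OF C] by blast
  have sets: "sets \<mu> = sigma_sets X ?C"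
    unfolding \<mu>_def using sC \<mu>0(2) by (simp add: measure_space_def sigma_algebra.sigma_sets_eq)
  have space: "space \<mu> = X" unfolding \<mu>_def using sC by (simp add: space_measure_of)
  have emeasure: "emeasure \<mu> A = ennreal (m A)" if "clopen_in X A" for A
  proof -
    have "A \<in> sigma_sets X ?C" using that by (auto intro: sigma_sets.Basic)
    then have "emeasure \<mu> A = \<mu>0 A"
      unfolding \<mu>_def using \<mu>0(2) by (intro emeasure_measure_of_sigma) (auto simp: measure_space_def)
    then show ?thesis using \<mu>0(1) that by simp
  qed
  have setsr: "sets \<mu> = sets (restrict_space borel X)" using sets sigma_sets_clopen by simp
  have prob: "prob_space \<mu>"
    by (rule prob_spaceI) (use emeasure[of X] m(2) space in simp)
  interpret prob_space \<mu> by (rule prob)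
  have "distr \<mu> \<mu> (\<phi> g) = \<mu>" if g: "g \<in> carrier G" for g
  proof -
    have "\<phi> g \<in> restrict_space borel X \<rightarrow>\<^sub>M borel"
      by (rule borel_measurable_continuous_on_restrict[OF continuous_act[OF g]])
    then have "\<phi> g \<in> restrict_space borel X \<rightarrow>\<^sub>M restrict_space borel X"
      using g by (intro measurable_restrict_space2) (auto simp: space_restrict_space)
    then have meas: "\<phi> g \<in> \<mu> \<rightarrow>\<^sub>M \<mu>"
      using setsr by (simp cong: measurable_cong_sets)
    have eq: "emeasure (distr \<mu> \<mu> (\<phi> g)) A = emeasure \<mu> A" if A: "A \<in> ?C" for A
    proof -
      have "A \<in> sets \<mu>" using A sets by auto
      then have "emeasure (distr \<mu> \<mu> (\<phi> g)) A = emeasure \<mu> (\<phi> g -` A \<inter> space \<mu>)"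
        by (rule emeasure_distr[OF meas])
      also have "\<phi> g -` A \<inter> space \<mu> = {x \<in> X. \<phi> g x \<in> A}" using space by auto
      also have "emeasure \<mu> \<dots> = emeasure \<mu> A"
        using emeasure clopen_Collect_act[OF g] invariant[OF g] A by simp
      finally show ?thesis .
    qed
    show ?thesis
    proof (rule measure_eqI_generator_eq[where E = ?C and \<Omega> = X and A = "\<lambda>_. X"])
      show "Int_stable ?C" by (auto simp: Int_stable_def intro: clopen_Int)
      show "emeasure (distr \<mu> \<mu> (\<phi> g)) X \<noteq> \<infinity>"
        using eq[of X] emeasure[of X] by simp
    qed (use C sets eq in auto)
  qed
  then have "invariant_prob G X \<phi> \<mu>"
    using prob setsr by (simp add: invariant_prob_def)
  moreover have "measure \<mu> A = m A" if "clopen_in X A" for A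
    using emeasure[OF that] m(1) by (simp add: measure_def)
  ultimately show thesis using that by blast
qed

text \<open>Applying g to the visited points replaces F by gF, and this changes a count by at most
  the symmetric difference.\<close>

lemma card_visits_shift:
  assumes F: "finite F" "F \<subseteq> carrier G" and g: "g \<in> carrier G" and x: "x \<in> X"
  shows "\<bar>real (card {f \<in> F. \<phi> g (\<phi> f x) \<in> A}) - real (card {f \<in> F. \<phi> f x \<in> A})\<bar>
       \<le> real (card (sym_diff ({g} <#> F) F))"
proof -
  have inj: "inj_on ((\<otimes>) g) F" using F g by (intro inj_onI) (metis Units_eq Units_l_cancel subsetD)
  have gF: "{g} <#> F = (\<otimes>) g ` F" by (auto simp: set_mult_def)
  define V where "V = (\<lambda>S. {f \<in> S. \<phi> f x \<in> A})"
  have "V ({g} <#> F) = (\<otimes>) g ` {f \<in> F. \<phi> g (\<phi> f x) \<in> A}"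
    using F g x act_mult by (auto simp: V_def gF subset_iff)
  then have 1: "card {f \<in> F. \<phi> g (\<phi> f x) \<in> A} = card (V ({g} <#> F))"
    using inj by (simp add: card_image inj_on_subset)
  have fin: "finite ({g} <#> F)" using F by (simp add: gF)
  have le: "card (V S) \<le> card (V T) + card (sym_diff ({g} <#> F) F)"
    if "S - T \<subseteq> sym_diff ({g} <#> F) F" "finite S" "finite T" for S T
  proof -
    have "card (V S) \<le> card (V T \<union> sym_diff ({g} <#> F) F)"
      using that fin F by (intro card_mono) (auto simp: V_def)
    also have "\<dots> \<le> card (V T) + card (sym_diff ({g} <#> F) F)" by (rule card_Un_le)
    finally show ?thesis .
  qed
  have 2: "card {f \<in> F. \<phi> f x \<in> A} = card (V F)" by (simp add: V_def)
  show ?thesis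
    unfolding 1 2 using le[of "{g} <#> F" F] le[of F "{g} <#> F"] fin F by simp
qed

text \<open>The measure is a limit of the empirical measures of the orbit pieces \<open>F n (x n)\<close>.\<close>

lemma limit_measure:
  assumes F: "Folner_sequence G F" and x: "\<And>n. x n \<in> X"
    and AB: "clopen_in X A" "clopen_in X B"
    and le: "\<And>n. card {f \<in> F n. \<phi> f (x n) \<in> A} \<le> card {f \<in> F n. \<phi> f (x n) \<in> B}"
  obtains \<mu> where "invariant_prob G X \<phi> \<mu>" "measure \<mu> A \<le> measure \<mu> B"
proof -
  have F1: "finite (F n)" "F n \<subseteq> carrier G" for n
    using F by (auto simp: Folner_sequence_def)
  \<comment> \<open>Frequencies are taken of all sets of points, clopen or not, so the limit m is
    finitely additive and invariant on all of them; its restriction to clopen sets is then extended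
    to a measure.\<close>
  define freq where "freq n A = real (card {f \<in> F n. \<phi> f (x n) \<in> A}) / real (card (F n))" for n A
  have bound: "0 \<le> freq n A \<and> freq n A \<le> 1" for n A
    using card_mono[OF F1(1), of "{f \<in> F n. \<phi> f (x n) \<in> A}" n]
    by (auto simp: freq_def divide_le_eq_1)
  obtain m H where H: "H \<noteq> bot" "H \<le> sequentially" and lim: "\<And>A. ((\<lambda>n. freq n A) \<longlongrightarrow> m A) H"
    by (rule pointwise_cluster_filter[of freq, OF bound]) (rule that)
  have ev: "eventually P H" if "eventually P sequentially" for P
    using that H(2) by (simp add: le_filter_def)
  have pos: "\<forall>\<^sub>F n in H. card (F n) > 0"
  proof -
    \<comment> \<open>Invariance under \<one> alone is the strict inequality 0 < |F n|, that is,
      \<open>F n\<close> is nonempty.\<close>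
    have "\<forall>\<^sub>F n in H. Folner_invariant G {\<one>} 1 (F n)"
      using F by (intro ev) (auto simp: Folner_sequence_def)
    then show ?thesis by eventually_elim (auto simp: Folner_invariant_def card_gt_0_iff)
  qed
  have m0: "0 \<le> m A" for A
    using bound by (intro tendsto_lowerbound[OF lim _ H(1)]) auto
  have "\<forall>\<^sub>F n in H. freq n X = 1"
    using pos
  proof eventually_elim
    case (elim n)
    have "{f \<in> F n. \<phi> f (x n) \<in> X} = F n"
      using x act_closed[OF subsetD[OF F1(2)]] by blast
    then show ?case using elim by (simp add: freq_def)
  qed
  then have m1: "m X = 1"
    using tendsto_unique[OF H(1) lim tendsto_eventually] by blast
  have madd: "m (A \<union> B) = m A + m B" if "A \<inter> B = {}" for A B
  proof -
    have "freq n (A \<union> B) = freq n A + freq n B" for n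
    proof -
      have "{f \<in> F n. \<phi> f (x n) \<in> A \<union> B} = {f \<in> F n. \<phi> f (x n) \<in> A} \<union> {f \<in> F n. \<phi> f (x n) \<in> B}"
        by auto
      moreover have "card \<dots> = card {f \<in> F n. \<phi> f (x n) \<in> A} + card {f \<in> F n. \<phi> f (x n) \<in> B}"
        using that F1 by (intro card_Un_disjoint) auto
      ultimately show ?thesis by (simp add: freq_def add_divide_distrib)
    qed
    then have "((\<lambda>n. freq n (A \<union> B)) \<longlongrightarrow> m A + m B) H"
      using tendsto_add[OF lim[of A] lim[of B]] by simp
    then show ?thesis using tendsto_unique[OF H(1) lim] by blast
  qed
  have minv: "m {y \<in> X. \<phi> g y \<in> A} = m A" if g: "g \<in> carrier G" for g A
  proof -
    have "((\<lambda>n. freq n {y \<in> X. \<phi> g y \<in> A} - freq n A) \<longlongrightarrow> 0) H"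
    proof (rule tendstoI)
      fix e :: real assume e: "e > 0"
      have "\<forall>\<^sub>F n in H. Folner_invariant G {g} e (F n)"
        using F g e by (intro ev) (auto simp: Folner_sequence_def)
      then show "\<forall>\<^sub>F n in H. dist (freq n {y \<in> X. \<phi> g y \<in> A} - freq n A) 0 < e"
        using pos
      proof eventually_elim
        case (elim n)
        have *: "{f \<in> F n. \<phi> f (x n) \<in> {y \<in> X. \<phi> g y \<in> A}} = {f \<in> F n. \<phi> g (\<phi> f (x n)) \<in> A}"
          using x act_closed[OF subsetD[OF F1(2)]] by auto
        have "\<bar>freq n {y \<in> X. \<phi> g y \<in> A} - freq n A\<bar> =
            \<bar>real (card {f \<in> F n. \<phi> g (\<phi> f (x n)) \<in> A}) - real (card {f \<in> F n. \<phi> f (x n) \<in> A})\<bar> / real (card (F n))"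
          unfolding freq_def * by (simp add: abs_divide diff_divide_distrib[symmetric])
        also have "\<dots> \<le> real (card (sym_diff ({g} <#> F n) (F n))) / real (card (F n))"
          by (intro divide_right_mono card_visits_shift F1 g x) simp
        also have "\<dots> < e"
          using elim by (simp add: Folner_invariant_def pos_divide_less_eq)
        finally show ?case by (simp add: dist_real_def)
      qed
    qed
    moreover have "((\<lambda>n. freq n {y \<in> X. \<phi> g y \<in> A} - freq n A) \<longlongrightarrow> m {y \<in> X. \<phi> g y \<in> A} - m A) H"
      by (intro tendsto_diff lim)
    ultimately have "m {y \<in> X. \<phi> g y \<in> A} - m A = 0"
      using tendsto_unique[OF H(1)] by blast
    then show ?thesis by simp
  qed
  obtain \<mu> where \<mu>: "invariant_prob G X \<phi> \<mu>" "\<And>A. clopen_in X A \<Longrightarrow> measure \<mu> A = m A"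
    using extend_clopen_content[of m, OF m0 m1 madd minv] by blast
  have "m A \<le> m B"
    by (rule tendsto_le[OF H(1) lim lim])
       (use le in \<open>auto simp: freq_def intro!: always_eventually divide_right_mono\<close>)
  then show thesis using that \<mu> AB by simp
qed

section \<open>From tilings to comparison\<close>

lemma subequivalent_of_cells:
  assumes \<gamma>: "loc_const \<gamma>" "\<And>x. x \<in> X \<Longrightarrow> \<gamma> x \<in> carrier G"
    and AB: "clopen_in X A" "clopen_in X B"
    and le: "\<And>v. v \<in> X \<Longrightarrow> card (cell A \<gamma> v) \<le> card (cell B \<gamma> v)"
  shows "subequivalent G X \<phi> A B"
proof -
  \<comment> \<open>The injection depends only on the two finite sets, not on the base point, so the
    matching is locally constant.\<close>
  define \<iota> :: "'g set \<Rightarrow> 'g set \<Rightarrow> 'g \<Rightarrow> 'g" where "\<iota> P Q = (SOME f. f ` P \<subseteq> Q \<and> inj_on f P)" for P Q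
  have cell_finite: "finite (cell C \<gamma> v)" if "v \<in> X" for C v
    using finite_cell[of \<gamma> v C] \<gamma> that by blast
  have \<iota>: "\<iota> (cell A \<gamma> v) (cell B \<gamma> v) ` cell A \<gamma> v \<subseteq> cell B \<gamma> v \<and> inj_on (\<iota> (cell A \<gamma> v) (cell B \<gamma> v)) (cell A \<gamma> v)"
    if v: "v \<in> X" for v
    using someI_ex[OF card_le_inj[OF cell_finite[OF v] cell_finite[OF v] le[OF v]]] unfolding \<iota>_def by blast
  define h where "h g P Q = \<iota> P Q (inv g) \<otimes> g" for g P Q
  define base where "base x = \<phi> (\<gamma> x) x" for x
  define \<theta> where "\<theta> x = h (\<gamma> x) (cell A \<gamma> (base x)) (cell B \<gamma> (base x))" for x
  define t where "t x = \<iota> (cell A \<gamma> (base x)) (cell B \<gamma> (base x)) (inv (\<gamma> x))" for x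
  have AX: "x \<in> X" if "x \<in> A" for x using that AB clopen_subset by blast
  have base: "base x \<in> X" if "x \<in> X" for x using that \<gamma> by (simp add: base_def)
  have s: "inv (\<gamma> x) \<in> cell A \<gamma> (base x)" if "x \<in> A" for x
    unfolding base_def using that AX \<gamma> by (intro mem_cell_base) auto
  have t: "t x \<in> cell B \<gamma> (base x)" if "x \<in> A" for x
    using \<iota>[OF base[OF AX[OF that]]] s[OF that] by (auto simp: t_def)
  have t': "t x \<in> carrier G" "\<phi> (t x) (base x) \<in> B" if "x \<in> A" for x
    using t[OF that] by (auto simp: cell_def)
  have \<theta>t: "\<theta> x = t x \<otimes> \<gamma> x" for x by (simp add: \<theta>_def t_def h_def)
  have act: "\<phi> (\<theta> x) x = \<phi> (t x) (base x)" if "x \<in> A" for x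
    using \<gamma>(2)[OF AX[OF that]] t' that AX by (simp add: \<theta>t base_def act_mult)
  show ?thesis
  proof (rule subequivalentI[OF AB(1)])
    have "loc_const (\<lambda>x. cell A \<gamma> (base x))" "loc_const (\<lambda>x. cell B \<gamma> (base x))"
      unfolding base_def using \<gamma> loc_const_cell[OF \<gamma> AB(1)] loc_const_cell[OF \<gamma> AB(2)]
      by (auto intro!: loc_const_act_bind)
    then have "loc_const (\<lambda>x. (cell A \<gamma> (base x), cell B \<gamma> (base x)))"
      by (rule loc_const_comp2)
    then have "loc_const (\<lambda>x. case (cell A \<gamma> (base x), cell B \<gamma> (base x)) of (P, Q) \<Rightarrow> h (\<gamma> x) P Q)"
      using \<gamma>(1) by (rule loc_const_comp2[rotated, where h = "\<lambda>g PQ. case PQ of (P, Q) \<Rightarrow> h g P Q"])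
    then show "loc_const \<theta>" by (simp add: \<theta>_def[abs_def])
    show "\<theta> x \<in> carrier G" if "x \<in> A" for x
      using that t' \<gamma> AX by (simp add: \<theta>t)
    show "\<phi> (\<theta> x) x \<in> B" if "x \<in> A" for x
      using that act t' by simp
    show "inj_on (\<lambda>x. \<phi> (\<theta> x) x) A"
    proof (rule inj_onI)
      \<comment> \<open>An image point determines its base point and its displacement there;
        injectivity of \<iota> within that cell then recovers the preimage.\<close>
      fix x y assume xy: "x \<in> A" "y \<in> A" "\<phi> (\<theta> x) x = \<phi> (\<theta> y) y"
      then have eq: "\<phi> (t x) (base x) = \<phi> (t y) (base y)" using act by simp
      have b: "base x = base y"
        using cell_base[OF t base] xy AX eq by metis
      have "inv (t x) = inv (t y)"
        using t[OF xy(1)] t[OF xy(2)] eq by (simp add: cell_def)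
      then have "t x = t y" using t' xy by (metis inv_inv)
      then have "inv (\<gamma> x) = inv (\<gamma> y)"
        using \<iota>[OF base[OF AX[OF xy(1)]]] s[OF xy(1)] s[OF xy(2)] b
        unfolding t_def by (simp add: inj_on_def)
      then have "\<gamma> x = \<gamma> y" using \<gamma>(2) AX xy by (metis inv_inv)
      then show "x = y" using b AX xy \<gamma>(2) act_inj unfolding base_def by metis
    qed
  qed
qed

text \<open>The condition \<open>inv c \<in> sh (\<l> (\<phi> c x))\<close> says that the tile
  centered at c contains the identity. So \<open>\<gamma> x\<close> is the center of the tile of the
  identity in the tiling attached to x.\<close>

lemma tiling_cells:
  assumes sh: "shape_collection G L sh"
    and \<l>: "loc_const \<l>" "\<And>x. x \<in> X \<Longrightarrow> \<l> x \<in> insert 0 L"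
    and ex1: "\<And>x. x \<in> X \<Longrightarrow> \<exists>!c. c \<in> carrier G \<and> \<l> (\<phi> c x) \<noteq> 0 \<and> inv c \<in> sh (\<l> (\<phi> c x))"
  obtains \<gamma> where "loc_const \<gamma>" "\<And>x. x \<in> X \<Longrightarrow> \<gamma> x \<in> carrier G"
    "\<And>v. v \<in> X \<Longrightarrow> cell X \<gamma> v = (if \<l> v = 0 then {} else sh (\<l> v))"
proof -
  define D where "D = (\<Union>l\<in>L. m_inv G ` sh l)"
  have shG: "sh l \<subseteq> carrier G" if "l \<in> L" for l using sh that by (auto simp: shape_collection_def)
  have D: "finite D" "D \<subseteq> carrier G"
    using sh by (auto simp: D_def shape_collection_def)
  define I where "I x = {c \<in> D. \<l> (\<phi> c x) \<noteq> 0 \<and> inv c \<in> sh (\<l> (\<phi> c x))}" for x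
  define \<gamma> where "\<gamma> x = (THE c. c \<in> I x)" for x
  have I: "c \<in> I x \<longleftrightarrow> c \<in> carrier G \<and> \<l> (\<phi> c x) \<noteq> 0 \<and> inv c \<in> sh (\<l> (\<phi> c x))" if "x \<in> X" for c x
  proof -
    have "c \<in> D" if c: "c \<in> carrier G" "\<l> (\<phi> c x) \<noteq> 0" "inv c \<in> sh (\<l> (\<phi> c x))"
      using \<l>(2)[of "\<phi> c x"] c \<open>x \<in> X\<close> inv_inv[of c] unfolding D_def by (metis UN_iff act_closed image_eqI insertE)
    then show ?thesis using D by (auto simp: I_def)
  qed
  have \<gamma>: "c \<in> I x \<longleftrightarrow> c = \<gamma> x" if x: "x \<in> X" for c x
  proof -
    have "\<exists>!c. c \<in> I x" using ex1[OF x] unfolding I[OF x] .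
    then show ?thesis unfolding \<gamma>_def by (metis the_equality)
  qed
  have "loc_const (\<lambda>x. \<l> (\<phi> c x) \<noteq> 0 \<and> inv c \<in> sh (\<l> (\<phi> c x)))" if "c \<in> D" for c
    using loc_const_act[of c \<l>] that D \<l>(1)
    by (intro loc_const_comp[where h = "\<lambda>l. l \<noteq> 0 \<and> inv c \<in> sh l"]) auto
  then have "loc_const I" unfolding I_def by (rule loc_const_Collect[OF D(1)])
  then have "loc_const \<gamma>" unfolding \<gamma>_def by (rule loc_const_comp)
  moreover have G: "\<gamma> x \<in> carrier G" if "x \<in> X" for x
    using \<gamma>[OF that] I[OF that] by blast
  moreover have "cell X \<gamma> v = (if \<l> v = 0 then {} else sh (\<l> v))" if v: "v \<in> X" for v
  proof -
    have "s \<in> cell X \<gamma> v \<longleftrightarrow> s \<in> (if \<l> v = 0 then {} else sh (\<l> v))" for s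
    proof (cases "s \<in> carrier G")
      case True
      then have "s \<in> cell X \<gamma> v \<longleftrightarrow> inv s = \<gamma> (\<phi> s v)" using v by (auto simp: cell_def)
      also have "\<dots> \<longleftrightarrow> inv s \<in> I (\<phi> s v)" using \<gamma> True v by simp
      also have "\<dots> \<longleftrightarrow> \<l> v \<noteq> 0 \<and> s \<in> sh (\<l> v)" using I True v by simp
      finally show ?thesis by simp
    next
      case False
      then show ?thesis using \<l>(2)[OF v] shG by (auto simp: cell_def)
    qed
    then show ?thesis by blast
  qed
  ultimately show thesis using that by blast
qed

text \<open>The partition makes the tile of the identity unique; uniqueness of its center comes from
  the injectivity of the assignment of tiles to centers.\<close>

lemma is_tiling_ex1:
  assumes "is_tiling G sh t" "\<And>c. c \<in> carrier G \<Longrightarrow> t c \<noteq> 0 \<Longrightarrow> sh (t c) \<subseteq> carrier G"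
  shows "\<exists>!c. c \<in> carrier G \<and> t c \<noteq> 0 \<and> inv c \<in> sh (t c)"
proof -
  have mem: "\<one> \<in> tile G sh t c \<longleftrightarrow> inv c \<in> sh (t c)" if c: "c \<in> centers G t" for c
  proof -
    have c: "c \<in> carrier G" "t c \<noteq> 0" using c by (auto simp: centers_def)
    have "\<one> = s \<otimes> c \<longleftrightarrow> s = inv c" if "s \<in> sh (t c)" for s
      using that assms(2)[OF c] c(1) by (metis inv_equality l_inv subsetD)
    then show ?thesis by (auto simp: tile_def r_coset_def)
  qed
  have part: "partition_on (carrier G) (tiles G sh t)" and inj: "inj_on (tile G sh t) (centers G t)"
    using assms(1) by (auto simp: is_tiling_def)
  obtain U where "U \<in> tiles G sh t" "\<one> \<in> U"
    using part one_closed unfolding partition_on_def by (metis UnionE)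
  then obtain c where c: "c \<in> centers G t" "\<one> \<in> tile G sh t c" by (auto simp: tiles_def)
  have unique: "c' = c" if c': "c' \<in> centers G t" "\<one> \<in> tile G sh t c'" for c'
  proof -
    have "tile G sh t c' = tile G sh t c"
      using part c c' by (auto simp: partition_on_def disjoint_def tiles_def)
    then show ?thesis using inj c c' by (auto simp: inj_on_def)
  qed
  show ?thesis
  proof (intro ex1I[of _ c] conjI)
    show "c \<in> carrier G" "t c \<noteq> 0" using c by (simp_all add: centers_def)
    show "inv c \<in> sh (t c)" using c mem by blast
    fix c' assume "c' \<in> carrier G \<and> t c' \<noteq> 0 \<and> inv c' \<in> sh (t c')"
    then have "c' \<in> centers G t" "inv c' \<in> sh (t c')" by (simp_all add: centers_def)
    then show "c' = c" using mem unique by blast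
  qed
qed

theorem tiling_factor_comparison:
  assumes "has_tiling_system_factor G X \<phi>"
  shows "admits_comparison G X \<phi>"
  unfolding admits_comparison_def
proof (intro allI impI, elim conjE)
  fix A B assume AB: "clopen_in X A" "clopen_in X B"
    and less: "\<forall>\<mu>. invariant_prob G X \<phi> \<mu> \<longrightarrow> measure \<mu> A < measure \<mu> B"
  obtain L sh T Z \<pi> where ts: "tiling_system G L sh T Z"
    and \<pi>: "factor_map G X \<phi> Z (product_action (shift G)) \<pi>"
    using assms by (auto simp: has_tiling_system_factor_def topological_factor_def)
  have dt: "dynamical_tiling G (L k) (sh k) (T k)" for k
    using ts by (auto simp: tiling_system_def Folner_system_def)
  have join: "joining G (shift G) T Z"
    using ts by (auto simp: tiling_system_def Folner_system_def)
  have shG: "sh k l \<subseteq> carrier G" "finite (sh k l)" if "l \<in> L k" for k l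
    using dt[of k] that by (auto simp: dynamical_tiling_def shape_collection_def)
  have "\<exists>k. \<forall>l\<in>L k. \<forall>x\<in>X. card {f \<in> sh k l. \<phi> f x \<in> A} \<le> card {f \<in> sh k l. \<phi> f x \<in> B}"
  proof (rule ccontr)
    assume "\<not> ?thesis"
    \<comment> \<open>A weak inequality is all that survives the passage to the limit, and it still
      contradicts the strict one between the measures. Pairing label and point allows a single
      choice.\<close>
    then have "\<forall>k. \<exists>p. fst p \<in> L k \<and> snd p \<in> X \<and>
        card {f \<in> sh k (fst p). \<phi> f (snd p) \<in> B} \<le> card {f \<in> sh k (fst p). \<phi> f (snd p) \<in> A}"
      by (simp add: not_le) (meson less_imp_le)
    then obtain p where p: "\<forall>k. fst (p k) \<in> L k \<and> snd (p k) \<in> X \<and>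
        card {f \<in> sh k (fst (p k)). \<phi> f (snd (p k)) \<in> B} \<le> card {f \<in> sh k (fst (p k)). \<phi> f (snd (p k)) \<in> A}"
      unfolding choice_iff ..
    define l x where "l k = fst (p k)" and "x k = snd (p k)" for k
    have lx: "\<And>k. l k \<in> L k" "\<And>k. x k \<in> X"
      "\<And>k. card {f \<in> sh k (l k). \<phi> f (x k) \<in> B} \<le> card {f \<in> sh k (l k). \<phi> f (x k) \<in> A}"
      using p by (simp_all add: l_def x_def)
    have "Folner_sequence G (\<lambda>k. sh k (l k))"
      unfolding Folner_sequence_def
    proof (intro conjI allI impI)
      fix K :: "'g set" and \<epsilon> :: real
      assume "finite K \<and> K \<noteq> {} \<and> K \<subseteq> carrier G \<and> 0 < \<epsilon>"
      then have "\<forall>\<^sub>F k in sequentially. \<forall>l\<in>L k. Folner_invariant G K \<epsilon> (sh k l)"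
        using ts by (auto simp: tiling_system_def Folner_system_def)
      then show "\<forall>\<^sub>F k in sequentially. Folner_invariant G K \<epsilon> (sh k (l k))"
        by eventually_elim (use lx in auto)
    qed (use shG lx in auto)
    then obtain \<mu> where "invariant_prob G X \<phi> \<mu>" "measure \<mu> B \<le> measure \<mu> A"
      by (rule limit_measure[OF _ lx(2) AB(2,1) lx(3)])
    then show False using less by force
  qed
  then obtain k where k: "\<And>l x. l \<in> L k \<Longrightarrow> x \<in> X \<Longrightarrow>
    card {f \<in> sh k l. \<phi> f x \<in> A} \<le> card {f \<in> sh k l. \<phi> f x \<in> B}" by blast
  \<comment> \<open>By equivariance the symbol at g is the symbol at \<one> of the configuration of
    \<open>\<phi> g x\<close>, so this one locally constant function contains the whole tiling of
    level k.\<close>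
  define \<l> where "\<l> x = \<pi> x k \<one>" for x
  have \<pi>Z: "\<pi> x \<in> Z" if "x \<in> X" for x using \<pi> that by (auto simp: factor_map_def)
  have \<pi>T: "\<pi> x k \<in> T k" if "x \<in> X" for x
    using join \<pi>Z[OF that] unfolding joining_def by (metis imageI)
  have shift: "\<l> (\<phi> g x) = \<pi> x k g" if "g \<in> carrier G" "x \<in> X" for g x
    using \<pi> that by (simp add: \<l>_def factor_map_def product_action_def shift_def)
  have "closedin (top_of_set (carrier G \<rightarrow>\<^sub>E insert 0 (L k))) (T k)"
    using dt[of k] by (simp add: dynamical_tiling_def subshift_def)
  then have TL: "T k \<subseteq> carrier G \<rightarrow>\<^sub>E insert 0 (L k)"
    using closedin_subset by fastforce
  have range: "\<l> x \<in> insert 0 (L k)" if "x \<in> X" for x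
    using subsetD[OF TL \<pi>T[OF that]] one_closed unfolding \<l>_def by (rule PiE_mem)
  have sc: "shape_collection G (L k) (sh k)" using dt[of k] by (simp add: dynamical_tiling_def)
  have lc: "loc_const \<l>"
    unfolding loc_const_def
  proof
    fix x assume x: "x \<in> X"
    have "continuous_on X \<pi>" using \<pi> by (simp add: factor_map_def)
    then have "continuous_on X (\<lambda>x. \<pi> x k)"
      by (rule continuous_on_product_then_coordinatewise)
    then have "continuous_on X (\<lambda>x. \<pi> x k \<one>)"
      by (rule continuous_on_product_then_coordinatewise)
    from this[unfolded continuous_on_topological, rule_format, OF x Topological_Spaces.open_discrete[of "{\<pi> x k \<one>}"]]
    have "\<exists>U. open U \<and> x \<in> U \<and> (\<forall>y\<in>X. y \<in> U \<longrightarrow> \<pi> y k \<one> \<in> {\<pi> x k \<one>})"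
      by simp
    then show "\<forall>\<^sub>F y in nhd x. \<l> y = \<l> x"
      unfolding eventually_nhd \<l>_def by blast
  qed
  have ex1: "\<exists>!c. c \<in> carrier G \<and> \<l> (\<phi> c x) \<noteq> 0 \<and> inv c \<in> sh k (\<l> (\<phi> c x))" if x: "x \<in> X" for x
  proof -
    have "is_tiling G (sh k) (\<pi> x k)"
      using dt[of k] \<pi>T[OF x] by (auto simp: dynamical_tiling_def)
    moreover have "sh k (\<pi> x k c) \<subseteq> carrier G" if "c \<in> carrier G" "\<pi> x k c \<noteq> 0" for c
      using range[of "\<phi> c x"] shift[OF that(1) x] that x shG by simp
    ultimately have "\<exists>!c. c \<in> carrier G \<and> \<pi> x k c \<noteq> 0 \<and> inv c \<in> sh k (\<pi> x k c)"
      by (rule is_tiling_ex1)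
    then show ?thesis using shift x by (metis (no_types, lifting))
  qed
  obtain \<gamma> where \<gamma>: "loc_const \<gamma>" "\<And>x. x \<in> X \<Longrightarrow> \<gamma> x \<in> carrier G"
    and cell: "\<And>v. v \<in> X \<Longrightarrow> cell X \<gamma> v = (if \<l> v = 0 then {} else sh k (\<l> v))"
    using tiling_cells[OF sc lc range ex1] by blast
  show "subequivalent G X \<phi> A B"
  proof (rule subequivalent_of_cells[OF \<gamma> AB])
    fix v assume v: "v \<in> X"
    have "cell C \<gamma> v = {f \<in> cell X \<gamma> v. \<phi> f v \<in> C}" if "clopen_in X C" for C
      using clopen_subset[OF that] by (auto simp: cell_def)
    then show "card (cell A \<gamma> v) \<le> card (cell B \<gamma> v)"
      using k[of "\<l> v" v] range[OF v] v AB cell[OF v] by auto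
  qed
qed

section \<open>The Ornstein-Weiss construction\<close>

text \<open>Injectivity of the map that sends (f, v) to f v: the orbit pieces F v with v in V are
  disjoint faithful copies of F.\<close>

definition separated :: "'g set \<Rightarrow> 'x set \<Rightarrow> bool" where
  "separated F V \<longleftrightarrow> (\<forall>f\<in>F. \<forall>f'\<in>F. \<forall>v\<in>V. \<forall>v'\<in>V. \<phi> f v = \<phi> f' v' \<longrightarrow> f = f' \<and> v = v')"

text \<open>By freeness each of the finitely many quotients \<open>inv f \<otimes> f'\<close> other
  than \<one> moves x, and a small enough B is disjoint from its image under each of them.\<close>

lemma separated_nbhd:
  assumes free: "free_system G X \<phi>" and F: "finite F" "F \<subseteq> carrier G" and x: "x \<in> X"
  shows "\<exists>B. clopen_in X B \<and> x \<in> B \<and> separated F B"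
proof -
  define H where "H = (\<lambda>(f, f'). inv f \<otimes> f') ` (F \<times> F) - {\<one>}"
  have H: "finite H" "H \<subseteq> carrier G" using F by (auto simp: H_def)
  have ex: "\<exists>p. open (fst p) \<and> open (snd p) \<and> x \<in> fst p \<and> \<phi> h x \<in> snd p \<and> fst p \<inter> snd p = {}"
    if h: "h \<in> H" for h
  proof -
    have "h \<in> carrier G" "h \<noteq> \<one>" using h H by (auto simp: H_def)
    then have "x \<noteq> \<phi> h x" using free x unfolding free_system_def by force
    then obtain U V where "open U" "open V" "x \<in> U" "\<phi> h x \<in> V" "U \<inter> V = {}"
      using hausdorff[of x "\<phi> h x"] by blast
    then show ?thesis by (intro exI[of _ "(U, V)"]) simp
  qed
  obtain p where p: "\<forall>h\<in>H. open (fst (p h)) \<and> open (snd (p h)) \<and> x \<in> fst (p h) \<and>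
      \<phi> h x \<in> snd (p h) \<and> fst (p h) \<inter> snd (p h) = {}"
    using bchoice[OF ballI[OF ex]] ..
  define U V where "U h = fst (p h)" and "V h = snd (p h)" for h
  have UV: "open (U h) \<and> open (V h) \<and> x \<in> U h \<and> \<phi> h x \<in> V h \<and> U h \<inter> V h = {}" if "h \<in> H" for h
    using p that by (simp add: U_def V_def)
  have "\<forall>\<^sub>F y in nhd x. y \<in> U h \<and> \<phi> h y \<in> V h" if h: "h \<in> H" for h
  proof (rule eventually_conj)
    show "\<forall>\<^sub>F y in nhd x. y \<in> U h"
      using UV[OF h] unfolding eventually_nhd by blast
    have "\<forall>\<^sub>F y in nhd (\<phi> h x). y \<in> V h"
      using UV[OF h] unfolding eventually_nhd by blast
    then show "\<forall>\<^sub>F y in nhd x. \<phi> h y \<in> V h"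
      using filterlim_act[of h x] h H x by (auto simp: filterlim_iff)
  qed
  then have "\<forall>\<^sub>F y in nhd x. \<forall>h\<in>H. y \<in> U h \<and> \<phi> h y \<in> V h"
    by (intro eventually_ball_finite H(1)) auto
  then obtain S where S: "open S" "x \<in> S" "\<forall>y\<in>X \<inter> S. \<forall>h\<in>H. y \<in> U h \<and> \<phi> h y \<in> V h"
    unfolding eventually_nhd by blast
  obtain B where B: "clopen_in X B" "x \<in> B" "B \<subseteq> X \<inter> S"
    using zero_dim openin_open_Int[OF S(1), of X] x S(2) unfolding zero_dimensional_def by blast
  have "separated F B"
    unfolding separated_def
  proof (intro ballI impI)
    fix f f' v v' assume *: "f \<in> F" "f' \<in> F" "v \<in> B" "v' \<in> B" "\<phi> f v = \<phi> f' v'"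
    have G: "f \<in> carrier G" "f' \<in> carrier G" "v \<in> X" "v' \<in> X" using * F B by auto
    have v: "v = \<phi> (inv f \<otimes> f') v'"
      using G *(5) by (metis act_inv act_mult inv_closed)
    have "f = f'"
    proof (rule ccontr)
      assume "f \<noteq> f'"
      have "inv f \<otimes> f' \<noteq> \<one>"
      proof
        assume "inv f \<otimes> f' = \<one>"
        then have "f \<otimes> (inv f \<otimes> f') = f" using G by simp
        then show False using G \<open>f \<noteq> f'\<close> by (simp add: m_assoc[symmetric])
      qed
      then have h: "inv f \<otimes> f' \<in> H" using * by (auto simp: H_def)
      have "v \<in> U (inv f \<otimes> f')" "\<phi> (inv f \<otimes> f') v' \<in> V (inv f \<otimes> f')"
        using S(3) B(3) * h by blast+
      then show False using v UV[OF h] by auto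
    qed
    then show "f = f' \<and> v = v'" using * G act_inj by metis
  qed
  then show ?thesis using B by blast
qed

text \<open>It serves to express \<open>saturation L W - W\<close>, the outer L-boundary of W inside
  X.\<close>

definition saturation :: "'g set \<Rightarrow> 'x set \<Rightarrow> 'x set" where
  "saturation L W = (\<Union>g\<in>L. \<phi> g ` W)"

lemma clopen_saturation:
  "finite L \<Longrightarrow> L \<subseteq> carrier G \<Longrightarrow> clopen_in X W \<Longrightarrow> clopen_in X (saturation L W)"
  unfolding saturation_def by (intro clopen_UN clopen_act) auto

text \<open>The invariance is demanded at every v in X; where v is not the base of a cell, the cell
  is empty and the demand is void.\<close>

definition castle :: "'g set \<Rightarrow> real \<Rightarrow> 'x set \<Rightarrow> ('x \<Rightarrow> 'g) \<Rightarrow> bool" where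
  "castle K \<kappa> W \<gamma> \<longleftrightarrow> clopen_in X W \<and> loc_const \<gamma> \<and> (\<forall>x\<in>X. \<gamma> x \<in> carrier G) \<and>
     (\<forall>v\<in>X. almost_inv G K \<kappa> (cell W \<gamma> v))"

text \<open>The points \<open>v\<close> of \<open>V\<close> for which most of \<open>F v\<close> is still free receive the free part of \<open>F v\<close>;
  if \<open>v\<close> was already the base of a cell, the two cells merge, which does no harm to their
  almost invariance. The potential in the last conclusion can only decrease because new tiles
  are at least half free.\<close>

lemma greedy_step:
  assumes K: "finite K" and L: "finite L" "L \<subseteq> carrier G"
    and F: "almost_inv G (K \<union> L) \<kappa> F" and \<kappa>: "0 < \<kappa>" "\<kappa> \<le> \<epsilon>" and \<epsilon>: "\<epsilon> \<le> 1/2"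
    and V: "clopen_in X V" "separated F V"
    and c: "castle K (4 * \<epsilon>) W \<gamma>"
  obtains W' \<gamma>' where "castle K (4 * \<epsilon>) W' \<gamma>'" "W \<subseteq> W'"
    "\<And>v. v \<in> V \<Longrightarrow> \<epsilon> * real (card F) \<le> real (card {f \<in> F. \<phi> f v \<in> W'})"
    "\<And>\<mu>. invariant_prob G X \<phi> \<mu> \<Longrightarrow> measure \<mu> (saturation L W' - W') - 2 * \<kappa> * measure \<mu> W' \<le>
        measure \<mu> (saturation L W - W) - 2 * \<kappa> * measure \<mu> W"
proof -
  have W: "clopen_in X W" and \<gamma>: "loc_const \<gamma>" "\<And>x. x \<in> X \<Longrightarrow> \<gamma> x \<in> carrier G"
    and cells: "\<And>v. v \<in> X \<Longrightarrow> almost_inv G K (4 * \<epsilon>) (cell W \<gamma> v)"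
    using c by (auto simp: castle_def)
  have F1: "finite F" "F \<subseteq> carrier G" using F by (auto simp: almost_inv_def)
  have FG: "f \<in> carrier G" if "f \<in> F" for f using F1 that by blast
  define new where "new v = {f \<in> F. \<phi> f v \<notin> W}" for v
  define U where "U = {v \<in> X. v \<in> V \<and> (1 - \<epsilon>) * real (card F) \<le> real (card (new v))}"
  define FU where "FU = (\<Union>f\<in>F. \<phi> f ` U)"
  have lc_new: "loc_const new"
    unfolding new_def
    by (intro loc_const_Collect F1 loc_const_comp[where h = Not]
        loc_const_act[where f = "\<lambda>x. x \<in> W"] loc_const_mem W FG)
  have U: "clopen_in X U"
    unfolding U_def
    by (intro clopen_Collect loc_const_comp2[where h = "\<lambda>a b. a \<and> (1 - \<epsilon>) * real (card F) \<le> real (card b)"]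
        loc_const_mem V lc_new)
  have UV: "U \<subseteq> V" and UX: "U \<subseteq> X" by (auto simp: U_def)
  have FU: "clopen_in X FU" unfolding FU_def using F1 U FG by (intro clopen_UN clopen_act) auto
  define W' where "W' = W \<union> FU"
  have W': "clopen_in X W'" unfolding W'_def by (intro clopen_Un W FU)
  \<comment> \<open>By separation this is a singleton on \<open>FU\<close>. Points outside both W
    and \<open>FU\<close> fall under the default in \<open>h\<close> and keep their old value, which
    enters no cell of \<open>W'\<close>.\<close>
  define hit where "hit x = {f \<in> F. \<phi> (inv f) x \<in> U}" for x
  define h where "h w g I = (if w \<or> I = {} then g else inv (SOME f. f \<in> I))" for w and g :: 'g and I
  define \<gamma>' where "\<gamma>' x = h (x \<in> W) (\<gamma> x) (hit x)" for x
  have sep: "f = f' \<and> v = v'" if "f \<in> F" "f' \<in> F" "v \<in> U" "v' \<in> U" "\<phi> f v = \<phi> f' v'" for f f' v v'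
    using V(2) that UV unfolding separated_def by blast
  have hit: "hit (\<phi> f v) = {f}" if fv: "f \<in> F" "v \<in> U" for f v
  proof
    have v: "v \<in> X" using fv UX by blast
    show "{f} \<subseteq> hit (\<phi> f v)" using fv FG v by (auto simp: hit_def)
    show "hit (\<phi> f v) \<subseteq> {f}"
    proof
      fix f' assume "f' \<in> hit (\<phi> f v)"
      then have f': "f' \<in> F" "\<phi> (inv f') (\<phi> f v) \<in> U" by (auto simp: hit_def)
      have "\<phi> f' (\<phi> (inv f') (\<phi> f v)) = \<phi> f v" using fv f' FG v by simp
      then show "f' \<in> {f}" using sep[OF f'(1) fv(1) f'(2) fv(2)] by simp
    qed
  qed
  have \<gamma>'W: "\<gamma>' x = \<gamma> x" if "x \<in> W" for x using that by (simp add: \<gamma>'_def h_def)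
  have \<gamma>'FU: "\<gamma>' (\<phi> f v) = inv f" if "f \<in> F" "v \<in> U" "\<phi> f v \<notin> W" for f v
    using hit[OF that(1,2)] that by (simp add: \<gamma>'_def h_def)
  have "loc_const hit"
    unfolding hit_def
    by (intro loc_const_Collect F1 loc_const_act[where f = "\<lambda>x. x \<in> U"] loc_const_mem U inv_closed FG)
  then have "loc_const (\<lambda>x. (\<gamma> x, hit x))" 
    by (rule loc_const_comp2[OF \<gamma>(1)])
  then have "loc_const (\<lambda>x. h (x \<in> W) (fst (\<gamma> x, hit x)) (snd (\<gamma> x, hit x)))"
    using loc_const_mem[OF W] by (rule loc_const_comp2[rotated, where h = "\<lambda>w p. h w (fst p) (snd p)"])
  then have lc\<gamma>': "loc_const \<gamma>'" by (simp add: \<gamma>'_def[abs_def])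
  have G\<gamma>': "\<gamma>' x \<in> carrier G" if x: "x \<in> X" for x
  proof (cases "x \<in> W \<or> hit x = {}")
    case True
    then show ?thesis using \<gamma>(2)[OF x] by (auto simp: \<gamma>'_def h_def)
  next
    case False
    then have "(SOME f. f \<in> hit x) \<in> hit x" by (simp add: some_in_eq)
    then have "(SOME f. f \<in> hit x) \<in> carrier G" using FG by (auto simp: hit_def)
    then show ?thesis using False by (simp add: \<gamma>'_def h_def)
  qed
  have cell': "cell W' \<gamma>' v = cell W \<gamma> v \<union> (if v \<in> U then new v else {})" if v: "v \<in> X" for v
  proof
    show "cell W' \<gamma>' v \<subseteq> cell W \<gamma> v \<union> (if v \<in> U then new v else {})"
    proof
      fix s assume s: "s \<in> cell W' \<gamma>' v"
      show "s \<in> cell W \<gamma> v \<union> (if v \<in> U then new v else {})"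
      proof (cases "\<phi> s v \<in> W")
        case True
        then show ?thesis using s \<gamma>'W by (simp add: cell_def)
      next
        case False
        then have "\<phi> s v \<in> FU" using s by (auto simp: cell_def W'_def)
        then obtain f u where fu: "f \<in> F" "u \<in> U" "\<phi> s v = \<phi> f u" by (auto simp: FU_def)
        have sG: "s \<in> carrier G" using s by (auto simp: cell_def)
        have "inv s = inv f" using s \<gamma>'FU[OF fu(1,2)] fu(3) False by (simp add: cell_def)
        then have "s = f" using sG FG[OF fu(1)] by (metis inv_inv)
        moreover have "v = u" using act_inj[OF v _ sG] fu UX \<open>s = f\<close> by auto
        ultimately show ?thesis using fu False by (simp add: new_def)
      qed
    qed
    show "cell W \<gamma> v \<union> (if v \<in> U then new v else {}) \<subseteq> cell W' \<gamma>' v"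
      using \<gamma>'W \<gamma>'FU FG by (auto simp: cell_def W'_def FU_def new_def)
  qed
  have castle': "castle K (4 * \<epsilon>) W' \<gamma>'"
    unfolding castle_def
  proof (intro conjI ballI W' lc\<gamma>' G\<gamma>')
    fix v assume v: "v \<in> X"
    show "almost_inv G K (4 * \<epsilon>) (cell W' \<gamma>' v)"
    proof (cases "v \<in> U")
      case True
      have FK: "almost_inv G K \<epsilon> F"
        using F \<kappa> K L by (intro almost_inv_mono[OF F]) auto
      have "almost_inv G K (4 * \<epsilon>) (new v)"
        by (rule almost_inv_of_subset[OF FK _ _ _ \<epsilon> K]) (use True \<kappa> in \<open>auto simp: new_def U_def\<close>)
      then show ?thesis
        unfolding cell'[OF v] using True cells[OF v] K
        by (auto intro!: almost_inv_union simp: cell_def new_def)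
    qed (use cells[OF v] cell'[OF v] in simp)
  qed
  have "\<epsilon> * real (card F) \<le> real (card {f \<in> F. \<phi> f v \<in> W'})" if v: "v \<in> V" for v
  proof (cases "v \<in> U")
    case True
    then have "{f \<in> F. \<phi> f v \<in> W'} = F" by (auto simp: W'_def FU_def)
    then show ?thesis using mult_right_mono[of \<epsilon> 1 "real (card F)"] \<epsilon> by simp
  next
    case False
    then have *: "real (card (new v)) < (1 - \<epsilon>) * real (card F)"
      using v V clopen_subset by (auto simp: U_def)
    have "card F = card (new v) + card {f \<in> F. \<phi> f v \<in> W}"
      using F1 by (subst card_Un_disjoint[symmetric]) (auto simp: new_def intro!: arg_cong[where f = card])
    moreover have "card {f \<in> F. \<phi> f v \<in> W} \<le> card {f \<in> F. \<phi> f v \<in> W'}"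
      using F1 by (intro card_mono) (auto simp: W'_def)
    ultimately show ?thesis using * by (simp add: algebra_simps)
  qed
  moreover have "measure \<mu> (saturation L W' - W') - 2 * \<kappa> * measure \<mu> W' \<le>
        measure \<mu> (saturation L W - W) - 2 * \<kappa> * measure \<mu> W" if \<mu>: "invariant_prob G X \<phi> \<mu>" for \<mu>
  proof -
    \<comment> \<open>Gain of mass: each u in U lies in at least (1 - \<epsilon>)|F| of the sets
      \<open>Q f\<close>, and their images under the respective f are disjoint subsets of
      \<open>W' - W\<close>.\<close>
    define Q where "Q f = {v \<in> X. v \<in> U \<and> \<phi> f v \<notin> W}" for f
    have Q: "clopen_in X (Q f)" if "f \<in> F" for f
      unfolding Q_def
      by (intro clopen_Collect loc_const_comp2[where h = "\<lambda>a b. a \<and> \<not> b"] loc_const_mem U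
          loc_const_act[where f = "\<lambda>x. x \<in> W"] W FG that)
    have "(1 - \<epsilon>) * real (card F) * measure \<mu> U \<le> (\<Sum>f\<in>F. measure \<mu> (Q f))"
    proof (rule measure_le_sum[OF \<mu> F1(1) U Q])
      fix v assume "v \<in> U"
      moreover from this have "{f \<in> F. v \<in> Q f} = new v" using UX by (auto simp: Q_def new_def)
      ultimately show "(1 - \<epsilon>) * real (card F) \<le> real (card {f \<in> F. v \<in> Q f})"
        by (simp add: U_def)
    qed
    also have "\<dots> = (\<Sum>f\<in>F. measure \<mu> (\<phi> f ` Q f))"
      using measure_act_image[OF \<mu> FG Q] by simp
    also have "\<dots> = measure \<mu> (\<Union>f\<in>F. \<phi> f ` Q f)"
    proof (rule measure_disjoint_UN[OF \<mu> F1(1), symmetric])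
      show "disjoint_family_on (\<lambda>f. \<phi> f ` Q f) F"
        using sep by (fastforce simp: disjoint_family_on_def Q_def)
    qed (use clopen_act[OF FG Q] in auto)
    also have "\<dots> \<le> measure \<mu> (W' - W)"
    proof (rule measure_mono_clopen[OF \<mu>])
      show "(\<Union>f\<in>F. \<phi> f ` Q f) \<subseteq> W' - W" by (auto simp: W'_def FU_def Q_def)
      show "clopen_in X (\<Union>f\<in>F. \<phi> f ` Q f)" using F1(1) clopen_act[OF FG Q] by (rule clopen_UN)
    qed (intro clopen_Diff W W')
    also have "\<dots> = measure \<mu> W' - measure \<mu> W"
      by (rule measure_Diff_clopen[OF \<mu> W W']) (auto simp: W'_def)
    finally have 1: "(1 - \<epsilon>) * real (card F) * measure \<mu> U \<le> measure \<mu> W' - measure \<mu> W" .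
    \<comment> \<open>Growth of the boundary: a boundary point reached from a new orbit piece F u is
      g u with g in the outer L-boundary of F, so the growth is at most |H| times the measure of
      U.\<close>
    define H where "H = (L <#> F) - F"
    have H: "finite H" "H \<subseteq> carrier G"
      using L F1 finite_set_mult[of L F] set_mult_closed[of L F] unfolding H_def by blast+
    have HU: "clopen_in X (\<phi> g ` U)" if "g \<in> H" for g using that H U clopen_act by blast
    have sub: "saturation L W' - W' \<subseteq> (saturation L W - W) \<union> (\<Union>g\<in>H. \<phi> g ` U)"
    proof
      fix x assume x: "x \<in> saturation L W' - W'"
      then obtain l y where l: "l \<in> L" "y \<in> W'" "x = \<phi> l y" by (auto simp: saturation_def)
      show "x \<in> (saturation L W - W) \<union> (\<Union>g\<in>H. \<phi> g ` U)"
      proof (cases "y \<in> W")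
        case True
        then show ?thesis using l x by (auto simp: saturation_def W'_def)
      next
        case False
        then obtain f u where fu: "f \<in> F" "u \<in> U" "y = \<phi> f u" using l by (auto simp: W'_def FU_def)
        then have xu: "x = \<phi> (l \<otimes> f) u" 
          using l L FG[OF fu(1)] UX act_mult[of u l f] by blast
        have "l \<otimes> f \<in> L <#> F" using l fu by (auto simp: set_mult_def)
        moreover have "l \<otimes> f \<notin> F" using xu x fu by (auto simp: W'_def FU_def)
        ultimately show ?thesis using xu fu by (auto simp: H_def)
      qed
    qed
    have sL: "clopen_in X (saturation L S - S)" if "clopen_in X S" for S
      by (intro clopen_Diff clopen_saturation L that)
    have "measure \<mu> (saturation L W' - W') \<le> measure \<mu> ((saturation L W - W) \<union> (\<Union>g\<in>H. \<phi> g ` U))"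
      by (rule measure_mono_clopen[OF \<mu> _ sub])
         (intro clopen_Un sL W W' clopen_UN H HU | assumption)+
    also have "\<dots> \<le> measure \<mu> (saturation L W - W) + measure \<mu> (\<Union>g\<in>H. \<phi> g ` U)"
      by (rule measure_Un_le[OF \<mu>]) (intro sL W clopen_UN H HU | assumption)+
    also have "measure \<mu> (\<Union>g\<in>H. \<phi> g ` U) \<le> (\<Sum>g\<in>H. measure \<mu> (\<phi> g ` U))"
      by (rule measure_UN_le[OF \<mu> H(1) HU])
    also have "\<dots> = real (card H) * measure \<mu> U"
      using measure_act_image[OF \<mu> _ U] H by (simp add: subset_iff)
    also have "\<dots> \<le> \<kappa> * real (card F) * measure \<mu> U"
    proof (rule mult_right_mono)
      have "almost_inv G L \<kappa> F" using K L by (intro almost_inv_mono[OF F]) auto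
      then show "real (card H) \<le> \<kappa> * real (card F)" by (simp add: almost_inv_def H_def)
    qed simp
    finally have 2: "measure \<mu> (saturation L W' - W') \<le>
      measure \<mu> (saturation L W - W) + \<kappa> * real (card F) * measure \<mu> U" by simp
    \<comment> \<open>Since 1 - \<epsilon> \<ge> 1/2, |F| times the measure of U is at most twice
      the gain in measure of W; this is the 2 in the potential.\<close>
    have "1/2 * (real (card F) * measure \<mu> U) \<le> (1 - \<epsilon>) * (real (card F) * measure \<mu> U)"
      using \<epsilon> by (intro mult_right_mono) auto
    then have "real (card F) * measure \<mu> U \<le> 2 * (measure \<mu> W' - measure \<mu> W)"
      using 1 by (simp add: mult.assoc)
    then have "\<kappa> * (real (card F) * measure \<mu> U) \<le> \<kappa> * (2 * (measure \<mu> W' - measure \<mu> W))"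
      using \<kappa> by (intro mult_left_mono) auto
    then show ?thesis using 2 by (simp add: algebra_simps)
  qed
  ultimately show thesis using that[OF castle'] by (auto simp: W'_def)
qed

text \<open>Compactness covers X by finitely many separated clopen sets. They are treated one after
  another, and the proportion reached at one of them persists because W only grows.\<close>

lemma greedy_pass:
  assumes free: "free_system G X \<phi>" and K: "finite K" and L: "finite L" "L \<subseteq> carrier G"
    and F: "almost_inv G (K \<union> L) \<kappa> F" and \<kappa>: "0 < \<kappa>" "\<kappa> \<le> \<epsilon>" and \<epsilon>: "\<epsilon> \<le> 1/2"
    and c: "castle K (4 * \<epsilon>) W \<gamma>"
  obtains W' \<gamma>' where "castle K (4 * \<epsilon>) W' \<gamma>'" "W \<subseteq> W'"
    "\<And>v. v \<in> X \<Longrightarrow> \<epsilon> * real (card F) \<le> real (card {f \<in> F. \<phi> f v \<in> W'})"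
    "\<And>\<mu>. invariant_prob G X \<phi> \<mu> \<Longrightarrow> measure \<mu> (saturation L W' - W') - 2 * \<kappa> * measure \<mu> W' \<le>
        measure \<mu> (saturation L W - W) - 2 * \<kappa> * measure \<mu> W"
proof -
  have F1: "finite F" "F \<subseteq> carrier G" using F by (auto simp: almost_inv_def)
  define good where "good \<V> W' \<gamma>' \<longleftrightarrow> castle K (4 * \<epsilon>) W' \<gamma>' \<and> W \<subseteq> W' \<and>
    (\<forall>v\<in>\<Union>\<V>. \<epsilon> * real (card F) \<le> real (card {f \<in> F. \<phi> f v \<in> W'})) \<and>
    (\<forall>\<mu>. invariant_prob G X \<phi> \<mu> \<longrightarrow> measure \<mu> (saturation L W' - W') - 2 * \<kappa> * measure \<mu> W' \<le>
        measure \<mu> (saturation L W - W) - 2 * \<kappa> * measure \<mu> W)" for \<V> W' \<gamma>'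
  have *: "\<exists>W' \<gamma>'. good \<V> W' \<gamma>'"
    if "finite \<V>" "\<And>V. V \<in> \<V> \<Longrightarrow> clopen_in X V \<and> separated F V" for \<V>
    using that
  proof (induction \<V> rule: finite_induct)
    case empty
    have "good {} W \<gamma>" using c by (simp add: good_def)
    then show ?case by blast
  next
    case (insert V \<V>)
    then obtain W1 \<gamma>1 where W1: "good \<V> W1 \<gamma>1" by blast
    have V: "clopen_in X V" "separated F V" using insert.prems by auto
    have c1: "castle K (4 * \<epsilon>) W1 \<gamma>1" using W1 by (simp add: good_def)
    obtain W2 \<gamma>2 where W2: "castle K (4 * \<epsilon>) W2 \<gamma>2" "W1 \<subseteq> W2"
      "\<And>v. v \<in> V \<Longrightarrow> \<epsilon> * real (card F) \<le> real (card {f \<in> F. \<phi> f v \<in> W2})"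
      "\<And>\<mu>. invariant_prob G X \<phi> \<mu> \<Longrightarrow> measure \<mu> (saturation L W2 - W2) - 2 * \<kappa> * measure \<mu> W2 \<le>
        measure \<mu> (saturation L W1 - W1) - 2 * \<kappa> * measure \<mu> W1"
      by (rule greedy_step[OF K L F \<kappa> \<epsilon> V c1]) (rule that)
    have mono: "real (card {f \<in> F. \<phi> f v \<in> W1}) \<le> real (card {f \<in> F. \<phi> f v \<in> W2})" for v
      using F1 W2(2) by (intro of_nat_mono card_mono) auto
    have "good (insert V \<V>) W2 \<gamma>2"
      unfolding good_def
    proof (intro conjI ballI allI impI)
      show "castle K (4 * \<epsilon>) W2 \<gamma>2" by (rule W2)
      show "W \<subseteq> W2" using W1 W2(2) by (auto simp: good_def)
      fix v assume v: "v \<in> \<Union>(insert V \<V>)"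
      show "\<epsilon> * real (card F) \<le> real (card {f \<in> F. \<phi> f v \<in> W2})"
      proof (cases "v \<in> V")
        case False
        then have "\<epsilon> * real (card F) \<le> real (card {f \<in> F. \<phi> f v \<in> W1})"
          using W1 v by (auto simp: good_def)
        then show ?thesis using mono[of v] by linarith
      qed (rule W2)
    next
      fix \<mu> assume \<mu>: "invariant_prob G X \<phi> \<mu>"
      have "measure \<mu> (saturation L W1 - W1) - 2 * \<kappa> * measure \<mu> W1 \<le>
        measure \<mu> (saturation L W - W) - 2 * \<kappa> * measure \<mu> W"
        using W1 \<mu> by (simp add: good_def)
      with W2(4)[OF \<mu>] show "measure \<mu> (saturation L W2 - W2) - 2 * \<kappa> * measure \<mu> W2 \<le>
        measure \<mu> (saturation L W - W) - 2 * \<kappa> * measure \<mu> W" by (rule order_trans)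
    qed
    then show ?case by blast
  qed
  obtain \<V> where \<V>: "finite \<V>" "\<And>V. V \<in> \<V> \<Longrightarrow> clopen_in X V \<and> separated F V" "X \<subseteq> \<Union>\<V>"
    by (rule clopen_cover[OF compact_space order_refl separated_nbhd[OF free F1]]) auto
  obtain W' \<gamma>' where "good \<V> W' \<gamma>'" using *[OF \<V>(1,2)] by blast
  then have g: "castle K (4 * \<epsilon>) W' \<gamma>'" "W \<subseteq> W'"
    "\<And>v. v \<in> X \<Longrightarrow> \<epsilon> * real (card F) \<le> real (card {f \<in> F. \<phi> f v \<in> W'})"
    "\<And>\<mu>. invariant_prob G X \<phi> \<mu> \<Longrightarrow> measure \<mu> (saturation L W' - W') - 2 * \<kappa> * measure \<mu> W' \<le>
        measure \<mu> (saturation L W - W) - 2 * \<kappa> * measure \<mu> W"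
    using \<V>(3) unfolding good_def by blast+
  show thesis by (rule that[OF g])
qed

text \<open>Every scale \<open>F\<close> leaves a fraction of at most \<open>1 - \<epsilon>\<close> of the remainder uncovered, since
  by the induction hypothesis few points outside the previous set \<open>W0\<close> have an \<open>F\<close>-translate in it.\<close>

lemma Rokhlin_castle:
  assumes free: "free_system G X \<phi>" and am: "amenable G" and K: "finite K" "K \<subseteq> carrier G"
    and \<epsilon>: "0 < \<epsilon>" "\<epsilon> \<le> 1/2" and "finite L" "L \<subseteq> carrier G" "0 < \<eta>"
  shows "\<exists>W \<gamma>. castle K (4 * \<epsilon>) W \<gamma> \<and> (\<forall>\<mu>. invariant_prob G X \<phi> \<mu> \<longrightarrow>
    measure \<mu> (saturation L W - W) \<le> \<eta> \<and> measure \<mu> (X - W) \<le> (1 - \<epsilon>) ^ n + \<eta>)"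
  using assms(7-9)
proof (induction n arbitrary: L \<eta>)
  case 0
  have "castle K (4 * \<epsilon>) {} (\<lambda>_. \<one>)" by (simp add: castle_def cell_def)
  then show ?case
    using \<open>0 < \<eta>\<close> measure_space_invariant
    by (intro exI[of _ "{}"] exI[of _ "\<lambda>_. \<one>"]) (simp add: saturation_def)
next
  case (Suc n)
  \<comment> \<open>The measure of W is at most 1, so the potential lets the L-boundary grow by at
    most 2\<kappa> \<le> \<eta>/4 during the pass, on top of the \<eta>/2 from the induction
    hypothesis.\<close>
  define \<kappa> where "\<kappa> = min \<epsilon> (\<eta> / 8)"
  have \<kappa>: "0 < \<kappa>" "\<kappa> \<le> \<epsilon>" "\<kappa> \<le> \<eta> / 8" using \<epsilon> \<open>0 < \<eta>\<close> by (auto simp: \<kappa>_def)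
  obtain F where F: "almost_inv G (K \<union> L) \<kappa> F" "F \<noteq> {}"
    using amenable_almost_inv[OF am, of "K \<union> L" \<kappa>] K Suc.prems \<kappa> by auto
  have F1: "finite F" "F \<subseteq> carrier G" using F by (auto simp: almost_inv_def)
  \<comment> \<open>The induction hypothesis holds for arbitrary L, so F can be fixed before the
    castle of the previous scale is requested. Points outside W0 that F carries into W0 then belong
    to the small L'-boundary of W0.\<close>
  define L' where "L' = L \<union> m_inv G ` F"
  have L': "finite L'" "L' \<subseteq> carrier G" using Suc.prems F1 by (auto simp: L'_def)
  obtain W0 \<gamma>0 where W0: "castle K (4 * \<epsilon>) W0 \<gamma>0"
    and m0: "\<And>\<mu>. invariant_prob G X \<phi> \<mu> \<Longrightarrow> measure \<mu> (saturation L' W0 - W0) \<le> \<eta> / 2 \<and>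
      measure \<mu> (X - W0) \<le> (1 - \<epsilon>) ^ n + \<eta> / 2"
    using Suc.IH[OF L', of "\<eta> / 2"] \<open>0 < \<eta>\<close> by auto
  obtain W \<gamma> where W: "castle K (4 * \<epsilon>) W \<gamma>" "W0 \<subseteq> W"
    and cover: "\<And>v. v \<in> X \<Longrightarrow> \<epsilon> * real (card F) \<le> real (card {f \<in> F. \<phi> f v \<in> W})"
    and mL: "\<And>\<mu>. invariant_prob G X \<phi> \<mu> \<Longrightarrow> measure \<mu> (saturation L W - W) - 2 * \<kappa> * measure \<mu> W \<le>
        measure \<mu> (saturation L W0 - W0) - 2 * \<kappa> * measure \<mu> W0"
    by (rule greedy_pass[OF free K(1) Suc.prems(1,2) F(1) \<kappa>(1,2) \<epsilon>(2) W0]) (rule that)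
  have cl: "clopen_in X W0" "clopen_in X W" using W0 W by (auto simp: castle_def)
  have "measure \<mu> (saturation L W - W) \<le> \<eta> \<and> measure \<mu> (X - W) \<le> (1 - \<epsilon>) ^ Suc n + \<eta>"
    if \<mu>: "invariant_prob G X \<phi> \<mu>" for \<mu>
  proof
    have W1: "measure \<mu> W \<le> 1" "0 \<le> measure \<mu> W0"
      using measure_mono_clopen[OF \<mu> clopen_space clopen_subset cl(2)] cl measure_space_invariant[OF \<mu>] by auto
    have "measure \<mu> (saturation L W0 - W0) \<le> measure \<mu> (saturation L' W0 - W0)"
      using Suc.prems L' cl
      by (intro measure_mono_clopen[OF \<mu>] clopen_Diff clopen_saturation) (auto simp: saturation_def L'_def)
    also have "\<dots> \<le> \<eta> / 2" using m0[OF \<mu>] by blast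
    finally have "measure \<mu> (saturation L W - W) \<le> \<eta> / 2 + 2 * \<kappa> * (measure \<mu> W - measure \<mu> W0)"
      using mL[OF \<mu>] by (simp add: algebra_simps)
    also have "2 * \<kappa> * (measure \<mu> W - measure \<mu> W0) \<le> 2 * \<kappa> * 1"
    proof (rule mult_left_mono)
      show "measure \<mu> W - measure \<mu> W0 \<le> 1" using W1 by linarith
    qed (use \<kappa> in simp)
    finally show "measure \<mu> (saturation L W - W) \<le> \<eta>" using \<kappa>(3) \<open>0 < \<eta>\<close> by linarith
    define S where "S = saturation L' W0"
    have S: "clopen_in X S" unfolding S_def by (intro clopen_saturation L' cl)
    \<comment> \<open>For x in A the whole piece F x avoids W0, so the \<epsilon>|F| covered points
      guaranteed by the pass all lie in \<open>W - W0\<close>.\<close>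
    define A where "A = (X - W0) - (S - W0)"
    have A: "clopen_in X A" unfolding A_def by (intro clopen_Diff clopen_space S cl)
    have Q: "clopen_in X {x \<in> X. \<phi> f x \<in> W - W0}" if "f \<in> F" for f
      using that F1 cl by (intro clopen_Collect_act clopen_Diff) auto
    have "\<epsilon> * real (card F) * measure \<mu> A \<le> (\<Sum>f\<in>F. measure \<mu> {x \<in> X. \<phi> f x \<in> W - W0})"
    proof (rule measure_le_sum[OF \<mu> F1(1) A Q])
      fix x assume x: "x \<in> A"
      have "\<phi> f x \<notin> W0" if f: "f \<in> F" for f
      proof
        assume "\<phi> f x \<in> W0"
        moreover have "x = \<phi> (inv f) (\<phi> f x)" using f F1 x by (auto simp: A_def)
        ultimately have "x \<in> S" using f by (auto simp: S_def L'_def saturation_def)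
        then show False using x by (auto simp: A_def)
      qed
      then have "{f \<in> F. x \<in> {x \<in> X. \<phi> f x \<in> W - W0}} = {f \<in> F. \<phi> f x \<in> W}"
        using x by (auto simp: A_def)
      then show "\<epsilon> * real (card F) \<le> real (card {f \<in> F. x \<in> {x \<in> X. \<phi> f x \<in> W - W0}})"
        using cover x by (auto simp: A_def)
    qed
    also have "\<dots> = (\<Sum>f\<in>F. measure \<mu> (W - W0))"
      using F1 by (intro sum.cong refl measure_act_vimage[OF \<mu>] clopen_Diff cl) auto
    also have "\<dots> = real (card F) * (measure \<mu> W - measure \<mu> W0)"
      using measure_Diff_clopen[OF \<mu> cl W(2)] by simp
    finally have "real (card F) * (\<epsilon> * measure \<mu> A) \<le> real (card F) * (measure \<mu> W - measure \<mu> W0)"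
      by (simp add: algebra_simps)
    then have 1: "\<epsilon> * measure \<mu> A \<le> measure \<mu> W - measure \<mu> W0"
      using F F1 by (simp add: card_gt_0_iff)
    have "measure \<mu> A = measure \<mu> (X - W0) - measure \<mu> (S - W0)"
      unfolding A_def using clopen_subset[OF S]
      by (intro measure_Diff_clopen[OF \<mu>] clopen_Diff S cl clopen_space) auto
    then have 2: "measure \<mu> (X - W0) - \<eta> / 2 \<le> measure \<mu> A"
      using m0[OF \<mu>] by (simp add: S_def)
    have 3: "measure \<mu> (X - V) = 1 - measure \<mu> V" if "clopen_in X V" for V
      using measure_Diff_clopen[OF \<mu> that clopen_space clopen_subset[OF that]] measure_space_invariant[OF \<mu>] by simp
    have "measure \<mu> (X - W) \<le> measure \<mu> (X - W0) - \<epsilon> * (measure \<mu> (X - W0) - \<eta> / 2)"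
      using 1 mult_left_mono[OF 2, of \<epsilon>] \<epsilon> unfolding 3[OF cl(1)] 3[OF cl(2)] by linarith
    also have "\<dots> = (1 - \<epsilon>) * measure \<mu> (X - W0) + \<epsilon> * \<eta> / 2" by (simp add: algebra_simps)
    also have "\<dots> \<le> (1 - \<epsilon>) * ((1 - \<epsilon>) ^ n + \<eta> / 2) + \<epsilon> * \<eta> / 2"
      using m0[OF \<mu>] \<epsilon> by (intro add_right_mono mult_left_mono) auto
    also have "\<dots> = (1 - \<epsilon>) ^ Suc n + \<eta> / 2" by (simp add: field_simps)
    finally show "measure \<mu> (X - W) \<le> (1 - \<epsilon>) ^ Suc n + \<eta>" using \<open>0 < \<eta>\<close> by linarith
  qed
  then show ?case using W(1) by blast
qed

section \<open>Exact castles\<close>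

text \<open>The points outside \<open>W\<close> are moved by the comparison into a small part \<open>B\<close> of every cell,
  and each joins the cell where it lands.\<close>

lemma exact_castle:
  assumes free: "free_system G X \<phi>" and am: "amenable G" and comp: "admits_comparison G X \<phi>"
    and inf: "infinite (carrier G)" and K: "finite K" "K \<subseteq> carrier G" and \<kappa>: "0 < \<kappa>"
  obtains \<gamma> where "loc_const \<gamma>" "\<And>x. x \<in> X \<Longrightarrow> \<gamma> x \<in> carrier G"
    "\<And>v. v \<in> X \<Longrightarrow> almost_inv G K \<kappa> (cell X \<gamma> v)"
proof -
  \<comment> \<open>Half of \<kappa> pays for the boundary of the old cell T, the other half for the
    attached points: at most \<alpha>|T| of them, creating at most |K|\<alpha>|T| boundary
    points.\<close>
  define \<epsilon> where "\<epsilon> = min (1/2) (\<kappa> / 8)"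
  define \<alpha> where "\<alpha> = min 1 (\<kappa> / (2 * (real (card K) + 1)))"
  have \<epsilon>: "0 < \<epsilon>" "\<epsilon> \<le> 1/2" "4 * \<epsilon> \<le> \<kappa> / 2" using \<kappa> by (auto simp: \<epsilon>_def)
  have \<alpha>: "0 < \<alpha>" "\<alpha> \<le> 1" using \<kappa> by (auto simp: \<alpha>_def)
  have "\<alpha> \<le> \<kappa> / (2 * (real (card K) + 1))" by (simp add: \<alpha>_def)
  then have "\<alpha> * (2 * (real (card K) + 1)) \<le> \<kappa>" by (simp add: pos_le_divide_eq)
  then have K\<alpha>: "real (card K) * \<alpha> \<le> \<kappa> / 2" using \<alpha> by (simp add: algebra_simps)
  \<comment> \<open>A nonempty cell T satisfies |K'| \<le> |K'T| \<le> 3|T|, so 6/\<alpha> elements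
    in K' force |T| \<ge> 2/\<alpha>. Then \<alpha>|T| \<ge> 2, and rounding it down loses at most
    half.\<close>
  obtain N :: nat where N: "6 / \<alpha> \<le> real N" using real_arch_simple by blast
  obtain K0 where K0: "finite K0" "card K0 = N" "K0 \<subseteq> carrier G"
    using infinite_arbitrarily_large[OF inf] by blast
  define K' where "K' = K \<union> K0"
  have K': "finite K'" "K' \<subseteq> carrier G" using K K0 by (auto simp: K'_def)
  have "card K0 \<le> card K'" using K' by (intro card_mono) (auto simp: K'_def)
  then have cardK': "6 / \<alpha> \<le> real (card K')" using N K0(2) by linarith
  have "\<exists>n. (1 - \<epsilon>) ^ n < \<alpha> / 16"
    using \<epsilon> \<alpha> by (intro real_arch_pow_inv) auto
  then obtain n where n: "(1 - \<epsilon>) ^ n < \<alpha> / 16" by blast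
  obtain W \<gamma> where c: "castle K' (4 * \<epsilon>) W \<gamma>"
    and m: "\<And>\<mu>. invariant_prob G X \<phi> \<mu> \<Longrightarrow> measure \<mu> (X - W) \<le> (1 - \<epsilon>) ^ n + \<alpha> / 16"
    using Rokhlin_castle[OF free am K' \<epsilon>(1,2), of "{}" "\<alpha> / 16" n] \<alpha> by auto
  have W: "clopen_in X W" and \<gamma>: "loc_const \<gamma>" "\<And>x. x \<in> X \<Longrightarrow> \<gamma> x \<in> carrier G"
    and cells: "\<And>v. v \<in> X \<Longrightarrow> almost_inv G K' (4 * \<epsilon>) (cell W \<gamma> v)"
    using c by (auto simp: castle_def)
  have WX: "W \<subseteq> X" using W by (rule clopen_subset)
  have big: "2 / \<alpha> \<le> real (card (cell W \<gamma> v))" if v: "v \<in> X" "cell W \<gamma> v \<noteq> {}" for v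
  proof -
    let ?T = "cell W \<gamma> v"
    have T: "finite ?T" "?T \<subseteq> carrier G" using cells[OF v(1)] by (auto simp: almost_inv_def)
    have "card K' \<le> card (K' <#> ?T)" by (rule card_le_card_set_mult[OF K'(1) T(1) K'(2) T(2) v(2)])
    also have "\<dots> \<le> card (((K' <#> ?T) - ?T) \<union> ?T)"
      using T K' finite_set_mult by (intro card_mono) auto
    also have "\<dots> \<le> card ((K' <#> ?T) - ?T) + card ?T" by (rule card_Un_le)
    finally have "real (card K') \<le> real (card ((K' <#> ?T) - ?T)) + real (card ?T)" by linarith
    also have "real (card ((K' <#> ?T) - ?T)) \<le> 4 * \<epsilon> * real (card ?T)"
      using cells[OF v(1)] by (simp add: almost_inv_def)
    also have "4 * \<epsilon> * real (card ?T) \<le> 2 * real (card ?T)"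
      using \<epsilon>(2) by (intro mult_right_mono) auto
    finally have "6 / \<alpha> \<le> 3 * real (card ?T)" using cardK' by linarith
    then show ?thesis by simp
  qed
  \<comment> \<open>The subset is selected from T alone, so that B below is clopen.\<close>
  define part where "part T = (SOME S. S \<subseteq> T \<and> card S = nat \<lfloor>\<alpha> * real (card T)\<rfloor>)" for T :: "'g set"
  have part: "part T \<subseteq> T \<and> card (part T) = nat \<lfloor>\<alpha> * real (card T)\<rfloor>" for T
  proof -
    have "\<alpha> * real (card T) \<le> real (card T)" using \<alpha> mult_right_mono[of \<alpha> 1 "real (card T)"] by simp
    then have "nat \<lfloor>\<alpha> * real (card T)\<rfloor> \<le> card T" by linarith
    then have "\<exists>S. S \<subseteq> T \<and> card S = nat \<lfloor>\<alpha> * real (card T)\<rfloor>"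
      by (rule obtain_subset_with_card_n) blast
    then show ?thesis unfolding part_def by (rule someI_ex)
  qed
  define base where "base x = \<phi> (\<gamma> x) x" for x
  have base: "base x \<in> X" if "x \<in> X" for x using that \<gamma> by (simp add: base_def)
  define B where "B = {x \<in> X. x \<in> W \<and> inv (\<gamma> x) \<in> part (cell W \<gamma> (base x))}"
  have "loc_const (\<lambda>x. cell W \<gamma> (base x))"
    unfolding base_def by (intro loc_const_act_bind \<gamma> loc_const_cell W)
  with \<gamma>(1) have "loc_const (\<lambda>x. inv (\<gamma> x) \<in> part (cell W \<gamma> (base x)))"
    by (rule loc_const_comp2)
  with loc_const_mem[OF W] have "loc_const (\<lambda>x. x \<in> W \<and> inv (\<gamma> x) \<in> part (cell W \<gamma> (base x)))"
    by (rule loc_const_comp2)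
  then have B: "clopen_in X B" unfolding B_def by (rule clopen_Collect)
  have cellB: "cell B \<gamma> v = part (cell W \<gamma> v)" if v: "v \<in> X" for v
  proof
    show "cell B \<gamma> v \<subseteq> part (cell W \<gamma> v)"
    proof
      fix s assume s: "s \<in> cell B \<gamma> v"
      then have sW: "s \<in> cell W \<gamma> v" and sG: "s \<in> carrier G" and e: "\<gamma> (\<phi> s v) = inv s"
        by (auto simp: cell_def B_def)
      have "base (\<phi> s v) = v" unfolding base_def using cell_base[OF sW v] .
      moreover have "inv (\<gamma> (\<phi> s v)) \<in> part (cell W \<gamma> (base (\<phi> s v)))"
        using s by (auto simp: cell_def B_def)
      ultimately show "s \<in> part (cell W \<gamma> v)" using e sG by simp
    qed
    show "part (cell W \<gamma> v) \<subseteq> cell B \<gamma> v"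
    proof
      fix s assume s: "s \<in> part (cell W \<gamma> v)"
      then have sW: "s \<in> cell W \<gamma> v" using part by blast
      then have *: "s \<in> carrier G" "\<phi> s v \<in> W" "\<gamma> (\<phi> s v) = inv s" by (auto simp: cell_def)
      have "base (\<phi> s v) = v" unfolding base_def using cell_base[OF sW v] .
      then show "s \<in> cell B \<gamma> v" using * s v by (simp add: cell_def B_def)
    qed
  qed
  define R where "R = X - W"
  have R: "clopen_in X R" unfolding R_def by (intro clopen_Diff clopen_space W)
  \<comment> \<open>The remainder has measure below \<alpha>/8, hence W has measure at least 7/8 and
    B at least 7\<alpha>/16.\<close>
  have "measure \<mu> R < measure \<mu> B" if \<mu>: "invariant_prob G X \<phi> \<mu>" for \<mu>
  proof -
    have "\<alpha> / 2 * measure \<mu> W \<le> 1 * measure \<mu> B"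
    proof (rule measure_le_of_cells[OF \<gamma> \<mu> W B])
      fix v assume v: "v \<in> X"
      show "\<alpha> / 2 * real (card (cell W \<gamma> v)) \<le> 1 * real (card (cell B \<gamma> v))"
      proof (cases "cell W \<gamma> v = {}")
        case False
        have "2 \<le> \<alpha> * real (card (cell W \<gamma> v))"
          using big[OF v False] \<alpha> by (simp add: pos_divide_le_eq mult.commute)
        then have "\<alpha> / 2 * real (card (cell W \<gamma> v)) \<le> real (nat \<lfloor>\<alpha> * real (card (cell W \<gamma> v))\<rfloor>)"
          by linarith
        then show ?thesis using part cellB[OF v] by simp
      qed simp
    qed
    moreover have "measure \<mu> R = 1 - measure \<mu> W"
      unfolding R_def using measure_Diff_clopen[OF \<mu> W clopen_space WX] measure_space_invariant[OF \<mu>] by simp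
    moreover have "measure \<mu> R < \<alpha> / 8" using m[OF \<mu>] n by (simp add: R_def)
    moreover have "\<alpha> / 2 * (7 / 8) \<le> \<alpha> / 2 * measure \<mu> W"
      using calculation(2,3) \<alpha> by (intro mult_left_mono) auto
    ultimately show ?thesis using \<alpha> by linarith
  qed
  then have "subequivalent G X \<phi> R B"
    using comp R B unfolding admits_comparison_def by blast
  then obtain \<theta> where \<theta>: "loc_const \<theta>" "\<And>x. \<theta> x \<in> carrier G"
    "inj_on (\<lambda>x. \<phi> (\<theta> x) x) R" "\<And>x. x \<in> R \<Longrightarrow> \<phi> (\<theta> x) x \<in> B"
    by (rule subequivalentE) (rule that)
  define \<gamma>' where "\<gamma>' x = (if x \<in> W then \<gamma> x else \<gamma> (\<phi> (\<theta> x) x) \<otimes> \<theta> x)" for x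
  have "loc_const (\<lambda>x. \<gamma> (\<phi> (\<theta> x) x))"
    by (intro loc_const_act_bind \<gamma> \<theta>)
  then have "loc_const (\<lambda>x. \<gamma> (\<phi> (\<theta> x) x) \<otimes> \<theta> x)"
    using \<theta>(1) by (rule loc_const_comp2)
  with \<gamma>(1) have "loc_const (\<lambda>x. (\<gamma> x, \<gamma> (\<phi> (\<theta> x) x) \<otimes> \<theta> x))"
    by (rule loc_const_comp2)
  with loc_const_mem[OF W] have "loc_const (\<lambda>x. if x \<in> W then fst (\<gamma> x, \<gamma> (\<phi> (\<theta> x) x) \<otimes> \<theta> x)
      else snd (\<gamma> x, \<gamma> (\<phi> (\<theta> x) x) \<otimes> \<theta> x))"
    by (rule loc_const_comp2[where h = "\<lambda>w p. if w then fst p else snd p"])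
  then have lc\<gamma>': "loc_const \<gamma>'" by (simp add: \<gamma>'_def[abs_def] cong: if_cong)
  have G\<gamma>': "\<gamma>' x \<in> carrier G" if "x \<in> X" for x
    using \<gamma>(2) \<theta>(2) that by (simp add: \<gamma>'_def)
  have inv\<gamma>': "almost_inv G K \<kappa> (cell X \<gamma>' v)" if v: "v \<in> X" for v
  proof -
    define T where "T = cell W \<gamma> v"
    define E where "E = {s \<in> carrier G. \<phi> s v \<in> R \<and> \<gamma> (\<phi> (\<theta> (\<phi> s v)) (\<phi> s v)) \<otimes> \<theta> (\<phi> s v) = inv s}"
    have cell': "cell X \<gamma>' v = T \<union> E"
      using WX v by (auto simp: cell_def \<gamma>'_def T_def E_def R_def)
    have T: "almost_inv G K (4 * \<epsilon>) T" "finite T" "T \<subseteq> carrier G"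
      using cells[OF v] almost_inv_mono[OF cells[OF v] _ order_refl K'(1), of K]
      by (auto simp: almost_inv_def T_def K'_def)
    \<comment> \<open>The displacement, from the same base point v, of the landing place of
      \<open>\<phi> s v\<close>. It injects the attached part of the cell into the part reserved in
      B.\<close>
    define j where "j s = \<theta> (\<phi> s v) \<otimes> s" for s
    have j\<phi>: "\<phi> (j s) v = \<phi> (\<theta> (\<phi> s v)) (\<phi> s v)" if "s \<in> carrier G" for s
      using that \<theta>(2) v by (simp add: j_def act_mult)
    have "j ` E \<subseteq> cell B \<gamma> v"
    proof (rule image_subsetI)
      fix s assume s: "s \<in> E"
      then have sG: "s \<in> carrier G" and sR: "\<phi> s v \<in> R"
        and e: "\<gamma> (\<phi> (j s) v) \<otimes> \<theta> (\<phi> s v) = inv s"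
        using j\<phi>[of s] by (auto simp: E_def)
      have g: "\<gamma> (\<phi> (j s) v) \<in> carrier G" using \<gamma>(2) v \<theta>(2) sG by (simp add: j_def)
      have "\<gamma> (\<phi> (j s) v) \<otimes> j s = \<gamma> (\<phi> (j s) v) \<otimes> \<theta> (\<phi> s v) \<otimes> s"
        using g \<theta>(2) sG by (simp add: j_def m_assoc)
      then have "\<gamma> (\<phi> (j s) v) \<otimes> j s = \<one>" using e sG by simp
      then have "\<gamma> (\<phi> (j s) v) = inv (j s)"
        using g \<theta>(2) sG by (metis inv_equality inv_inv j_def m_closed)
      then show "j s \<in> cell B \<gamma> v"
        using \<theta>(4)[OF sR] j\<phi>[OF sG] \<theta>(2) sG by (simp add: cell_def j_def)
    qed
    moreover have inj: "inj_on j E"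
    proof (rule inj_onI)
      fix s s' assume s: "s \<in> E" "s' \<in> E" "j s = j s'"
      then have "\<phi> (\<theta> (\<phi> s v)) (\<phi> s v) = \<phi> (\<theta> (\<phi> s' v)) (\<phi> s' v)"
        using j\<phi>[of s] j\<phi>[of s'] by (simp add: E_def)
      then have "\<phi> s v = \<phi> s' v"
        using \<theta>(3) s by (auto simp: inj_on_def E_def)
      then show "s = s'" using s \<theta>(2) by (simp add: j_def E_def)
    qed
    moreover have fB: "finite (cell B \<gamma> v)" using finite_cell[OF \<gamma> v] .
    ultimately have E: "finite E" "card E \<le> card (cell B \<gamma> v)"
      by (auto intro: inj_on_finite card_inj_on_le)
    have "real (card E) \<le> real (nat \<lfloor>\<alpha> * real (card T)\<rfloor>)"
      using E(2) part cellB[OF v] by (simp add: T_def)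
    also have "\<dots> \<le> \<alpha> * real (card T)"
      using \<alpha> by simp
    finally have cE: "real (card E) \<le> \<alpha> * real (card T)" .
    have "card (T \<union> E - T) \<le> card E" using E by (intro card_mono) auto
    then have "card K * card (T \<union> E - T) \<le> card K * card E" by (rule mult_le_mono2)
    moreover have "card ((K <#> (T \<union> E)) - (T \<union> E)) \<le>
        card ((K <#> T) - T) + card K * card (T \<union> E - T) + card (T - (T \<union> E))"
      using K T E by (intro card_boundary_perturb) auto
    moreover have "card (T - (T \<union> E)) = 0"
      by (simp add: Diff_eq_empty_iff[THEN iffD2])
    ultimately have "card ((K <#> (T \<union> E)) - (T \<union> E)) \<le> card ((K <#> T) - T) + card K * card E"
      by linarith
    then have "real (card ((K <#> (T \<union> E)) - (T \<union> E))) \<le> real (card ((K <#> T) - T)) + real (card K) * real (card E)"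
      by (metis of_nat_add of_nat_le_iff of_nat_mult)
    also have "\<dots> \<le> \<kappa> / 2 * real (card T) + \<kappa> / 2 * real (card T)"
    proof (rule add_mono)
      have "real (card ((K <#> T) - T)) \<le> 4 * \<epsilon> * real (card T)" using T(1) by (simp add: almost_inv_def)
      also have "\<dots> \<le> \<kappa> / 2 * real (card T)" using \<epsilon>(3) by (intro mult_right_mono) auto
      finally show "real (card ((K <#> T) - T)) \<le> \<kappa> / 2 * real (card T)" .
      have "real (card K) * real (card E) \<le> real (card K) * (\<alpha> * real (card T))"
        using cE by (intro mult_left_mono) auto
      also have "\<dots> = real (card K) * \<alpha> * real (card T)" by simp
      also have "\<dots> \<le> \<kappa> / 2 * real (card T)" using K\<alpha> by (intro mult_right_mono) auto
      finally show "real (card K) * real (card E) \<le> \<kappa> / 2 * real (card T)" .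
    qed
    also have "\<dots> = \<kappa> * real (card T)" by simp
    also have "\<dots> \<le> \<kappa> * real (card (T \<union> E))"
      using \<kappa> T E by (intro mult_left_mono of_nat_mono card_mono) auto
    finally show ?thesis
      unfolding cell' almost_inv_def using T E by (auto simp: E_def)
  qed
  show thesis by (rule that[OF lc\<gamma>' G\<gamma>' inv\<gamma>'])
qed

section \<open>Congruent sequences of tilings\<close>

text \<open>A tiling in which \<open>\<gamma> x\<close> carries \<open>x\<close> to the center of its tile.\<close>

definition tiling_cocycle :: "('x \<Rightarrow> 'g) \<Rightarrow> bool" where
  "tiling_cocycle \<gamma> \<longleftrightarrow> loc_const \<gamma> \<and> (\<forall>x\<in>X. \<gamma> x \<in> carrier G \<and> \<gamma> (\<phi> (\<gamma> x) x) = \<one>)"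

text \<open>A tile of \<open>\<gamma>\<close> goes to the cell of \<open>\<delta>\<close> that contains its center, and the new center is chosen
  among the centers in that cell, so that it belongs to the new tile.\<close>

lemma coarsening:
  assumes \<gamma>: "tiling_cocycle \<gamma>" and K: "finite K" "K \<subseteq> carrier G" and \<kappa>: "0 < \<kappa>"
    and exact: "\<And>K' \<kappa>'. finite K' \<Longrightarrow> K' \<subseteq> carrier G \<Longrightarrow> 0 < \<kappa>' \<Longrightarrow>
      \<exists>\<delta>. loc_const \<delta> \<and> (\<forall>x\<in>X. \<delta> x \<in> carrier G) \<and> (\<forall>v\<in>X. almost_inv G K' \<kappa>' (cell X \<delta> v))"
  obtains \<gamma>' where "tiling_cocycle \<gamma>'" "\<And>x. x \<in> X \<Longrightarrow> \<gamma>' x = \<gamma>' (\<phi> (\<gamma> x) x) \<otimes> \<gamma> x"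
    "\<And>v. v \<in> X \<Longrightarrow> almost_inv G K \<kappa> (cell X \<gamma>' v)"
proof -
  have lc: "loc_const \<gamma>" and \<gamma>G: "\<And>x. x \<in> X \<Longrightarrow> \<gamma> x \<in> carrier G"
    and \<gamma>1: "\<And>x. x \<in> X \<Longrightarrow> \<gamma> (\<phi> (\<gamma> x) x) = \<one>"
    using \<gamma> by (auto simp: tiling_cocycle_def)
  define M where "M = \<gamma> ` X"
  have M: "finite M" "M \<subseteq> carrier G" using loc_const_finite[OF lc] \<gamma>G by (auto simp: M_def)
  define N where "N = m_inv G ` M"
  have N: "finite N" "N \<subseteq> carrier G" "card N \<le> card M"
    using M card_image_le by (auto simp: N_def)
  define K' where "K' = K \<union> M \<union> N"
  have K': "finite K'" "K' \<subseteq> carrier G" using K M N by (auto simp: K'_def)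
  \<comment> \<open>The three summands pay for the boundary of the \<delta>-cell T, for K times the
    points added to it and for the points removed from it. The 2 in \<open>\<kappa>'\<close> comes
    from |T| \<le> 2|U| for the regrouped set U.\<close>
  define r where "r = 1 + real (card K) + real (card M)"
  define \<kappa>' where "\<kappa>' = min \<kappa> 1 / (2 * r)"
  have r: "1 \<le> r" by (simp add: r_def)
  have \<kappa>': "0 < \<kappa>'" "2 * r * \<kappa>' \<le> \<kappa>" "2 * r * \<kappa>' \<le> 1" using \<kappa> r by (auto simp: \<kappa>'_def)
  obtain \<delta> where \<delta>: "loc_const \<delta>" "\<And>x. x \<in> X \<Longrightarrow> \<delta> x \<in> carrier G"
    and inv\<delta>: "\<And>v. v \<in> X \<Longrightarrow> almost_inv G K' \<kappa>' (cell X \<delta> v)"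
    using exact[OF K' \<kappa>'(1)] by blast
  define ctr where "ctr x = \<phi> (\<gamma> x) x" for x
  define b where "b x = \<delta> (ctr x) \<otimes> \<gamma> x" for x
  define base where "base x = \<phi> (b x) x" for x
  \<comment> \<open>The \<gamma>-centers in the \<delta>-cell based at y, relative to y. The choice
    \<open>T0\<close> depends on this set alone, so all points regrouped into one tile agree on its
    center.\<close>
  define dom where "dom y = {t \<in> cell X \<delta> y. \<gamma> (\<phi> t y) = \<one>}" for y
  define T0 :: "'g set \<Rightarrow> 'g" where "T0 D = (SOME t. t \<in> D)" for D
  define \<gamma>' where "\<gamma>' x = T0 (dom (base x)) \<otimes> b x" for x
  have ctr: "ctr x \<in> X" if "x \<in> X" for x using that \<gamma>G by (simp add: ctr_def)
  have bG: "b x \<in> carrier G" if "x \<in> X" for x using that \<gamma>G \<delta> ctr by (simp add: b_def)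
  have base: "base x \<in> X" if "x \<in> X" for x using that bG by (simp add: base_def)
  have base_eq: "base x = \<phi> (\<delta> (ctr x)) (ctr x)" if "x \<in> X" for x
    using that \<gamma>G \<delta>(2)[OF ctr[OF that]] by (simp add: base_def b_def ctr_def act_mult)
  have T0: "T0 (dom (base x)) \<in> dom (base x)" if x: "x \<in> X" for x
  proof -
    have "inv (\<delta> (ctr x)) \<in> cell X \<delta> (base x)"
      unfolding base_eq[OF x] using ctr[OF x] \<delta> by (intro mem_cell_base) auto
    moreover have "\<gamma> (\<phi> (inv (\<delta> (ctr x))) (base x)) = \<one>"
      unfolding base_eq[OF x] using \<gamma>1[OF x] \<delta> ctr[OF x] by (simp add: ctr_def)
    ultimately have "inv (\<delta> (ctr x)) \<in> dom (base x)" by (simp add: dom_def)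
    then show ?thesis unfolding T0_def by (rule someI)
  qed
  have T0G: "T0 (dom (base x)) \<in> carrier G" if "x \<in> X" for x
    using T0[OF that] by (auto simp: dom_def cell_def)
  have \<gamma>'G: "\<gamma>' x \<in> carrier G" if "x \<in> X" for x using T0G bG that by (simp add: \<gamma>'_def)
  have ctr': "\<phi> (\<gamma>' x) x = \<phi> (T0 (dom (base x))) (base x)" if "x \<in> X" for x
    using that T0G bG by (simp add: \<gamma>'_def base_def act_mult)
  \<comment> \<open>A chosen center is its own \<gamma>-center and has the same \<delta>-base as the
    points sent to it, so it chooses itself.\<close>
  have at_ctr': "\<gamma> z = \<one> \<and> \<delta> z = inv (T0 (dom (base x))) \<and> base z = base x \<and> \<gamma>' z = \<one>"
    if x: "x \<in> X" and z: "z = \<phi> (\<gamma>' x) x" for x z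
  proof -
    define t where "t = T0 (dom (base x))"
    have t: "t \<in> dom (base x)" "t \<in> carrier G" using T0[OF x] T0G[OF x] by (auto simp: t_def)
    have zt: "z = \<phi> t (base x)" using ctr'[OF x] z by (simp add: t_def)
    have zX: "z \<in> X" using zt t base[OF x] by simp
    have \<gamma>z: "\<gamma> z = \<one>" and \<delta>z: "\<delta> z = inv t" using t zt by (auto simp: dom_def cell_def)
    have "ctr z = z" using \<gamma>z zX by (simp add: ctr_def)
    then have bz: "b z = inv t" using \<gamma>z \<delta>z t by (simp add: b_def)
    then have "base z = base x" using zt t base[OF x] by (simp add: base_def)
    then show ?thesis using \<gamma>z \<delta>z bz t by (simp add: \<gamma>'_def t_def[symmetric])
  qed
  have "loc_const (\<lambda>x. \<delta> (ctr x))"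
    unfolding ctr_def by (intro loc_const_act_bind lc \<delta> \<gamma>G)
  then have lcb: "loc_const b" unfolding b_def using lc by (rule loc_const_comp2)
  define D where "D = displacements \<delta>"
  have D: "finite D" "D \<subseteq> carrier G"
    using finite_displacements[OF \<delta>] displacements_subset[OF \<delta>] by (auto simp: D_def)
  have "loc_const (\<lambda>y. {t \<in> D. t \<in> cell X \<delta> y \<and> \<gamma> (\<phi> t y) = \<one>})"
  proof (rule loc_const_Collect[OF D(1)])
    fix t assume "t \<in> D"
    then have "loc_const (\<lambda>y. \<gamma> (\<phi> t y))" using D lc by (intro loc_const_act) auto
    with loc_const_cell[OF \<delta> clopen_space] show "loc_const (\<lambda>y. t \<in> cell X \<delta> y \<and> \<gamma> (\<phi> t y) = \<one>)"
      by (rule loc_const_comp2)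
  qed
  moreover have "{t \<in> D. t \<in> cell X \<delta> y \<and> \<gamma> (\<phi> t y) = \<one>} = dom y" if "y \<in> X" for y
    using cell_subset[OF \<delta> that, of X] by (auto simp: dom_def D_def)
  ultimately have "loc_const dom" using loc_const_cong by (metis (no_types, lifting))
  then have "loc_const (\<lambda>x. dom (base x))"
    unfolding base_def by (intro loc_const_act_bind lcb bG)
  then have lc\<gamma>': "loc_const \<gamma>'" unfolding \<gamma>'_def using lcb by (rule loc_const_comp2)
  have tc: "tiling_cocycle \<gamma>'"
    unfolding tiling_cocycle_def using lc\<gamma>' \<gamma>'G at_ctr' by blast
  have cong: "\<gamma>' x = \<gamma>' (\<phi> (\<gamma> x) x) \<otimes> \<gamma> x" if x: "x \<in> X" for x
  proof -
    have cc: "ctr (ctr x) = ctr x" using \<gamma>1[OF x] ctr[OF x] by (simp add: ctr_def)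
    have bc: "b (ctr x) = \<delta> (ctr x)" using cc \<gamma>1[OF x] \<delta>(2)[OF ctr[OF x]] by (simp add: b_def ctr_def)
    have "base (ctr x) = base x" using bc base_eq[OF x] by (simp add: base_def[of "ctr x"])
    then show ?thesis
      using bc T0G[OF x] \<delta>(2)[OF ctr[OF x]] \<gamma>G[OF x]
      by (simp add: \<gamma>'_def ctr_def[symmetric] b_def[of x] m_assoc)
  qed
  have inv\<gamma>': "almost_inv G K \<kappa> (cell X \<gamma>' v)" if v: "v \<in> X" for v
  proof (cases "cell X \<gamma>' v = {}")
    case False
    have \<gamma>'v: "\<gamma>' v = \<one>"
    proof -
      obtain s where s: "s \<in> cell X \<gamma>' v" using False by blast
      then have "v = \<phi> (\<gamma>' (\<phi> s v)) (\<phi> s v)" "\<phi> s v \<in> X" using v by (auto simp: cell_def)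
      then show ?thesis using at_ctr' by blast
    qed
    define y where "y = base v"
    define t where "t = T0 (dom y)"
    define T where "T = cell X \<delta> y"
    have y: "y \<in> X" using base[OF v] by (simp add: y_def)
    have tG: "t \<in> carrier G" using T0G[OF v] by (simp add: t_def y_def)
    have vt: "v = \<phi> t y" using ctr'[OF v] \<gamma>'v v by (simp add: t_def y_def)
    have \<delta>v: "\<delta> v = inv t" using at_ctr'[OF v, of v] \<gamma>'v v by (simp add: t_def y_def)
    \<comment> \<open>The new tile seen from y: the elements whose \<gamma>-center lies in T. The
      new shape S is based at v = t y instead, whence U = S t.\<close>
    define U where "U = {u \<in> carrier G. \<gamma> (\<phi> u y) \<otimes> u \<in> T}"
    have key: "s \<otimes> t \<in> U \<longleftrightarrow> s \<in> cell X \<gamma>' v" if sG: "s \<in> carrier G" for s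
    proof -
      define u where "u = s \<otimes> t"
      define x where "x = \<phi> s v"
      have uG: "u \<in> carrier G" using sG tG by (simp add: u_def)
      have xX: "x \<in> X" using sG v by (simp add: x_def)
      have xu: "x = \<phi> u y" using vt sG tG y by (simp add: x_def u_def act_mult)
      have gG: "\<gamma> x \<in> carrier G" "\<delta> (ctr x) \<in> carrier G" using \<gamma>G \<delta> ctr xX by auto
      have cu: "\<phi> (\<gamma> x \<otimes> u) y = ctr x" using gG uG y xu by (simp add: ctr_def act_mult)
      have inv_u: "inv u = inv t \<otimes> inv s" using sG tG by (simp add: u_def inv_mult_group)
      have invs: "t \<otimes> inv u = inv s" using sG tG by (simp add: inv_u m_assoc[symmetric])
      have inT: "\<gamma> x \<otimes> u \<in> T \<longleftrightarrow> \<delta> (ctr x) = inv (\<gamma> x \<otimes> u)"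
        using gG uG y by (auto simp: T_def cell_def cu ctr[OF xX])
      show ?thesis
      proof
        assume "s \<otimes> t \<in> U"
        then have d: "\<delta> (ctr x) = inv (\<gamma> x \<otimes> u)"
          using inT xu by (simp add: U_def u_def)
        then have bx: "b x = inv u" using gG uG by (simp add: b_def inv_mult_group m_assoc)
        then have "base x = y" using xu uG y by (simp add: base_def)
        then have "\<gamma>' x = inv s" using bx invs by (simp add: \<gamma>'_def t_def[symmetric])
        then show "s \<in> cell X \<gamma>' v" using sG xX by (simp add: cell_def x_def)
      next
        assume "s \<in> cell X \<gamma>' v"
        then have e: "\<gamma>' x = inv s" by (simp add: cell_def x_def)
        then have "v = \<phi> (\<gamma>' x) x" using sG v by (simp add: x_def)
        from at_ctr'[OF xX this] have *: "\<delta> v = inv (T0 (dom (base x)))" "base v = base x" by auto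
        then have "T0 (dom (base x)) = t" by (simp add: t_def y_def)
        then have tb: "t \<otimes> b x = inv s" using e by (simp add: \<gamma>'_def)
        have "b x = inv u"
          using tb invs bG[OF xX] tG uG by (metis Units_eq Units_l_cancel inv_closed)
        then have "\<delta> (ctr x) = inv u \<otimes> inv (\<gamma> x)"
          using gG uG by (metis b_def inv_closed inv_solve_right)
        then have "\<delta> (ctr x) = inv (\<gamma> x \<otimes> u)" using gG uG by (simp add: inv_mult_group)
        then show "s \<otimes> t \<in> U" using inT xu uG by (simp add: U_def u_def[symmetric])
      qed
    qed
    define S where "S = cell X \<gamma>' v"
    have S: "finite S" "S \<subseteq> carrier G"
      using finite_cell[OF lc\<gamma>' \<gamma>'G v] by (auto simp: S_def cell_def)
    have US: "U = (\<lambda>s. s \<otimes> t) ` S"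
    proof
      show "U \<subseteq> (\<lambda>s. s \<otimes> t) ` S"
      proof
        fix u assume u: "u \<in> U"
        then have uG: "u \<in> carrier G" by (simp add: U_def)
        have "u \<otimes> inv t \<otimes> t = u" using uG tG by (simp add: m_assoc)
        then show "u \<in> (\<lambda>s. s \<otimes> t) ` S"
          using key[of "u \<otimes> inv t"] u uG tG by (auto simp: S_def intro!: image_eqI[of _ _ "u \<otimes> inv t"])
      qed
      show "(\<lambda>s. s \<otimes> t) ` S \<subseteq> U" using key S by (auto simp: S_def)
    qed
    have U: "finite U" "U \<subseteq> carrier G" using US S tG by auto
    have invT: "almost_inv G K' \<kappa>' T" using inv\<delta>[OF y] by (simp add: T_def)
    have T: "finite T" "T \<subseteq> carrier G" using invT by (auto simp: almost_inv_def)
    have sub: "real (card ((H <#> T) - T)) \<le> \<kappa>' * real (card T)" if "H \<subseteq> K'" for H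
      using almost_inv_mono[OF invT that order_refl K'(1)] by (simp add: almost_inv_def)
    have "card (U - T) \<le> card ((N <#> T) - T)"
    proof (intro card_mono)
      show "U - T \<subseteq> (N <#> T) - T"
      proof
        fix u assume u: "u \<in> U - T"
        define g where "g = \<gamma> (\<phi> u y)"
        have "u \<in> carrier G" using u U by blast
        then have g: "g \<in> carrier G" "inv g \<in> N" using y \<gamma>G by (auto simp: g_def N_def M_def)
        have "u = inv g \<otimes> (g \<otimes> u)" using g \<open>u \<in> carrier G\<close> by (simp add: m_assoc[symmetric])
        moreover have "g \<otimes> u \<in> T" using u by (auto simp: U_def g_def)
        ultimately show "u \<in> (N <#> T) - T" using g u by (auto simp: set_mult_def)
      qed
    qed (use finite_set_mult N T in auto)
    then have UT: "real (card (U - T)) \<le> \<kappa>' * real (card T)"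
      using sub[of N] by (simp add: K'_def le_trans)
    \<comment> \<open>An element of T is dropped when its \<gamma>-center escapes from T; M leads to
      that center, a boundary point of T, and N leads back.\<close>
    have "card (T - U) \<le> card (N <#> ((M <#> T) - T))"
    proof (intro card_mono)
      show "T - U \<subseteq> N <#> ((M <#> T) - T)"
      proof
        fix u assume u: "u \<in> T - U"
        define g where "g = \<gamma> (\<phi> u y)"
        have uG: "u \<in> carrier G" using u T by blast
        then have g: "g \<in> carrier G" "g \<in> M" "inv g \<in> N" using y \<gamma>G by (auto simp: g_def N_def M_def)
        have "g \<otimes> u \<notin> T" using u uG by (auto simp: U_def g_def)
        moreover have "g \<otimes> u \<in> M <#> T" using g u by (auto simp: set_mult_def)
        moreover have "u = inv g \<otimes> (g \<otimes> u)" using g uG by (simp add: m_assoc[symmetric])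
        ultimately show "u \<in> N <#> ((M <#> T) - T)" using g by (auto simp: set_mult_def)
      qed
    qed (use finite_set_mult N M T in auto)
    also have "\<dots> \<le> card N * card ((M <#> T) - T)"
      using finite_set_mult N M T by (intro card_set_mult_le) auto
    also have "\<dots> \<le> card M * card ((M <#> T) - T)" using N by simp
    finally have "real (card (T - U)) \<le> real (card M) * real (card ((M <#> T) - T))"
      by (metis of_nat_le_iff of_nat_mult)
    also have "\<dots> \<le> real (card M) * (\<kappa>' * real (card T))"
      using sub[of M] by (intro mult_left_mono) (auto simp: K'_def)
    finally have TU: "real (card (T - U)) \<le> real (card M) * \<kappa>' * real (card T)" by simp
    have "real (card M) * \<kappa>' \<le> r * \<kappa>'" using \<kappa>'(1) by (intro mult_right_mono) (auto simp: r_def)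
    then have "real (card M) * \<kappa>' \<le> 1 / 2" using \<kappa>'(3) by linarith
    then have "real (card M) * \<kappa>' * real (card T) \<le> 1 / 2 * real (card T)"
      by (rule mult_right_mono) simp
    then have TU2: "real (card (T - U)) \<le> real (card T) / 2" using TU by linarith
    have "card T \<le> card (U \<union> (T - U))" using U T by (intro card_mono) auto
    also have "\<dots> \<le> card U + card (T - U)" by (rule card_Un_le)
    finally have "real (card T) \<le> real (card U) + real (card (T - U))" by linarith
    then have TleU: "real (card T) \<le> 2 * real (card U)" using TU2 by linarith
    have "card ((K <#> U) - U) \<le> card ((K <#> T) - T) + card K * card (U - T) + card (T - U)"
      using K U T by (intro card_boundary_perturb) auto
    then have "real (card ((K <#> U) - U)) \<le>
        real (card ((K <#> T) - T)) + real (card K) * real (card (U - T)) + real (card (T - U))"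
      by (metis (no_types, lifting) of_nat_add of_nat_le_iff of_nat_mult)
    also have "\<dots> \<le> \<kappa>' * real (card T) + real (card K) * (\<kappa>' * real (card T)) + real (card M) * \<kappa>' * real (card T)"
      using sub[of K] UT TU by (intro add_mono mult_left_mono) (auto simp: K'_def)
    also have "\<dots> = r * \<kappa>' * real (card T)" by (simp add: r_def algebra_simps)
    also have "\<dots> \<le> r * \<kappa>' * (2 * real (card U))"
      using TleU r \<kappa>'(1) by (intro mult_left_mono) auto
    also have "\<dots> = 2 * r * \<kappa>' * real (card U)" by simp
    also have "\<dots> \<le> \<kappa> * real (card U)" using \<kappa>'(2) by (intro mult_right_mono) auto
    finally have "almost_inv G K \<kappa> U" using U by (simp add: almost_inv_def)
    then have "almost_inv G K \<kappa> S" unfolding US by (rule almost_inv_translate[OF _ tG S(2) K(2) S(1)])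
    then show ?thesis by (simp add: S_def)
  qed simp
  show thesis by (rule that[OF tc cong inv\<gamma>'])
qed

section \<open>Coding by labels\<close>

lemma loc_const_continuous: "loc_const f \<Longrightarrow> continuous_on X f"
  unfolding continuous_on_topological loc_const_def eventually_nhd by (metis IntI)

text \<open>The label of a tile records the labels at all points of the tile one level below, which makes
  the tilings deterministic.\<close>

primrec label :: "(nat \<Rightarrow> 'x \<Rightarrow> 'g) \<Rightarrow> nat \<Rightarrow> 'x \<Rightarrow> nat" where
  "label \<gamma> 0 x = 1"
| "label \<gamma> (Suc k) x =
     (let I = (\<lambda>x. (\<lambda>c. (c, label \<gamma> k (\<phi> c x))) ` cell X (\<gamma> (Suc k)) x)
      in if \<gamma> (Suc k) x = \<one> then Suc (to_nat_on (I ` X) (I x)) else 0)"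

context
  fixes \<gamma> :: "nat \<Rightarrow> 'x \<Rightarrow> 'g"
  assumes tc: "\<And>k. tiling_cocycle (\<gamma> k)"
    and \<gamma>0: "\<And>x. x \<in> X \<Longrightarrow> \<gamma> 0 x = \<one>"
    and cong: "\<And>k x. x \<in> X \<Longrightarrow> \<gamma> (Suc k) x = \<gamma> (Suc k) (\<phi> (\<gamma> k x) x) \<otimes> \<gamma> k x"
begin

lemma cocycle: "loc_const (\<gamma> k)" "x \<in> X \<Longrightarrow> \<gamma> k x \<in> carrier G" "x \<in> X \<Longrightarrow> \<gamma> k (\<phi> (\<gamma> k x) x) = \<one>"
  using tc[of k] by (auto simp: tiling_cocycle_def)

lemma finite_cell_cocycle: "x \<in> X \<Longrightarrow> finite (cell X (\<gamma> k) x)"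
  using finite_cell[of "\<gamma> k"] cocycle by blast

definition pattern :: "nat \<Rightarrow> 'x \<Rightarrow> ('g \<times> nat) set" where
  "pattern k x = (\<lambda>c. (c, label \<gamma> k (\<phi> c x))) ` cell X (\<gamma> (Suc k)) x"

lemma label_Suc:
  "label \<gamma> (Suc k) x = (if \<gamma> (Suc k) x = \<one> then Suc (to_nat_on (pattern k ` X) (pattern k x)) else 0)"
  by (simp add: pattern_def[abs_def] Let_def)

lemma loc_const_pattern:
  assumes "loc_const (label \<gamma> k)"
  shows "loc_const (pattern k)"
proof -
  define D where "D = displacements (\<gamma> (Suc k)) \<times> label \<gamma> k ` X"
  have dG: "displacements (\<gamma> (Suc k)) \<subseteq> carrier G" "finite (displacements (\<gamma> (Suc k)))"
    using displacements_subset finite_displacements cocycle by blast+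
  have D: "finite D" using dG loc_const_finite[OF assms] by (simp add: D_def)
  have "loc_const (\<lambda>x. {p \<in> D. fst p \<in> cell X (\<gamma> (Suc k)) x \<and> snd p = label \<gamma> k (\<phi> (fst p) x)})"
  proof (rule loc_const_Collect[OF D])
    fix p assume p: "p \<in> D"
    have "loc_const (cell X (\<gamma> (Suc k)))" using loc_const_cell[OF cocycle(1,2) clopen_space] .
    moreover have "loc_const (\<lambda>x. label \<gamma> k (\<phi> (fst p) x))"
      using p dG assms by (intro loc_const_act) (auto simp: D_def)
    ultimately show "loc_const (\<lambda>x. fst p \<in> cell X (\<gamma> (Suc k)) x \<and> snd p = label \<gamma> k (\<phi> (fst p) x))"
      by (rule loc_const_comp2)
  qed
  moreover have "{p \<in> D. fst p \<in> cell X (\<gamma> (Suc k)) x \<and> snd p = label \<gamma> k (\<phi> (fst p) x)} = pattern k x"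
    if x: "x \<in> X" for x
  proof -
    have "c \<in> displacements (\<gamma> (Suc k)) \<and> \<phi> c x \<in> X" if "c \<in> cell X (\<gamma> (Suc k)) x" for c
      using cell_subset[OF cocycle(1,2) x] that by (auto simp: cell_def)
    then show ?thesis by (auto simp: D_def pattern_def)
  qed
  ultimately show ?thesis using loc_const_cong by (metis (no_types, lifting))
qed

lemma loc_const_label: "loc_const (label \<gamma> k)"
proof (induction k)
  case (Suc k)
  have "loc_const (\<lambda>x. if \<gamma> (Suc k) x = \<one> then Suc (to_nat_on (pattern k ` X) (pattern k x)) else 0)"
    using cocycle(1) loc_const_pattern[OF Suc.IH] by (rule loc_const_comp2)
  then show ?case unfolding label_Suc[abs_def] .
qed simp

text \<open>Patterns are numbered through \<open>Suc\<close>, which leaves 0 for the points that are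
  not centers.\<close>

lemma label_eq_0: "x \<in> X \<Longrightarrow> label \<gamma> k x = 0 \<longleftrightarrow> \<gamma> k x \<noteq> \<one>"
  using \<gamma>0 by (cases k) (simp_all add: label_Suc del: label.simps(2))

text \<open>The numbering is injective on the finite set of patterns, and the first components of a
  pattern recover the cell.\<close>

lemma label_Suc_eq:
  assumes "x \<in> X" "x' \<in> X" "label \<gamma> (Suc k) x = label \<gamma> (Suc k) x'" "label \<gamma> (Suc k) x \<noteq> 0"
  shows "cell X (\<gamma> (Suc k)) x = cell X (\<gamma> (Suc k)) x'"
    and "c \<in> cell X (\<gamma> (Suc k)) x \<Longrightarrow> label \<gamma> k (\<phi> c x) = label \<gamma> k (\<phi> c x')"
proof -
  have "countable (pattern k ` X)"
    using loc_const_finite[OF loc_const_pattern[OF loc_const_label]] by (rule countable_finite)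
  moreover have "to_nat_on (pattern k ` X) (pattern k x) = to_nat_on (pattern k ` X) (pattern k x')"
    using assms(3,4) by (auto simp: label_Suc simp del: label.simps(2) split: if_splits)
  ultimately have eq: "pattern k x = pattern k x'"
    using assms(1,2) by (simp add: inj_on_eq_iff[OF inj_on_to_nat_on])
  have "fst ` pattern k z = cell X (\<gamma> (Suc k)) z" for z
    by (force simp: pattern_def)
  then show "cell X (\<gamma> (Suc k)) x = cell X (\<gamma> (Suc k)) x'" using eq by metis
  assume "c \<in> cell X (\<gamma> (Suc k)) x"
  then have "(c, label \<gamma> k (\<phi> c x)) \<in> pattern k x'" unfolding eq[symmetric] by (auto simp: pattern_def)
  then show "label \<gamma> k (\<phi> c x) = label \<gamma> k (\<phi> c x')" by (auto simp: pattern_def)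
qed

lemma label_eq_cell:
  assumes "x \<in> X" "x' \<in> X" "label \<gamma> k x = label \<gamma> k x'" "label \<gamma> k x \<noteq> 0"
  shows "cell X (\<gamma> k) x = cell X (\<gamma> k) x'"
proof (cases k)
  case 0
  have "cell X (\<gamma> 0) z = {\<one>}" if "z \<in> X" for z
    using that \<gamma>0 by (auto simp: cell_def) (metis inv_inv inv_one)
  then show ?thesis using 0 assms by simp
qed (use label_Suc_eq(1) assms in blast)

text \<open>Any representative would do, since equal nonzero labels force equal cells by
  \<open>label_eq_cell\<close>.\<close>

definition shapes :: "nat \<Rightarrow> nat \<Rightarrow> 'g set" where
  "shapes k l = cell X (\<gamma> k) (SOME x. x \<in> X \<and> label \<gamma> k x = l)"

definition labels :: "nat \<Rightarrow> nat set" where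
  "labels k = label \<gamma> k ` X - {0}"

definition code :: "'x \<Rightarrow> nat \<Rightarrow> 'g \<Rightarrow> nat" where
  "code x k = (\<lambda>g\<in>carrier G. label \<gamma> k (\<phi> g x))"

lemma shapes_label:
  assumes "x \<in> X" "label \<gamma> k x \<noteq> 0"
  shows "shapes k (label \<gamma> k x) = cell X (\<gamma> k) x"
proof -
  have "\<exists>x'. x' \<in> X \<and> label \<gamma> k x' = label \<gamma> k x" using assms by blast
  from someI_ex[OF this] show ?thesis
    unfolding shapes_def using label_eq_cell assms by metis
qed

lemma labelsE:
  assumes "l \<in> labels k"
  obtains x where "x \<in> X" "label \<gamma> k x = l" "l \<noteq> 0" "shapes k l = cell X (\<gamma> k) x"
  using assms shapes_label by (auto simp: labels_def)

section \<open>Tiles as fibres of the center map\<close>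

lemma cell_r_coset:
  assumes "x \<in> X" "c \<in> carrier G"
  shows "cell X (\<gamma> k) (\<phi> c x) #> c = {g \<in> carrier G. \<gamma> k (\<phi> g x) \<otimes> g = c}"
proof
  have *: "\<gamma> k (\<phi> (s \<otimes> c) x) \<otimes> (s \<otimes> c) = c \<longleftrightarrow> \<gamma> k (\<phi> s (\<phi> c x)) = inv s" if s: "s \<in> carrier G" for s
  proof -
    have e: "\<phi> s (\<phi> c x) = \<phi> (s \<otimes> c) x" using assms s by (simp add: act_mult)
    have g: "\<gamma> k (\<phi> (s \<otimes> c) x) \<in> carrier G" using assms s cocycle(2) by simp
    have "\<gamma> k (\<phi> (s \<otimes> c) x) \<otimes> (s \<otimes> c) = c \<longleftrightarrow> \<gamma> k (\<phi> (s \<otimes> c) x) \<otimes> s \<otimes> c = \<one> \<otimes> c"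
      using g s assms by (simp add: m_assoc)
    also have "\<dots> \<longleftrightarrow> \<gamma> k (\<phi> (s \<otimes> c) x) \<otimes> s = \<one>" using g s assms by (intro right_cancel) auto
    also have "\<dots> \<longleftrightarrow> \<gamma> k (\<phi> (s \<otimes> c) x) = inv s" using g s by (metis inv_equality inv_inv l_inv)
    finally show ?thesis using e by simp
  qed
  show "cell X (\<gamma> k) (\<phi> c x) #> c \<subseteq> {g \<in> carrier G. \<gamma> k (\<phi> g x) \<otimes> g = c}"
    using * assms by (auto simp: r_coset_def cell_def)
  show "{g \<in> carrier G. \<gamma> k (\<phi> g x) \<otimes> g = c} \<subseteq> cell X (\<gamma> k) (\<phi> c x) #> c"
  proof
    fix g assume g: "g \<in> {g \<in> carrier G. \<gamma> k (\<phi> g x) \<otimes> g = c}"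
    have gs: "g \<otimes> inv c \<in> carrier G" "g \<otimes> inv c \<otimes> c = g" using g assms by (auto simp: m_assoc)
    then have "\<gamma> k (\<phi> (g \<otimes> inv c) (\<phi> c x)) = inv (g \<otimes> inv c)"
      using *[OF gs(1)] g by simp
    then have "g \<otimes> inv c \<in> cell X (\<gamma> k) (\<phi> c x)" using gs assms by (simp add: cell_def)
    then show "g \<in> cell X (\<gamma> k) (\<phi> c x) #> c" using gs(2) unfolding r_coset_def by force
  qed
qed

lemma centers_code: "x \<in> X \<Longrightarrow> centers G (code x k) = {c \<in> carrier G. \<gamma> k (\<phi> c x) = \<one>}"
  by (auto simp: centers_def code_def label_eq_0 simp del: neq0_conv)

text \<open>The center of the tile containing g in the tiling of x. Tiles are the fibres of this
  map, which reduces the partition property, congruence and disjointness to statements about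
  functions.\<close>

definition center :: "nat \<Rightarrow> 'x \<Rightarrow> 'g \<Rightarrow> 'g" where
  "center k x g = \<gamma> k (\<phi> g x) \<otimes> g"

lemma center_mem: "x \<in> X \<Longrightarrow> g \<in> carrier G \<Longrightarrow> center k x g \<in> centers G (code x k)"
  using cocycle by (simp add: centers_code center_def act_mult[symmetric])

lemma center_center: "x \<in> X \<Longrightarrow> c \<in> centers G (code x k) \<Longrightarrow> center k x c = c"
  by (simp add: centers_code center_def)

lemma tile_code:
  assumes "x \<in> X" "c \<in> centers G (code x k)"
  shows "tile G (shapes k) (code x k) c = {g \<in> carrier G. center k x g = c}"
proof -
  have c: "c \<in> carrier G" "\<gamma> k (\<phi> c x) = \<one>" using assms by (auto simp: centers_code)
  then have "label \<gamma> k (\<phi> c x) \<noteq> 0" using label_eq_0[of "\<phi> c x" k] assms by simp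
  then show ?thesis
    using c assms shapes_label[of "\<phi> c x" k] cell_r_coset[OF assms(1) c(1), of k]
    by (simp add: tile_def code_def center_def)
qed

text \<open>The identity \<open>cong\<close> read along an orbit: the coarse center of g depends on
  g only through its fine center, which is the content of congruence.\<close>

lemma center_Suc:
  assumes "x \<in> X" "g \<in> carrier G"
  shows "center (Suc k) x (center k x g) = center (Suc k) x g"
proof -
  define y where "y = \<phi> g x"
  have y: "y \<in> X" using assms by (simp add: y_def)
  have e: "\<phi> (center k x g) x = \<phi> (\<gamma> k y) y"
    using assms cocycle(2)[OF y] by (simp add: center_def y_def act_mult)
  have G: "\<gamma> (Suc k) (\<phi> (\<gamma> k y) y) \<in> carrier G" "\<gamma> k y \<in> carrier G" using y cocycle by auto
  have "center (Suc k) x (center k x g) = \<gamma> (Suc k) (\<phi> (\<gamma> k y) y) \<otimes> (\<gamma> k y \<otimes> g)"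
    unfolding center_def[of "Suc k"] e by (simp add: center_def y_def)
  also have "\<dots> = \<gamma> (Suc k) (\<phi> (\<gamma> k y) y) \<otimes> \<gamma> k y \<otimes> g" using G assms by (simp add: m_assoc)
  also have "\<dots> = center (Suc k) x g" using cong[OF y] by (simp add: center_def y_def)
  finally show ?thesis .
qed

lemma is_tiling_code: "x \<in> X \<Longrightarrow> is_tiling G (shapes k) (code x k)"
proof -
  assume x: "x \<in> X"
  have self: "c \<in> tile G (shapes k) (code x k) c" if "c \<in> centers G (code x k)" for c
    using tile_code[OF x that] center_center[OF x that] that by (simp add: centers_def)
  have "\<Union>(tiles G (shapes k) (code x k)) = carrier G"
    using tile_code[OF x] center_mem[OF x] by (auto simp: tiles_def)
  moreover have "disjoint (tiles G (shapes k) (code x k))"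
    using tile_code[OF x] by (auto simp: tiles_def disjoint_def)
  moreover have "{} \<notin> tiles G (shapes k) (code x k)" using self by (auto simp: tiles_def)
  moreover have "inj_on (tile G (shapes k) (code x k)) (centers G (code x k))"
  proof (rule inj_onI)
    fix c c' assume c: "c \<in> centers G (code x k)" "c' \<in> centers G (code x k)"
      "tile G (shapes k) (code x k) c = tile G (shapes k) (code x k) c'"
    then have "c \<in> tile G (shapes k) (code x k) c'" using self by blast
    then show "c = c'" using tile_code[OF x c(2)] center_center[OF x c(1)] by simp
  qed
  ultimately show ?thesis by (simp add: is_tiling_def partition_on_def)
qed

lemma shape_collection_labels: "shape_collection G (labels k) (shapes k)"
proof -
  have "finite (labels k)" using loc_const_finite[OF loc_const_label] by (simp add: labels_def)
  moreover have "finite (shapes k l) \<and> shapes k l \<subseteq> carrier G \<and> \<one> \<in> shapes k l" if l: "l \<in> labels k" for l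
  proof -
    obtain x where x: "x \<in> X" "label \<gamma> k x = l" "l \<noteq> 0" "shapes k l = cell X (\<gamma> k) x"
      using l by (rule labelsE)
    then have "\<gamma> k x = \<one>" using label_eq_0[OF x(1), of k] by simp
    then show ?thesis using x finite_cell_cocycle[OF x(1)] by (auto simp: cell_def)
  qed
  ultimately show ?thesis by (simp add: shape_collection_def labels_def)
qed

section \<open>The coded tiling system\<close>

lemma shift_code: "x \<in> X \<Longrightarrow> g \<in> carrier G \<Longrightarrow> shift G g (code x k) = code (\<phi> g x) k"
  by (auto simp: shift_def code_def act_mult)

lemma product_shift_code: "x \<in> X \<Longrightarrow> g \<in> carrier G \<Longrightarrow> product_action (shift G) g (code x) = code (\<phi> g x)"
  by (simp add: product_action_def shift_code fun_eq_iff)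

lemma continuous_code_coordinate: "continuous_on X (\<lambda>x. code x k)"
proof (rule continuous_on_coordinatewise_then_product)
  fix g
  show "continuous_on X (\<lambda>x. code x k g)"
  proof (cases "g \<in> carrier G")
    case True
    then show ?thesis
      using loc_const_continuous[OF loc_const_act[OF True loc_const_label]] by (simp add: code_def)
  qed (simp add: code_def)
qed

lemma continuous_code: "continuous_on X code"
  by (rule continuous_on_coordinatewise_then_product) (rule continuous_code_coordinate)

lemma subshift_code: "subshift G (insert 0 (labels k)) ((\<lambda>x. code x k) ` X)"
  unfolding subshift_def
proof (intro conjI ballI)
  show "(\<lambda>x. code x k) ` X \<noteq> {}" using nonempty_space by blast
  have "(\<lambda>x. code x k) ` X \<subseteq> carrier G \<rightarrow>\<^sub>E insert 0 (labels k)"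
    by (auto simp: code_def labels_def)
  then show "closedin (top_of_set (carrier G \<rightarrow>\<^sub>E insert 0 (labels k))) ((\<lambda>x. code x k) ` X)"
    using compact_continuous_image[OF continuous_code_coordinate compact_space]
    by (intro compact_closedin Hausdorff_fun Hausdorff_discrete)
  show "shift G g t \<in> (\<lambda>x. code x k) ` X" if "g \<in> carrier G" "t \<in> (\<lambda>x. code x k) ` X" for g t
    using that shift_code act_closed by (auto intro!: image_eqI)
qed

lemma joining_code: "joining G (shift G) (\<lambda>k. (\<lambda>x. code x k) ` X) (code ` X)"
  unfolding joining_def
proof (intro conjI ballI allI)
  have "code ` X \<subseteq> (\<Pi>\<^sub>E k\<in>UNIV. (\<lambda>x. code x k) ` X)" by auto
  then show "closedin (top_of_set (\<Pi>\<^sub>E k\<in>UNIV. (\<lambda>x. code x k) ` X)) (code ` X)"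
    using compact_continuous_image[OF continuous_code compact_space]
    by (intro compact_closedin Hausdorff_fun Hausdorff_discrete)
  show "product_action (shift G) g z \<in> code ` X" if "g \<in> carrier G" "z \<in> code ` X" for g z
    using that product_shift_code by auto
  show "(\<lambda>z. z k) ` code ` X = (\<lambda>x. code x k) ` X" for k by (simp add: image_image)
qed

lemma congruent_code: "congruent_tilings G shapes (code ` X)"
  unfolding congruent_tilings_def
proof (intro ballI allI)
  fix z k U assume z: "z \<in> code ` X" and U: "U \<in> tiles G (shapes (Suc k)) (z (Suc k))"
  then obtain x where x: "x \<in> X" "z = code x" by blast
  then obtain c where c: "c \<in> centers G (code x (Suc k))"
    "U = {g \<in> carrier G. center (Suc k) x g = c}"
    using U tile_code[OF x(1)] by (auto simp: tiles_def)
  define \<U> where "\<U> = (\<lambda>g. {h \<in> carrier G. center k x h = center k x g}) ` U"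
  have "U = \<Union>\<U>"
  proof
    show "U \<subseteq> \<Union>\<U>" using c(2) by (auto simp: \<U>_def)
    show "\<Union>\<U> \<subseteq> U"
    proof
      fix h assume "h \<in> \<Union>\<U>"
      then obtain g where "g \<in> U" "h \<in> carrier G" "center k x h = center k x g" by (auto simp: \<U>_def)
      then show "h \<in> U" using center_Suc[OF x(1), of h k] center_Suc[OF x(1), of g k] c(2) by simp
    qed
  qed
  moreover have "\<U> \<subseteq> tiles G (shapes k) (z k)"
  proof
    fix V assume "V \<in> \<U>"
    then obtain g where g: "g \<in> carrier G" "V = {h \<in> carrier G. center k x h = center k x g}"
      using c(2) by (auto simp: \<U>_def)
    then have "V = tile G (shapes k) (code x k) (center k x g)"
      using tile_code[OF x(1) center_mem[OF x(1) g(1)]] by simp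
    then show "V \<in> tiles G (shapes k) (z k)"
      using center_mem[OF x(1) g(1)] x(2) by (auto simp: tiles_def)
  qed
  ultimately show "\<exists>\<U>\<subseteq>tiles G (shapes k) (z k). U = \<Union>\<U>" by blast
qed

lemma deterministic_code: "deterministic_tilings G labels shapes (code ` X)"
  unfolding deterministic_tilings_def
proof (intro allI ballI)
  fix k l' assume "l' \<in> labels (Suc k)"
  then obtain x where x: "x \<in> X" "label \<gamma> (Suc k) x = l'" "l' \<noteq> 0"
    and sh: "shapes (Suc k) l' = cell X (\<gamma> (Suc k)) x" by (rule labelsE)
  have \<gamma>x: "\<gamma> (Suc k) x = \<one>" using label_eq_0[OF x(1), of "Suc k"] x by simp
  \<comment> \<open>Coordinates are taken at the representative x, whose own tile is centered at
    \<one>.\<close>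
  have sub: "s \<in> shapes (Suc k) l' \<longleftrightarrow> s \<in> carrier G \<and> center (Suc k) x s = \<one>" for s
    using cell_r_coset[OF x(1) one_closed, of "Suc k"] x(1)
    unfolding sh by (simp add: r_coset_def center_def cell_def set_eq_iff)
  \<comment> \<open>Relative centers are read off at x; \<open>label_Suc_eq\<close> carries them
    over to every other point with the label \<open>l'\<close>.\<close>
  define C where "C l = {c \<in> shapes (Suc k) l'. label \<gamma> k (\<phi> c x) = l}" for l
  have piece: "shapes k l #> c = {g \<in> carrier G. center k x g = c}" if "l \<in> labels k" "c \<in> C l" for l c
  proof -
    have cG: "c \<in> carrier G" "label \<gamma> k (\<phi> c x) = l" "l \<noteq> 0" using that sub by (auto simp: C_def labels_def)
    then show ?thesis
      using shapes_label[of "\<phi> c x" k] x(1) cell_r_coset[OF x(1) cG(1), of k] by (simp add: center_def)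
  qed
  show "\<exists>C. (\<forall>l\<in>labels k. C l \<subseteq> shapes (Suc k) l') \<and>
      shapes (Suc k) l' = (\<Union>l\<in>labels k. \<Union>c\<in>C l. shapes k l #> c) \<and>
      disjoint_family_on (\<lambda>(l, c). shapes k l #> c) (SIGMA l:labels k. C l) \<and>
      (\<forall>z\<in>code ` X. \<forall>c'\<in>carrier G. z (Suc k) c' = l' \<longrightarrow>
         (\<forall>l\<in>labels k. \<forall>c\<in>C l. z k (c \<otimes> c') = l))"
  proof (intro exI[of _ C] conjI ballI impI)
    show "C l \<subseteq> shapes (Suc k) l'" for l by (auto simp: C_def)
    show "shapes (Suc k) l' = (\<Union>l\<in>labels k. \<Union>c\<in>C l. shapes k l #> c)"
    proof
      show "shapes (Suc k) l' \<subseteq> (\<Union>l\<in>labels k. \<Union>c\<in>C l. shapes k l #> c)"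
      proof
        fix s assume s: "s \<in> shapes (Suc k) l'"
        define c where "c = center k x s"
        have sG: "s \<in> carrier G" using s sub by blast
        have c: "c \<in> centers G (code x k)" using center_mem[OF x(1) sG] by (simp add: c_def)
        then have cG: "c \<in> carrier G" by (simp add: centers_def)
        have "center (Suc k) x c = \<one>" using center_Suc[OF x(1) sG, of k] s sub by (simp add: c_def)
        then have cS: "c \<in> shapes (Suc k) l'" using sub cG by simp
        have "label \<gamma> k (\<phi> c x) \<noteq> 0" using c cG by (simp add: centers_def code_def)
        then have l: "label \<gamma> k (\<phi> c x) \<in> labels k" using cG x(1) by (auto simp: labels_def)
        have "c \<in> C (label \<gamma> k (\<phi> c x))" using cS by (simp add: C_def)
        moreover from piece[OF l this] have "s \<in> shapes k (label \<gamma> k (\<phi> c x)) #> c"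
          using sG by (simp add: c_def)
        ultimately show "s \<in> (\<Union>l\<in>labels k. \<Union>c\<in>C l. shapes k l #> c)" using l by blast
      qed
      show "(\<Union>l\<in>labels k. \<Union>c\<in>C l. shapes k l #> c) \<subseteq> shapes (Suc k) l'"
      proof
        fix s assume "s \<in> (\<Union>l\<in>labels k. \<Union>c\<in>C l. shapes k l #> c)"
        then obtain l c where lc: "l \<in> labels k" "c \<in> C l" "s \<in> shapes k l #> c" by blast
        then have s: "s \<in> carrier G" "center k x s = c" using piece by auto
        have "c \<in> shapes (Suc k) l'" using lc by (simp add: C_def)
        then show "s \<in> shapes (Suc k) l'" using sub center_Suc[OF x(1) s(1), of k] s by simp
      qed
    qed
    show "disjoint_family_on (\<lambda>(l, c). shapes k l #> c) (SIGMA l:labels k. C l)"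
      unfolding disjoint_family_on_def
    proof (intro ballI impI, rule ccontr)
      fix p q
      assume pq: "p \<in> (SIGMA l:labels k. C l)" "q \<in> (SIGMA l:labels k. C l)" "p \<noteq> q"
        "(case p of (l, c) \<Rightarrow> shapes k l #> c) \<inter> (case q of (l, c) \<Rightarrow> shapes k l #> c) \<noteq> {}"
      obtain l c m d where "p = (l, c)" "q = (m, d)" by (metis surj_pair)
      then have *: "l \<in> labels k" "c \<in> C l" "m \<in> labels k" "d \<in> C m" "(l, c) \<noteq> (m, d)"
        "(shapes k l #> c) \<inter> (shapes k m #> d) \<noteq> {}" using pq by auto
      then have "c = d" using piece[OF *(1,2)] piece[OF *(3,4)] by auto
      then show False using * by (simp add: C_def)
    qed
    fix z c' l c
    assume z: "z \<in> code ` X" and c': "c' \<in> carrier G" "z (Suc k) c' = l'"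
      and l: "l \<in> labels k" and c: "c \<in> C l"
    obtain y where y: "y \<in> X" "z = code y" using z by blast
    have cc: "c \<in> cell X (\<gamma> (Suc k)) x" "label \<gamma> k (\<phi> c x) = l" using c sh by (auto simp: C_def)
    then have cG: "c \<in> carrier G" by (simp add: cell_def)
    have "label \<gamma> (Suc k) x = label \<gamma> (Suc k) (\<phi> c' y)" using c' y x(2) by (simp add: code_def del: label.simps)
    from label_Suc_eq(2)[OF x(1) _ this _ cc(1)] have "label \<gamma> k (\<phi> c x) = label \<gamma> k (\<phi> c (\<phi> c' y))"
      using x y c' by (simp del: label.simps)
    then show "z k (c \<otimes> c') = l" using cc y c' cG by (simp add: code_def act_mult)
  qed
qed

text \<open>Empty cells are exempted because Folner invariance is a strict inequality and fails for
  the empty set; shapes are never empty, as they contain \<one>.\<close>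

lemma tiling_system_code:
  assumes Folner: "\<And>K \<epsilon>. finite K \<and> K \<noteq> {} \<and> K \<subseteq> carrier G \<and> 0 < \<epsilon> \<Longrightarrow>
    \<forall>\<^sub>F k in sequentially. \<forall>v\<in>X. cell X (\<gamma> k) v \<noteq> {} \<longrightarrow> Folner_invariant G K \<epsilon> (cell X (\<gamma> k) v)"
  shows "has_tiling_system_factor G X \<phi>"
proof -
  have dyn: "dynamical_tiling G (labels k) (shapes k) ((\<lambda>x. code x k) ` X)" for k
    unfolding dynamical_tiling_def using shape_collection_labels subshift_code is_tiling_code by blast
  have Fol: "\<forall>\<^sub>F k in sequentially. \<forall>l\<in>labels k. Folner_invariant G K \<epsilon> (shapes k l)"
    if "finite K \<and> K \<noteq> {} \<and> K \<subseteq> carrier G \<and> 0 < \<epsilon>" for K \<epsilon>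
    using Folner[OF that]
  proof eventually_elim
    case (elim k)
    show ?case
    proof
      fix l assume l: "l \<in> labels k"
      then have "\<one> \<in> shapes k l" using shape_collection_labels[of k] by (simp add: shape_collection_def)
      moreover obtain x where "x \<in> X" "shapes k l = cell X (\<gamma> k) x" using l by (rule labelsE)
      ultimately show "Folner_invariant G K \<epsilon> (shapes k l)" using elim by auto
    qed
  qed
  have "tiling_system G labels shapes (\<lambda>k. (\<lambda>x. code x k) ` X) (code ` X)"
    unfolding tiling_system_def Folner_system_def
    using dyn joining_code Fol congruent_code deterministic_code by blast
  moreover have "factor_map G X \<phi> (code ` X) (product_action (shift G)) code"
    unfolding factor_map_def using continuous_code product_shift_code by auto
  ultimately show ?thesis
    unfolding has_tiling_system_factor_def topological_factor_def by blast
qed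

end

section \<open>All levels by dependent choice\<close>

theorem comparison_tiling_factor:
  assumes free: "free_system G X \<phi>" and am: "amenable G" and comp: "admits_comparison G X \<phi>"
    and inf: "infinite (carrier G)" and count: "countable (carrier G)"
  shows "has_tiling_system_factor G X \<phi>"
proof -
  have exact: "\<exists>\<delta>. loc_const \<delta> \<and> (\<forall>x\<in>X. \<delta> x \<in> carrier G) \<and> (\<forall>v\<in>X. almost_inv G K \<kappa> (cell X \<delta> v))"
    if "finite K" "K \<subseteq> carrier G" "0 < \<kappa>" for K \<kappa>
    by (rule exact_castle[OF free am comp inf that]) blast
  define e where "e = from_nat_into (carrier G)"
  have e: "range e = carrier G" unfolding e_def using count by (intro range_from_nat_into) auto
  define Ks where "Ks n = e ` {..<n}" for n :: nat
  have Ks: "finite (Ks n)" "Ks n \<subseteq> carrier G" for n using e by (auto simp: Ks_def)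
  \<comment> \<open>Level 0 is the partition into singletons, with no invariance asserted; level n
    \<ge> 1 handles the first n elements of an enumeration of G up to 1/(n+1).\<close>
  define P where "P n \<gamma> \<longleftrightarrow> tiling_cocycle \<gamma> \<and> (if n = 0 then \<forall>x\<in>X. \<gamma> x = \<one>
      else \<forall>v\<in>X. almost_inv G (Ks n) (1 / real (Suc n)) (cell X \<gamma> v))" for n \<gamma>
  have "\<exists>\<gamma>. \<forall>n. P n (\<gamma> n) \<and> (\<forall>x\<in>X. \<gamma> (Suc n) x = \<gamma> (Suc n) (\<phi> (\<gamma> n x) x) \<otimes> \<gamma> n x)"
  proof (rule dependent_nat_choice[where Q = "\<lambda>n \<gamma> \<gamma>'. \<forall>x\<in>X. \<gamma>' x = \<gamma>' (\<phi> (\<gamma> x) x) \<otimes> \<gamma> x"])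
    show "\<exists>\<gamma>. P 0 \<gamma>" by (rule exI[of _ "\<lambda>_. \<one>"]) (simp add: P_def tiling_cocycle_def)
    fix \<gamma> n assume "P n \<gamma>"
    then have tc: "tiling_cocycle \<gamma>" by (simp add: P_def)
    have pos: "0 < 1 / real (Suc (Suc n))" by simp
    obtain \<gamma>' where "tiling_cocycle \<gamma>'" "\<And>x. x \<in> X \<Longrightarrow> \<gamma>' x = \<gamma>' (\<phi> (\<gamma> x) x) \<otimes> \<gamma> x"
      "\<And>v. v \<in> X \<Longrightarrow> almost_inv G (Ks (Suc n)) (1 / real (Suc (Suc n))) (cell X \<gamma>' v)"
      by (rule coarsening[OF tc Ks pos exact]) auto
    then show "\<exists>\<gamma>'. P (Suc n) \<gamma>' \<and> (\<forall>x\<in>X. \<gamma>' x = \<gamma>' (\<phi> (\<gamma> x) x) \<otimes> \<gamma> x)"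
      by (intro exI[of _ \<gamma>']) (simp add: P_def)
  qed
  then obtain \<gamma> where P: "\<And>n. P n (\<gamma> n)"
    and cong: "\<And>n x. x \<in> X \<Longrightarrow> \<gamma> (Suc n) x = \<gamma> (Suc n) (\<phi> (\<gamma> n x) x) \<otimes> \<gamma> n x"
    by blast
  show ?thesis
  proof (rule tiling_system_code[of \<gamma>])
    show "tiling_cocycle (\<gamma> k)" for k using P[of k] by (simp add: P_def)
    show "\<gamma> 0 x = \<one>" if "x \<in> X" for x using P[of 0] that by (simp add: P_def)
    show "\<gamma> (Suc k) x = \<gamma> (Suc k) (\<phi> (\<gamma> k x) x) \<otimes> \<gamma> k x" if "x \<in> X" for k x using cong[OF that] .
    fix K and \<epsilon> :: real assume K: "finite K \<and> K \<noteq> {} \<and> K \<subseteq> carrier G \<and> 0 < \<epsilon>"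
    then obtain C where C: "finite C" "K = e ` C" using e finite_subset_image[of K e UNIV] by auto
    obtain N where N: "C \<subseteq> {..<N}" using C(1) finite_nat_iff_bounded by blast
    obtain M :: nat where M: "2 / \<epsilon> < real M" using reals_Archimedean2 by blast
    show "\<forall>\<^sub>F k in sequentially. \<forall>v\<in>X. cell X (\<gamma> k) v \<noteq> {} \<longrightarrow> Folner_invariant G K \<epsilon> (cell X (\<gamma> k) v)"
      unfolding eventually_sequentially
    \<comment> \<open>N puts K into \<open>Ks k\<close>, M makes twice the tolerance smaller than
      \<epsilon>, the 2 being the price of two-sided invariance, and the final 1 excludes level
      0.\<close>
    proof (intro exI[of _ "N + M + 1"] allI impI ballI)
      fix k v assume k: "N + M + 1 \<le> k" and v: "v \<in> X" "cell X (\<gamma> k) v \<noteq> {}"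
      have inv: "almost_inv G (Ks k) (1 / real (Suc k)) (cell X (\<gamma> k) v)"
        using P[of k] k v by (simp add: P_def)
      have KK: "K \<subseteq> Ks k" using C N k by (force simp: Ks_def)
      have "2 / \<epsilon> < real (Suc k)" using M k by linarith
      then have "2 * (1 / real (Suc k)) < \<epsilon>"
        using K by (simp add: pos_divide_less_eq mult.commute)
      then show "Folner_invariant G K \<epsilon> (cell X (\<gamma> k) v)"
        using Folner_invariant_of_almost_inv[OF inv v(2) Ks(1) KK _ Ks(2)] K by simp
    qed
  qed
qed

end

theorem corollary7p6:
  fixes G :: "('g, 'm) monoid_scheme"
    and X :: "'x::metric_space set"
    and \<phi> :: "'g \<Rightarrow> 'x \<Rightarrow> 'x"
  assumes "group G" "countable (carrier G)" "infinite (carrier G)" "amenable G"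
    and "topological_system G X \<phi>" "zero_dimensional X"
  shows "(free_system G X \<phi> \<longrightarrow> (has_tiling_system_factor G X \<phi> \<longleftrightarrow> admits_comparison G X \<phi>))
       \<and> (has_tiling_system_factor G X \<phi> \<longrightarrow> admits_comparison G X \<phi>)"
proof -
  interpret zero_dim_system G X \<phi>
    using assms(5,6) by (simp add: zero_dim_system_def zero_dim_system_axioms_def)
  show ?thesis
    using tiling_factor_comparison comparison_tiling_factor assms(2-4) by blast
qed

end
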